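(* Let $S,g_0,\omega,\Lambda$, $g$, $g_\varepsilon$ and $F_\varepsilon$ be as in the context, and assume that there exists $\bar\varepsilon\in(0,1]$ such that all intersections $\bar B^+_{\bar\varepsilon}(x,r)\cap\bar B^-_{\bar\varepsilon}(y,s)$, $x,y\in S$, $r,s>0$, of closed forward and closed backward balls of $F_{\bar\varepsilon}$ are compact. Let $x_0,x_1\in S$, $t_0\in\mathbb R$, let $\{\varepsilon_n\}$ be a sequence of positive numbers with $\varepsilon_n\to0$, let $\Delta_n>0$ with $\Delta_n\to\Delta\in\mathbb R$, and let $\gamma_n:[t_0,t_0+\Delta_n]\to S\times\mathbb R$ be a sequence of curves parametrized by the time coordinate $t$, $\gamma_n(t)=(\sigma_n(t),t)$, such that $\gamma_n(t_0)=(x_0,t_0)$ and $\gamma_n(t_0+\Delta_n)=(x_1,t_0+\Delta_n)$ for all $n\in\mathbb N$, and such that $\gamma_n$ is a lightlike pregeodesic of $g_{\varepsilon_n}$ for each $n$. Then there exists a subsequence of $\{\gamma_n\}$ that uniformly converges to a future-pointing lightlike pregeodesic of the metric $g$ from $(x_0,t_0)$ to $(x_1,t_0+\Delta)$.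
   Context: $S$ is a connected smooth manifold of finite dimension $m\ge 2$, with a smooth Riemannian metric $g_0$, a smooth one-form $\omega$ and a smooth function $\Lambda:S\to\mathbb R$ with $\Lambda\geq 0$ and $\omega_x\neq 0$ for all $x\in S$. On $S\times\mathbb R$, with $t$ the natural coordinate on $\mathbb R$, consider for $\varepsilon\ge0$ the Lorentzian metrics $$g_\varepsilon=g_0+\omega\otimes dt+dt\otimes\omega-(\Lambda+\varepsilon)dt^2,$$ and let $g$ denote the metric $g_\varepsilon$ with $\varepsilon=0$, i.e. $g=g_0+\omega\otimes dt+dt\otimes\omega-\Lambda dt^2$. A nonzero vector $w$ is lightlike (causal) if its squared norm is $0$ ($\le0$); a causal vector $w$ is future-pointing if $dt(w)>0$. A lightlike pregeodesic is a curve which can be reparametrized as a lightlike geodesic. For $\varepsilon>0$, $F_\varepsilon$ is the Randers metric $$F_\varepsilon(v)=\frac{1}{\Lambda+\varepsilon}\Big(\sqrt{(\Lambda+\varepsilon)g_0(v,v)+\omega^2(v)}+\omega(v)\Big),\quad v\in TS.$$ $d_\varepsilon(x,y)=\inf_\sigma\int_0^1F_\varepsilon(\dot\sigma)\,ds$ over continuous piecewise smooth curves $\sigma:[0,1]\to S$ from $x$ to $y$; $B^+_\varepsilon(x,r)=\{z:d_\varepsilon(x,z)<r\}$, $B^-_\varepsilon(x,r)=\{z:d_\varepsilon(z,x)<r\}$, and $\bar B_\varepsilon^\pm(x,r)$ are their closures. Uniform convergence is with respect to the distance induced by $g_0\oplus dt^2$ on $S\times\mathbb R$. Since the intervals $[t_0,t_0+\Delta_n]$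 vary, each $\gamma_n$ is regarded as extended beyond $t_0+\Delta_n$ by the vertical line $t\mapsto(x_1,t)$, and the (sub)sequence converges uniformly on $[t_0,t_0+\Delta+1]$ to a curve $\gamma(t)=(\sigma(t),t)$ whose restriction to $[t_0,t_0+\Delta]$ is the limit pregeodesic. *)

theory Defs
  imports "HOL-Analysis.Analysis"
begin

section \<open>Smooth maps between open subsets of Euclidean spaces\<close>

primrec Ck_on ::
  "nat \<Rightarrow> ('v::real_normed_vector \<Rightarrow> 'w::real_normed_vector) \<Rightarrow> 'v set \<Rightarrow> bool"
where
  "Ck_on 0 f X \<longleftrightarrow> continuous_on X f"
| "Ck_on (Suc k) f X \<longleftrightarrow>
     (\<forall>x\<in>X. f differentiable (at x)) \<and>
     (\<forall>v. Ck_on k (\<lambda>x. frechet_derivative f (at x) v) X)"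

definition smooth_on ::
  "('v::real_normed_vector \<Rightarrow> 'w::real_normed_vector) \<Rightarrow> 'v set \<Rightarrow> bool" where
  "smooth_on f X \<longleftrightarrow> (\<forall>k. Ck_on k f X)"

text \<open>Smoothness of a function of one real variable, with one-sided derivatives where \<open>T\<close>
  contains an end point: \<open>f k\<close> is the derivative of order \<open>k\<close>. Used only for intervals and
  their relatively open subsets.\<close>

definition smooth_path :: "real set \<Rightarrow> (real \<Rightarrow> 'v::real_normed_vector) \<Rightarrow> bool" where
  "smooth_path T x \<longleftrightarrow>
     (\<exists>f :: nat \<Rightarrow> real \<Rightarrow> 'v. \<forall>t\<in>T. f 0 t = x t \<and>
        (\<forall>k. (f k has_vector_derivative f (Suc k) t) (at t within T)))"


section \<open>Smooth manifolds\<close>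

text \<open>The manifold is the whole type \<open>'a\<close>; its dimension is \<open>DIM('e)\<close>. The charts are
  indexed, so that an atlas of a manifold and the induced atlas of its product with the real
  line share their index set.\<close>

record ('i, 'a, 'e) atlas =
  index :: "'i set"
  chart_dom :: "'i \<Rightarrow> 'a set"
  chart :: "'i \<Rightarrow> 'a \<Rightarrow> 'e"

definition chart_inv :: "('i, 'a, 'e) atlas \<Rightarrow> 'i \<Rightarrow> 'e \<Rightarrow> 'a" where
  "chart_inv A i = inv_into (chart_dom A i) (chart A i)"

definition transition :: "('i, 'a, 'e) atlas \<Rightarrow> 'i \<Rightarrow> 'i \<Rightarrow> 'e \<Rightarrow> 'e" where
  "transition A i j = chart A j \<circ> chart_inv A i"

definition smooth_atlas ::
  "('i, 'a::{t2_space, second_countable_topology}, 'e::euclidean_space) atlas \<Rightarrow> bool" where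
  "smooth_atlas A \<longleftrightarrow>
     (\<Union>i\<in>index A. chart_dom A i) = UNIV \<and>
     (\<forall>i\<in>index A. open (chart_dom A i) \<and> open (chart A i ` chart_dom A i) \<and>
        homeomorphism (chart_dom A i) (chart A i ` chart_dom A i) (chart A i) (chart_inv A i)) \<and>
     (\<forall>i\<in>index A. \<forall>j\<in>index A.
        smooth_on (transition A i j) (chart A i ` (chart_dom A i \<inter> chart_dom A j)))"

definition smooth_function ::
  "('i, 'a, 'e::euclidean_space) atlas \<Rightarrow> ('a \<Rightarrow> real) \<Rightarrow> bool" where
  "smooth_function A f \<longleftrightarrow>
     (\<forall>i\<in>index A. smooth_on (f \<circ> chart_inv A i) (chart A i ` chart_dom A i))"

text \<open>A tangent vector at \<open>x\<close> is given by its components \<open>u\<close> in a chart \<open>i\<close> around \<open>x\<close>; the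
  components in a chart \<open>j\<close> are then \<open>coord_change A i j x u\<close>. Accordingly, functions of
  tangent vectors are written \<open>F i x u\<close> and tensor fields are families of components obeying
  the transformation law.\<close>

definition coord_change ::
  "('i, 'a, 'e::euclidean_space) atlas \<Rightarrow> 'i \<Rightarrow> 'i \<Rightarrow> 'a \<Rightarrow> 'e \<Rightarrow> 'e" where
  "coord_change A i j x u = frechet_derivative (transition A i j) (at (chart A i x)) u"

definition smooth_one_form ::
  "('i, 'a, 'e::euclidean_space) atlas \<Rightarrow> ('i \<Rightarrow> 'a \<Rightarrow> 'e \<Rightarrow> real) \<Rightarrow> bool" where
  "smooth_one_form A \<omega> \<longleftrightarrow>
     (\<forall>i\<in>index A. \<forall>x\<in>chart_dom A i. linear (\<omega> i x)) \<and>
     (\<forall>i\<in>index A. \<forall>j\<in>index A. \<forall>x\<in>chart_dom A i \<inter> chart_dom A j. \<forall>u.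
        \<omega> j x (coord_change A i j x u) = \<omega> i x u) \<and>
     (\<forall>i\<in>index A. \<forall>u.
        smooth_on (\<lambda>p. \<omega> i (chart_inv A i p) u) (chart A i ` chart_dom A i))"

definition riemannian_metric ::
  "('i, 'a, 'e::euclidean_space) atlas \<Rightarrow> ('i \<Rightarrow> 'a \<Rightarrow> 'e \<Rightarrow> 'e \<Rightarrow> real) \<Rightarrow> bool" where
  "riemannian_metric A g \<longleftrightarrow>
     (\<forall>i\<in>index A. \<forall>x\<in>chart_dom A i.
        bilinear (g i x) \<and> (\<forall>u v. g i x u v = g i x v u) \<and> (\<forall>u. u \<noteq> 0 \<longrightarrow> 0 < g i x u u)) \<and>
     (\<forall>i\<in>index A. \<forall>j\<in>index A. \<forall>x\<in>chart_dom A i \<inter> chart_dom A j. \<forall>u v.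
        g j x (coord_change A i j x u) (coord_change A i j x v) = g i x u v) \<and>
     (\<forall>i\<in>index A. \<forall>u v.
        smooth_on (\<lambda>p. g i (chart_inv A i p) u v) (chart A i ` chart_dom A i))"


section \<open>Curves, lengths and distances\<close>

definition smooth_curve ::
  "('i, 'a::topological_space, 'e::euclidean_space) atlas \<Rightarrow> real set \<Rightarrow> (real \<Rightarrow> 'a) \<Rightarrow> bool" where
  "smooth_curve A J \<gamma> \<longleftrightarrow> continuous_on J \<gamma> \<and>
     (\<forall>i\<in>index A. smooth_path {t\<in>J. \<gamma> t \<in> chart_dom A i} (\<lambda>t. chart A i (\<gamma> t)))"

definition velocity ::
  "('i, 'a, 'e::euclidean_space) atlas \<Rightarrow> 'i \<Rightarrow> real set \<Rightarrow> (real \<Rightarrow> 'a) \<Rightarrow> real \<Rightarrow> 'e" where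
  "velocity A i J \<gamma> t = vector_derivative (\<lambda>s. chart A i (\<gamma> s)) (at t within J)"

definition piecewise_smooth_curve ::
  "('i, 'a::topological_space, 'e::euclidean_space) atlas \<Rightarrow> (real \<Rightarrow> 'a) \<Rightarrow> bool" where
  "piecewise_smooth_curve A \<sigma> \<longleftrightarrow> continuous_on {0..1} \<sigma> \<and>
     (\<exists>(n::nat) s. s 0 = 0 \<and> s n = 1 \<and>
        (\<forall>k<n. s k < s (Suc k) \<and> smooth_curve A {s k..s (Suc k)} \<sigma>))"

definition chart_at :: "('i, 'a, 'e) atlas \<Rightarrow> 'a \<Rightarrow> 'i" where
  "chart_at A x = (SOME i. i \<in> index A \<and> x \<in> chart_dom A i)"

text \<open>For a function \<open>F\<close> of tangent vectors the integrand does not depend on the chart used.\<close>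

definition curve_length ::
  "('i, 'a, 'e::euclidean_space) atlas \<Rightarrow> ('i \<Rightarrow> 'a \<Rightarrow> 'e \<Rightarrow> real) \<Rightarrow> (real \<Rightarrow> 'a) \<Rightarrow> real" where
  "curve_length A F \<sigma> =
     integral {0..1} (\<lambda>s. F (chart_at A (\<sigma> s)) (\<sigma> s) (velocity A (chart_at A (\<sigma> s)) {0..1} \<sigma> s))"

definition path_distance ::
  "('i, 'a::topological_space, 'e::euclidean_space) atlas \<Rightarrow> ('i \<Rightarrow> 'a \<Rightarrow> 'e \<Rightarrow> real) \<Rightarrow>
   'a \<Rightarrow> 'a \<Rightarrow> real" where
  "path_distance A F x y =
     Inf {curve_length A F \<sigma> |\<sigma>. piecewise_smooth_curve A \<sigma> \<and> \<sigma> 0 = x \<and> \<sigma> 1 = y}"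

definition forward_ball ::
  "('i, 'a::topological_space, 'e::euclidean_space) atlas \<Rightarrow> ('i \<Rightarrow> 'a \<Rightarrow> 'e \<Rightarrow> real) \<Rightarrow>
   'a \<Rightarrow> real \<Rightarrow> 'a set" where
  "forward_ball A F x r = {z. path_distance A F x z < r}"

definition backward_ball ::
  "('i, 'a::topological_space, 'e::euclidean_space) atlas \<Rightarrow> ('i \<Rightarrow> 'a \<Rightarrow> 'e \<Rightarrow> real) \<Rightarrow>
   'a \<Rightarrow> real \<Rightarrow> 'a set" where
  "backward_ball A F x r = {z. path_distance A F z x < r}"


section \<open>Geodesics of a semi-Riemannian metric\<close>

definition metric_deriv ::
  "('i, 'a, 'e::euclidean_space) atlas \<Rightarrow> ('i \<Rightarrow> 'a \<Rightarrow> 'e \<Rightarrow> 'e \<Rightarrow> real) \<Rightarrow>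
   'i \<Rightarrow> 'a \<Rightarrow> 'e \<Rightarrow> 'e \<Rightarrow> 'e \<Rightarrow> real" where
  "metric_deriv A g i x w u v =
     frechet_derivative (\<lambda>p. g i (chart_inv A i p) u v) (at (chart A i x)) w"

text \<open>The Christoffel symbols of the first kind
  \<open>\<Gamma>\<^sub>k\<^sub>,\<^sub>a\<^sub>b = (\<partial>\<^sub>a g\<^sub>b\<^sub>k + \<partial>\<^sub>b g\<^sub>a\<^sub>k - \<partial>\<^sub>k g\<^sub>a\<^sub>b) / 2\<close>,
  contracted with vectors \<open>u\<close>, \<open>v\<close>, \<open>w\<close> in the slots \<open>a\<close>, \<open>b\<close>, \<open>k\<close>.\<close>

definition christoffel ::
  "('i, 'a, 'e::euclidean_space) atlas \<Rightarrow> ('i \<Rightarrow> 'a \<Rightarrow> 'e \<Rightarrow> 'e \<Rightarrow> real) \<Rightarrow>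
   'i \<Rightarrow> 'a \<Rightarrow> 'e \<Rightarrow> 'e \<Rightarrow> 'e \<Rightarrow> real" where
  "christoffel A g i x u v w =
     (metric_deriv A g i x u v w + metric_deriv A g i x v u w - metric_deriv A g i x w u v) / 2"

text \<open>The geodesic equation of the Levi-Civita connection is stated with the index lowered,
  i.e. as \<open>g(\<nabla>\<^sub>t \<gamma>', w) = 0\<close> for all \<open>w\<close>; as \<open>g\<close> is nondegenerate, this says that
  \<open>\<nabla>\<^sub>t \<gamma>' = 0\<close>.\<close>

definition is_geodesic ::
  "('i, 'a::topological_space, 'e::euclidean_space) atlas \<Rightarrow> ('i \<Rightarrow> 'a \<Rightarrow> 'e \<Rightarrow> 'e \<Rightarrow> real) \<Rightarrow>
   real set \<Rightarrow> (real \<Rightarrow> 'a) \<Rightarrow> bool" where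
  "is_geodesic A g J \<gamma> \<longleftrightarrow> smooth_curve A J \<gamma> \<and>
     (\<forall>i\<in>index A. \<forall>t\<in>J. \<gamma> t \<in> chart_dom A i \<longrightarrow>
        (\<forall>w. g i (\<gamma> t) (vector_derivative (velocity A i J \<gamma>) (at t within J)) w
             + christoffel A g i (\<gamma> t) (velocity A i J \<gamma> t) (velocity A i J \<gamma> t) w = 0))"

definition lightlike :: "('i \<Rightarrow> 'a \<Rightarrow> 'e \<Rightarrow> 'e \<Rightarrow> real) \<Rightarrow> 'i \<Rightarrow> 'a \<Rightarrow> 'e::zero \<Rightarrow> bool" where
  "lightlike g i x w \<longleftrightarrow> w \<noteq> 0 \<and> g i x w w = 0"

definition causal :: "('i \<Rightarrow> 'a \<Rightarrow> 'e \<Rightarrow> 'e \<Rightarrow> real) \<Rightarrow> 'i \<Rightarrow> 'a \<Rightarrow> 'e::zero \<Rightarrow> bool" where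
  "causal g i x w \<longleftrightarrow> w \<noteq> 0 \<and> g i x w w \<le> 0"

definition lightlike_geodesic ::
  "('i, 'a::topological_space, 'e::euclidean_space) atlas \<Rightarrow> ('i \<Rightarrow> 'a \<Rightarrow> 'e \<Rightarrow> 'e \<Rightarrow> real) \<Rightarrow>
   real set \<Rightarrow> (real \<Rightarrow> 'a) \<Rightarrow> bool" where
  "lightlike_geodesic A g J \<gamma> \<longleftrightarrow> is_geodesic A g J \<gamma> \<and>
     (\<forall>i\<in>index A. \<forall>t\<in>J. \<gamma> t \<in> chart_dom A i \<longrightarrow> lightlike g i (\<gamma> t) (velocity A i J \<gamma> t))"

definition lightlike_pregeodesic ::
  "('i, 'a::topological_space, 'e::euclidean_space) atlas \<Rightarrow> ('i \<Rightarrow> 'a \<Rightarrow> 'e \<Rightarrow> 'e \<Rightarrow> real) \<Rightarrow>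
   real \<Rightarrow> real \<Rightarrow> (real \<Rightarrow> 'a) \<Rightarrow> bool" where
  "lightlike_pregeodesic A g a b \<gamma> \<longleftrightarrow>
     (\<exists>c d h. c < d \<and> h c = a \<and> h d = b \<and> smooth_path {c..d} h \<and>
        (\<forall>s\<in>{c..d}. 0 < vector_derivative h (at s within {c..d})) \<and>
        lightlike_geodesic A g {c..d} (\<gamma> \<circ> h))"


section \<open>The product with the real line\<close>

definition times_line :: "('i, 'a, 'e) atlas \<Rightarrow> ('i, 'a \<times> real, 'e \<times> real) atlas" where
  "times_line A =
     \<lparr>index = index A, chart_dom = (\<lambda>i. chart_dom A i \<times> UNIV),
      chart = (\<lambda>i (x, t). (chart A i x, t))\<rparr>"

text \<open>In the charts of \<open>times_line A\<close>, the form \<open>dt\<close> is the second projection and the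
  first projection is the differential of the projection onto \<open>S\<close>.\<close>

definition lorentz_metric ::
  "('i \<Rightarrow> 'a \<Rightarrow> 'e \<Rightarrow> 'e \<Rightarrow> real) \<Rightarrow> ('i \<Rightarrow> 'a \<Rightarrow> 'e \<Rightarrow> real) \<Rightarrow> ('a \<Rightarrow> real) \<Rightarrow> real \<Rightarrow>
   'i \<Rightarrow> 'a \<times> real \<Rightarrow> 'e \<times> real \<Rightarrow> 'e \<times> real \<Rightarrow> real" where
  "lorentz_metric g\<^sub>0 \<omega> \<Lambda> \<epsilon> i z w w' =
     g\<^sub>0 i (fst z) (fst w) (fst w') + \<omega> i (fst z) (fst w) * snd w' + snd w * \<omega> i (fst z) (fst w')
     - (\<Lambda> (fst z) + \<epsilon>) * (snd w * snd w')"

definition future_pointing ::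
  "('i \<Rightarrow> 'a \<times> real \<Rightarrow> 'e \<times> real \<Rightarrow> 'e \<times> real \<Rightarrow> real) \<Rightarrow>
   'i \<Rightarrow> 'a \<times> real \<Rightarrow> ('e::zero) \<times> real \<Rightarrow> bool" where
  "future_pointing g i z w \<longleftrightarrow> causal g i z w \<and> 0 < snd w"

definition future_pointing_curve ::
  "('i, 'a, 'e::euclidean_space) atlas \<Rightarrow>
   ('i \<Rightarrow> 'a \<times> real \<Rightarrow> 'e \<times> real \<Rightarrow> 'e \<times> real \<Rightarrow> real) \<Rightarrow>
   real set \<Rightarrow> (real \<Rightarrow> 'a \<times> real) \<Rightarrow> bool" where
  "future_pointing_curve A g J \<gamma> \<longleftrightarrow>
     (\<forall>i\<in>index A. \<forall>t\<in>J. \<gamma> t \<in> chart_dom (times_line A) i \<longrightarrow>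
        future_pointing g i (\<gamma> t) (velocity (times_line A) i J \<gamma> t))"

definition randers ::
  "('i \<Rightarrow> 'a \<Rightarrow> 'e \<Rightarrow> 'e \<Rightarrow> real) \<Rightarrow> ('i \<Rightarrow> 'a \<Rightarrow> 'e \<Rightarrow> real) \<Rightarrow> ('a \<Rightarrow> real) \<Rightarrow> real \<Rightarrow>
   'i \<Rightarrow> 'a \<Rightarrow> 'e \<Rightarrow> real" where
  "randers g\<^sub>0 \<omega> \<Lambda> \<epsilon> i x v =
     1 / (\<Lambda> x + \<epsilon>) * (sqrt ((\<Lambda> x + \<epsilon>) * g\<^sub>0 i x v v + (\<omega> i x v)\<^sup>2) + \<omega> i x v)"

text \<open>The distance of the Riemannian metric \<open>g\<^sub>0 \<oplus> dt\<^sup>2\<close>.\<close>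

definition product_distance ::
  "('i, 'a::topological_space, 'e::euclidean_space) atlas \<Rightarrow> ('i \<Rightarrow> 'a \<Rightarrow> 'e \<Rightarrow> 'e \<Rightarrow> real) \<Rightarrow>
   'a \<times> real \<Rightarrow> 'a \<times> real \<Rightarrow> real" where
  "product_distance A g\<^sub>0 =
     path_distance (times_line A)
       (\<lambda>i z w. sqrt (g\<^sub>0 i (fst z) (fst w) (fst w) + (snd w)\<^sup>2))"

definition extend_vertically :: "'a \<Rightarrow> real \<Rightarrow> (real \<Rightarrow> 'a \<times> real) \<Rightarrow> real \<Rightarrow> 'a \<times> real" where
  "extend_vertically x b \<gamma> t = (if t \<le> b then \<gamma> t else (x, t))"

end

theory Submission
  imports Defs "HOL-Complex_Analysis.Great_Picard"
begin

text \<open>Along a lightlike curve of \<open>g\<^sub>\<epsilon>\<close> parametrized by \<open>t\<close>, \<open>F\<^sub>\<epsilon>(\<sigma>') = 1\<close>, and \<open>F\<^sub>\<epsilon>\<close> decreases in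
  \<open>\<epsilon>\<close>; hence all \<open>\<sigma>\<^sub>n\<close> with \<open>\<epsilon>\<^sub>n \<le> \<epsilon>\<^sub>b\<close> stay in one compact intersection of closed balls of the Randers
  metric with parameter \<open>\<epsilon>\<^sub>b\<close>. The metric \<open>g\<close> is Lorentzian even where \<open>\<Lambda> = 0\<close>, because \<open>\<omega> \<noteq> 0\<close>, so that on this compact set speeds
  are bounded by a multiple of \<open>dt\<close> and affine accelerations by a multiple of \<open>dt\<^sup>2\<close>, uniformly in \<open>\<epsilon>\<close>.
  Thus the geodesics, affinely parametrized over \<open>[0, 1]\<close>, subconverge in \<open>C\<^sup>1\<close> as soon as the arrival
  times stay away from \<open>0\<close>; the geodesic equation passes to the limit in its momentum form. If
  the arrival times tended to \<open>0\<close>, there would be arbitrarily short lightlike loops, which the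
  conserved momentum of the Killing field \<open>\<partial>\<^sub>t\<close> excludes.\<close>


subsection \<open>Paths of class C^k\<close>

text \<open>As \<epsilon> tends to 0 the Randers metrics degenerate where \<Lambda> vanishes, so
  they serve only to trap the curves; all estimates are made for the Lorentzian metrics. There
  \<epsilon> multiplies a term with constant coefficients, so one constant per compact subset of a
  chart works for all \<epsilon> in [0, 1]. Two parametrizations are needed: the claim compares
  curves at equal times \<open>t\<close>, but the geodesic equation has a limit only for affine
  parameters. The bridge is \<open>|\<tau>''| \<le> B \<tau>'^2\<close>: it bounds the oscillation
  of \<open>ln \<tau>'\<close> by \<open>B\<close> times the elapsed time and so keeps \<tau>'
  between positive constants. Bounded second derivatives give compactness in C^1 only, so second
  derivatives need not converge. The momenta have derivatives that involve only first derivatives of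
  the curve, and lowered indices avoid differentiating an inverse metric. That the limit time is
  positive must be proved: a pregeodesic with increasing reparametrization cannot have \<Delta> = 0.
  Topology on S is handled by neighbourhoods and charts, without a distance that induces it.\<close>

primrec path_Ck :: "nat \<Rightarrow> real set \<Rightarrow> (real \<Rightarrow> 'v::real_normed_vector) \<Rightarrow> bool" where
  "path_Ck 0 T x \<longleftrightarrow> continuous_on T x"
| "path_Ck (Suc k) T x \<longleftrightarrow>
     (\<exists>x'. (\<forall>t\<in>T. (x has_vector_derivative x' t) (at t within T)) \<and> path_Ck k T x')"

lemma has_vector_derivative_quotientI:
  fixes f :: "real \<Rightarrow> 'v::real_normed_vector"
  assumes "((\<lambda>t. (f t - f t0) /\<^sub>R (t - t0)) \<longlongrightarrow> f') (at t0 within T)"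
  shows "(f has_vector_derivative f') (at t0 within T)"
proof -
  have "((\<lambda>t. norm ((f t - f t0) /\<^sub>R (t - t0) - f')) \<longlongrightarrow> 0) (at t0 within T)"
    using assms by (simp add: tendsto_norm_zero LIM_zero)
  moreover have "\<forall>\<^sub>F t in at t0 within T. norm ((f t - f t0) /\<^sub>R (t - t0) - f')
      = norm (f t - f t0 - (t - t0) *\<^sub>R f') / norm (t - t0)"
    unfolding eventually_at_filter
  proof (rule always_eventually, intro allI impI)
    fix t assume "t \<noteq> t0"
    then have "(f t - f t0) /\<^sub>R (t - t0) - f' = (f t - f t0 - (t - t0) *\<^sub>R f') /\<^sub>R (t - t0)"
      by (simp add: scaleR_diff_right)
    then show "norm ((f t - f t0) /\<^sub>R (t - t0) - f') = norm (f t - f t0 - (t - t0) *\<^sub>R f') / norm (t - t0)"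
      by (simp add: divide_inverse mult.commute)
  qed
  ultimately have "((\<lambda>t. norm (f t - f t0 - (t - t0) *\<^sub>R f') / norm (t - t0)) \<longlongrightarrow> 0) (at t0 within T)"
    by (rule Lim_transform_eventually)
  then show ?thesis
    by (simp add: has_vector_derivative_def has_derivative_iff_norm bounded_linear_scaleR_left)
qed

lemma path_Ck_cong:
  assumes "path_Ck k T x" "\<And>t. t \<in> T \<Longrightarrow> x t = y t"
  shows "path_Ck k T y"
proof (cases k)
  case 0
  then show ?thesis using assms continuous_on_cong by force
next
  case (Suc j)
  then obtain x' where x': "\<forall>t\<in>T. (x has_vector_derivative x' t) (at t within T)" "path_Ck j T x'"
    using assms by auto
  have "\<forall>t\<in>T. (y has_vector_derivative x' t) (at t within T)"
    using x'(1) assms(2) by (metis has_vector_derivative_transform)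
  then show ?thesis using Suc x' by auto
qed

lemma path_Ck_continuous: "path_Ck k T x \<Longrightarrow> continuous_on T x"
  by (cases k) (auto simp: continuous_on_eq_continuous_within
      intro: has_vector_derivative_continuous)

lemma path_Ck_SucD: "path_Ck (Suc k) T x \<Longrightarrow> path_Ck k T x"
proof (induction k arbitrary: x)
  case 0
  then show ?case using path_Ck_continuous by fastforce
next
  case (Suc k)
  then obtain x' where "\<forall>t\<in>T. (x has_vector_derivative x' t) (at t within T)" "path_Ck (Suc k) T x'"
    by auto
  then show ?case using Suc.IH by auto
qed

lemma path_Ck_subset:
  "path_Ck k T x \<Longrightarrow> T' \<subseteq> T \<Longrightarrow> path_Ck k T' x"
proof (induction k arbitrary: x)
  case 0
  then show ?case using continuous_on_subset by auto
next
  case (Suc k)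
  then obtain x' where "\<forall>t\<in>T. (x has_vector_derivative x' t) (at t within T)" "path_Ck k T x'"
    by auto
  then show ?case using Suc has_vector_derivative_within_subset
    by (metis path_Ck.simps(2) subsetD)
qed

lemma path_Ck_const: "path_Ck k T (\<lambda>_. c)"
proof (induction k arbitrary: c)
  case (Suc k)
  have "\<forall>t\<in>T. ((\<lambda>_. c) has_vector_derivative 0) (at t within T)" by auto
  then show ?case using Suc[of 0] by (auto intro!: exI[of _ "\<lambda>_. 0"])
qed auto

lemma path_Ck_linear:
  assumes "bounded_linear L" "path_Ck k T x"
  shows "path_Ck k T (\<lambda>t. L (x t))"
  using assms(2)
proof (induction k arbitrary: x)
  case 0
  then show ?case using assms(1) bounded_linear.continuous_on by auto
next
  case (Suc k)
  then obtain x' where "\<forall>t\<in>T. (x has_vector_derivative x' t) (at t within T)" "path_Ck k T x'"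
    by auto
  then show ?case using Suc.IH[of x'] bounded_linear.has_vector_derivative[OF assms(1)]
    by (auto intro!: exI[of _ "\<lambda>t. L (x' t)"])
qed

lemma path_Ck_add:
  assumes "path_Ck k T x" "path_Ck k T y"
  shows "path_Ck k T (\<lambda>t. x t + y t)"
  using assms
proof (induction k arbitrary: x y)
  case 0
  then show ?case by (auto intro: continuous_on_add)
next
  case (Suc k)
  then obtain x' y' where "\<forall>t\<in>T. (x has_vector_derivative x' t) (at t within T)" "path_Ck k T x'"
    "\<forall>t\<in>T. (y has_vector_derivative y' t) (at t within T)" "path_Ck k T y'"
    by auto
  then show ?case using Suc.IH[of x' y']
    by (auto intro!: exI[of _ "\<lambda>t. x' t + y' t"] has_vector_derivative_add)
qed

lemma path_Ck_sum:
  assumes "\<And>i. i \<in> I \<Longrightarrow> path_Ck k T (x i)"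
  shows "path_Ck k T (\<lambda>t. \<Sum>i\<in>I. x i t)"
proof (cases "finite I")
  case True
  then show ?thesis using assms
    by (induction I) (auto simp: path_Ck_const intro: path_Ck_add)
qed (simp add: path_Ck_const)

lemma path_Ck_scaleR:
  fixes c :: "real \<Rightarrow> real"
  assumes "path_Ck k T c" "path_Ck k T x"
  shows "path_Ck k T (\<lambda>t. c t *\<^sub>R x t)"
  using assms
proof (induction k arbitrary: c x)
  case 0
  then show ?case by (auto intro: continuous_on_scaleR)
next
  case (Suc k)
  then obtain c' x' where d: "\<forall>t\<in>T. (c has_vector_derivative c' t) (at t within T)" "path_Ck k T c'"
    "\<forall>t\<in>T. (x has_vector_derivative x' t) (at t within T)" "path_Ck k T x'"
    by auto
  have "path_Ck k T (\<lambda>t. c t *\<^sub>R x' t + c' t *\<^sub>R x t)"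
    using Suc d path_Ck_SucD by (metis path_Ck_add)
  moreover have "\<forall>t\<in>T. ((\<lambda>t. c t *\<^sub>R x t) has_vector_derivative c t *\<^sub>R x' t + c' t *\<^sub>R x t) (at t within T)"
    using d by (auto intro!: has_vector_derivative_scaleR
        simp: has_real_derivative_iff_has_vector_derivative)
  ultimately show ?case by (auto intro!: exI[of _ "\<lambda>t. c t *\<^sub>R x' t + c' t *\<^sub>R x t"])
qed

lemma path_Ck_mult:
  fixes c x :: "real \<Rightarrow> real"
  assumes "path_Ck k T c" "path_Ck k T x"
  shows "path_Ck k T (\<lambda>t. c t * x t)"
  using path_Ck_scaleR[OF assms] by simp

lemma path_Ck_Pair:
  assumes "path_Ck k T x" "path_Ck k T y"
  shows "path_Ck k T (\<lambda>t. (x t, y t))"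
proof -
  have "bounded_linear (\<lambda>u. (u, 0))" "bounded_linear (\<lambda>u. (0, u))"
    by (auto intro!: bounded_linear_Pair bounded_linear_ident bounded_linear_zero)
  from path_Ck_add[OF path_Ck_linear[OF this(1) assms(1)] path_Ck_linear[OF this(2) assms(2)]]
  show ?thesis by simp
qed

lemma path_Ck_inner: "path_Ck k T x \<Longrightarrow> path_Ck k T (\<lambda>t. x t \<bullet> b)"
  by (rule path_Ck_linear[OF bounded_linear_inner_left])

lemma linear_expansion:
  fixes f :: "'v::euclidean_space \<Rightarrow> 'w::real_vector"
  assumes "linear f"
  shows "f u = (\<Sum>b\<in>Basis. (u \<bullet> b) *\<^sub>R f b)"
proof -
  have "f u = f (\<Sum>b\<in>Basis. (u \<bullet> b) *\<^sub>R b)" by (simp only: euclidean_representation)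
  also have "\<dots> = (\<Sum>b\<in>Basis. (u \<bullet> b) *\<^sub>R f b)"
    by (simp only: linear_sum[OF assms] linear_scale[OF assms])
  finally show ?thesis .
qed

text \<open>\<open>Ck_on\<close> controls derivatives in fixed directions only. Expanding the
  derivative of \<open>f\<close> along the path in the basis leaves products of components of
  \<open>x'\<close> with such directional derivatives, to which the induction hypothesis
  applies.\<close>

lemma path_Ck_compose:
  fixes f :: "'v::euclidean_space \<Rightarrow> 'w::real_normed_vector"
  assumes "Ck_on k f X" "path_Ck k T x" "x ` T \<subseteq> X"
  shows "path_Ck k T (\<lambda>t. f (x t))"
  using assms
proof (induction k arbitrary: f)
  case 0
  then show ?case using continuous_on_compose2 by auto
next
  case (Suc k)
  obtain x' where x': "\<forall>t\<in>T. (x has_vector_derivative x' t) (at t within T)" "path_Ck k T x'"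
    using Suc.prems by auto
  define D where "D = (\<lambda>t. \<Sum>b\<in>Basis. (x' t \<bullet> b) *\<^sub>R frechet_derivative f (at (x t)) b)"
  have "path_Ck k T D"
    unfolding D_def
  proof (intro path_Ck_sum path_Ck_scaleR path_Ck_inner x')
    fix b :: 'v
    show "path_Ck k T (\<lambda>t. frechet_derivative f (at (x t)) b)"
      using Suc.IH[of "\<lambda>p. frechet_derivative f (at p) b"] Suc.prems(1,3)
        path_Ck_SucD[OF Suc.prems(2)] by simp
  qed
  moreover have "((\<lambda>t. f (x t)) has_vector_derivative D t) (at t within T)" if "t \<in> T" for t
  proof -
    have d: "(f has_derivative frechet_derivative f (at (x t))) (at (x t))"
      using Suc.prems that by (auto simp: frechet_derivative_works)
    have "((\<lambda>t. f (x t)) has_vector_derivative frechet_derivative f (at (x t)) (x' t)) (at t within T)"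
      using vector_derivative_diff_chain_within[of x "x' t" t T f] d x' that
        has_derivative_at_withinI by (fastforce simp: o_def)
    moreover have "frechet_derivative f (at (x t)) (x' t) = D t"
      unfolding D_def by (rule linear_expansion[OF has_derivative_linear[OF d]])
    ultimately show ?thesis by simp
  qed
  ultimately show ?case by auto
qed

section \<open>Bilinear forms along a path\<close>

lemma bilinear_form_expansion:
  fixes m :: "'f::euclidean_space \<Rightarrow> 'f \<Rightarrow> real"
  assumes "bilinear m"
  shows "m u v = (\<Sum>b\<in>Basis. \<Sum>c\<in>Basis. (u \<bullet> b) * (v \<bullet> c) * m b c)"
proof -
  have l: "linear (\<lambda>u. m u v)" "linear (m u)" for u v
    using assms by (auto simp: bilinear_def)
  have "m u v = (\<Sum>b\<in>Basis. (u \<bullet> b) * m b v)" 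
    using linear_expansion[OF l(1), of u v] by simp
  also have "\<dots> = (\<Sum>b\<in>Basis. (u \<bullet> b) * (\<Sum>c\<in>Basis. (v \<bullet> c) * m b c))"
    using linear_expansion[OF l(2), of _ v] by simp
  finally show ?thesis by (simp add: sum_distrib_left mult.assoc)
qed

lemma bilinear_form_le:
  fixes m :: "'f::euclidean_space \<Rightarrow> 'f \<Rightarrow> real"
  assumes "bilinear m"
  shows "\<bar>m u v\<bar> \<le> norm u * norm v * (\<Sum>b\<in>Basis. \<Sum>c\<in>Basis. \<bar>m b c\<bar>)"
proof -
  have "\<bar>m u v\<bar> \<le> (\<Sum>b\<in>Basis. \<Sum>c\<in>Basis. \<bar>(u \<bullet> b) * (v \<bullet> c) * m b c\<bar>)"
    unfolding bilinear_form_expansion[OF assms, of u v]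
    by (rule order_trans[OF sum_abs sum_mono]) (rule sum_abs)
  also have "\<dots> \<le> (\<Sum>b\<in>Basis. \<Sum>c\<in>Basis. norm u * norm v * \<bar>m b c\<bar>)"
    by (intro sum_mono) (auto simp: abs_mult Basis_le_norm intro!: mult_mono)
  finally show ?thesis by (simp add: sum_distrib_left)
qed

lemma path_Ck_bilinear:
  fixes m :: "real \<Rightarrow> 'f::euclidean_space \<Rightarrow> 'f \<Rightarrow> real"
  assumes "\<And>t. t \<in> T \<Longrightarrow> bilinear (m t)" "\<And>b c. path_Ck k T (\<lambda>t. m t b c)"
    "path_Ck k T u" "path_Ck k T v"
  shows "path_Ck k T (\<lambda>t. m t (u t) (v t))"
proof -
  have "path_Ck k T (\<lambda>t. \<Sum>b\<in>Basis. \<Sum>c\<in>Basis. (u t \<bullet> b) * (v t \<bullet> c) * m t b c)"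
    by (intro path_Ck_sum path_Ck_mult path_Ck_inner assms)
  then show ?thesis
    by (rule path_Ck_cong) (simp add: bilinear_form_expansion[OF assms(1)])
qed

lemma linear_scaleR_const: "linear (f :: 'v::real_vector \<Rightarrow> real) \<Longrightarrow> linear (\<lambda>x. f x *\<^sub>R b)"
  by (intro linearI) (simp_all add: linear_add linear_scale scaleR_add_left)

text \<open>Injectivity in finite dimension is quantitative:
  \<open>c * norm u \<le> norm (N u)\<close> for the limit form. On basis vectors the forms
  \<open>m t\<close> differ from it by at most \<open>norm u * e t\<close> with \<open>e\<close>
  tending to 0, and this error is absorbed into the left-hand side. The lemma is applied below both
  to differences and to difference quotients.\<close>

lemma nondegenerate_tendsto_zero:
  fixes m :: "real \<Rightarrow> 'f::euclidean_space \<Rightarrow> 'f \<Rightarrow> real"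
  assumes bil: "\<forall>\<^sub>F t in F. bilinear (m t)" and bil0: "bilinear m0"
    and nondeg: "\<And>u. (\<And>w. m0 u w = 0) \<Longrightarrow> u = 0"
    and lim: "\<And>b c. b \<in> Basis \<Longrightarrow> c \<in> Basis \<Longrightarrow> ((\<lambda>t. m t b c) \<longlongrightarrow> m0 b c) F"
    and zero: "\<And>b. b \<in> Basis \<Longrightarrow> ((\<lambda>t. m t (u t) b) \<longlongrightarrow> 0) F"
  shows "(u \<longlongrightarrow> 0) F"
proof -
  define N where "N = (\<lambda>u. \<Sum>b\<in>Basis. m0 u b *\<^sub>R b)"
  have l: "linear (\<lambda>u. m0 u v)" "linear (m0 u)" for u v
    using bil0 by (auto simp: bilinear_def)
  have linN: "linear N"
    unfolding N_def by (intro linear_compose_sum ballI linear_scaleR_const l) 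
  have coef: "N u \<bullet> b = m0 u b" if "b \<in> Basis" for u b
    using that by (simp add: N_def)
  have "inj N"
  proof (subst linear_injective_0[OF linN], intro allI impI)
    fix u assume "N u = 0"
    then have "m0 u b = 0" if "b \<in> Basis" for b
      using coef[OF that, of u] by simp
    then have "m0 u w = 0" for w
      using linear_expansion[OF l(2), of u w] by simp
    then show "u = 0" using nondeg by blast
  qed
  from linear_inj_bounded_below_pos[OF linN this]
  obtain c where c: "c > 0" "\<And>u. c * norm u \<le> norm (N u)" by metis
  define e where "e = (\<lambda>t. \<Sum>b\<in>Basis. \<Sum>d\<in>Basis. \<bar>m t b d - m0 b d\<bar>)"
  define s where "s = (\<lambda>t. \<Sum>b\<in>Basis. \<bar>m t (u t) b\<bar>)"
  have e0: "(e \<longlongrightarrow> 0) F"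
    unfolding e_def
    by (intro tendsto_null_sum tendsto_rabs_zero) (simp add: lim LIM_zero)
  have s0: "(s \<longlongrightarrow> 0) F"
    unfolding s_def by (intro tendsto_null_sum tendsto_rabs_zero zero)
  have le: "c * norm (u t) \<le> s t + real DIM('f) * (norm (u t) * e t)" if "bilinear (m t)" for t
  proof -
    have b: "bilinear (\<lambda>u v. m t u v - m0 u v)"
      using that bil0 by (auto simp: bilinear_def intro: linear_compose_sub)
    have "c * norm (u t) \<le> norm (N (u t))" by (rule c)
    also have "\<dots> \<le> (\<Sum>b\<in>Basis. \<bar>m0 (u t) b\<bar>)"
      unfolding N_def by (rule order_trans[OF norm_sum]) simp
    also have "\<dots> \<le> (\<Sum>b\<in>Basis. \<bar>m t (u t) b\<bar> + norm (u t) * e t)"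
    proof (rule sum_mono)
      fix d :: 'f assume "d \<in> Basis"
      then have "\<bar>m t (u t) d - m0 (u t) d\<bar> \<le> norm (u t) * e t"
        using bilinear_form_le[OF b, of "u t" d] by (simp add: e_def)
      then show "\<bar>m0 (u t) d\<bar> \<le> \<bar>m t (u t) d\<bar> + norm (u t) * e t" by linarith
    qed
    finally show ?thesis by (simp add: s_def sum.distrib)
  qed
  have "\<forall>\<^sub>F t in F. real DIM('f) * e t < c / 2"
    using tendsto_mult_right_zero[OF e0, of "real DIM('f)"] c(1)
    by (intro order_tendstoD(2)[where a="c/2"]) auto
  then have "\<forall>\<^sub>F t in F. norm (u t) \<le> 2 / c * s t"
    using bil
  proof eventually_elim
    case (elim t)
    have "norm (u t) * (real DIM('f) * e t) \<le> norm (u t) * (c / 2)"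
      using elim by (intro mult_left_mono) auto
    moreover have "real DIM('f) * (norm (u t) * e t) = norm (u t) * (real DIM('f) * e t)"
      "norm (u t) * (c / 2) = c * norm (u t) / 2" "c / 2 * norm (u t) = c * norm (u t) / 2" by simp_all
    ultimately have "c / 2 * norm (u t) \<le> s t" using le[OF elim(2)] by linarith
    then show ?case using c(1) by (simp add: pos_le_divide_eq mult.commute)
  qed
  then show ?thesis
    by (rule Lim_null_comparison[OF _ tendsto_mult_right_zero[OF s0]])
qed

text \<open>Differentiating \<open>m t (v t) = P t\<close> shows that the derivative of \<open>v\<close> solves a linear
  system with the same \<open>m\<close>, so that no inverse of \<open>m\<close> has to be differentiated.\<close>

lemma path_Ck_solve:
  fixes m :: "real \<Rightarrow> 'f::euclidean_space \<Rightarrow> 'f \<Rightarrow> real"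
  assumes "\<And>t. t \<in> T \<Longrightarrow> bilinear (m t)"
    and "\<And>t u. t \<in> T \<Longrightarrow> (\<And>w. m t u w = 0) \<Longrightarrow> u = 0"
    and "\<And>b c. path_Ck k T (\<lambda>t. m t b c)"
    and "\<And>b. path_Ck k T (\<lambda>t. m t (v t) b)"
  shows "path_Ck k T v"
  using assms(3,4)
proof (induction k arbitrary: v)
  case 0
  have "(v \<longlongrightarrow> v t0) (at t0 within T)" if t0: "t0 \<in> T" for t0
  proof -
    have ev: "\<forall>\<^sub>F t in at t0 within T. t \<in> T"
      by (simp add: eventually_at_filter)
    have lim: "((\<lambda>t. m t b c) \<longlongrightarrow> m t0 b c) (at t0 within T)" for b c
      using 0(1) t0 by (auto simp: continuous_on_def)
    have "((\<lambda>t. v t - v t0) \<longlongrightarrow> 0) (at t0 within T)"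
    proof (rule nondegenerate_tendsto_zero[where m=m and ?m0.0="m t0"])
      fix b :: 'f assume "b \<in> Basis"
      have "((\<lambda>t. m t (v t) b - m t (v t0) b) \<longlongrightarrow> m t0 (v t0) b - m t0 (v t0) b) (at t0 within T)"
        using 0(2) t0 lim by (intro tendsto_diff) (auto simp: continuous_on_def)
      moreover have "\<forall>\<^sub>F t in at t0 within T. m t (v t) b - m t (v t0) b = m t (v t - v t0) b"
        using ev by eventually_elim (simp add: bilinear_lsub[OF assms(1)])
      ultimately show "((\<lambda>t. m t (v t - v t0) b) \<longlongrightarrow> 0) (at t0 within T)"
        using Lim_transform_eventually by force
    qed (use ev lim t0 assms in \<open>auto elim: eventually_mono\<close>)
    then show ?thesis by (simp add: LIM_zero_iff)
  qed
  then show ?case by (simp add: continuous_on_def)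
next
  case (Suc k)
  have "\<forall>b c. \<exists>m'. (\<forall>t\<in>T. ((\<lambda>t. m t b c) has_vector_derivative m' t) (at t within T)) \<and> path_Ck k T m'"
    using Suc.prems(1) by simp
  then obtain m' where m': "\<And>b c t. t \<in> T \<Longrightarrow> ((\<lambda>t. m t b c) has_vector_derivative m' b c t) (at t within T)"
    "\<And>b c. path_Ck k T (m' b c)" by metis
  have "\<forall>b. \<exists>p'. (\<forall>t\<in>T. ((\<lambda>t. m t (v t) b) has_vector_derivative p' t) (at t within T)) \<and> path_Ck k T p'"
    using Suc.prems(2) by simp
  then obtain p' where p': "\<And>b t. t \<in> T \<Longrightarrow> ((\<lambda>t. m t (v t) b) has_vector_derivative p' b t) (at t within T)"
    "\<And>b. path_Ck k T (p' b)" by metis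
  \<comment> \<open>The right-hand side \<open>r\<close> contains \<open>v\<close> itself, so
    \<open>v\<close> must be known to be regular to the lower order first.\<close>
  have vk: "path_Ck k T v"
    using Suc.prems path_Ck_SucD by (intro Suc.IH) blast+
  \<comment> \<open>Formal differentiation of \<open>m t (v t) b\<close>, with the term containing
    the derivative of \<open>m\<close> moved to the other side, leaves
    \<open>m t (v' t) b = r b t\<close>.\<close>
  define r where "r = (\<lambda>b t. p' b t - (\<Sum>c\<in>Basis. (v t \<bullet> c) * m' c b t))"
  have rk: "path_Ck k T (r b)" for b
  proof -
    have "path_Ck k T (\<lambda>t. p' b t + - 1 * (\<Sum>c\<in>Basis. (v t \<bullet> c) * m' c b t))"
      by (intro path_Ck_add path_Ck_mult path_Ck_const path_Ck_sum path_Ck_inner m' p' vk)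
    then show ?thesis by (simp add: r_def)
  qed
  \<comment> \<open>Nondegeneracy makes the linear map \<open>N\<close> injective, hence surjective,
    so the system can be solved. The solution is only a candidate for the derivative until the
    difference quotients are compared with it.\<close>
  have "\<exists>l. \<forall>b\<in>Basis. m t l b = r b t" if "t \<in> T" for t
  proof -
    note l = assms(1)[OF that, unfolded bilinear_def]
    define N where "N = (\<lambda>u. \<Sum>b\<in>Basis. m t u b *\<^sub>R b)"
    have linN: "linear N"
      unfolding N_def using l by (intro linear_compose_sum ballI linear_scaleR_const) auto
    have coef: "N u \<bullet> b = m t u b" if "b \<in> Basis" for u b
      using that by (simp add: N_def)
    have "inj N"
    proof (subst linear_injective_0[OF linN], intro allI impI)
      fix u assume "N u = 0"
      then have "m t u b = 0" if "b \<in> Basis" for b using coef[OF that, of u] by simp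
      then have "m t u w = 0" for w
        using linear_expansion[of "m t u" w] l by simp
      then show "u = 0" using assms(2)[OF that] by blast
    qed
    then have "surj N" using linear_injective_imp_surjective[OF linN] by simp
    then obtain x where "N x = (\<Sum>b\<in>Basis. r b t *\<^sub>R b)" by (metis surjD)
    then show ?thesis using coef[of _ x] by (intro exI[of _ x]) auto
  qed
  then obtain v' where v': "\<And>t b. t \<in> T \<Longrightarrow> b \<in> Basis \<Longrightarrow> m t (v' t) b = r b t" by metis
  have "path_Ck k T v'"
  proof (rule Suc.IH)
    show "path_Ck k T (\<lambda>t. m t b c)" for b c using Suc.prems(1) path_Ck_SucD by blast
    fix w
    have "path_Ck k T (\<lambda>t. \<Sum>b\<in>Basis. (w \<bullet> b) * r b t)"
      by (intro path_Ck_sum path_Ck_mult path_Ck_const rk)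
    moreover have "(\<Sum>b\<in>Basis. (w \<bullet> b) * r b t) = m t (v' t) w" if "t \<in> T" for t
      using assms(1)[OF that] v'[OF that] linear_expansion[of "m t (v' t)" w]
      by (simp add: bilinear_def)
    ultimately show "path_Ck k T (\<lambda>t. m t (v' t) w)" by (rule path_Ck_cong)
  qed
  moreover have "(v has_vector_derivative v' t0) (at t0 within T)" if t0: "t0 \<in> T" for t0
  proof -
    let ?F = "at t0 within T"
    have ev: "\<forall>\<^sub>F t in ?F. t \<in> T" by (simp add: eventually_at_filter)
    have lim: "((\<lambda>t. m t b c) \<longlongrightarrow> m t0 b c) ?F" for b c
      using path_Ck_continuous[OF Suc.prems(1)] t0 by (auto simp: continuous_on_def)
    have q: "((\<lambda>t. (f t - f t0) /\<^sub>R (t - t0)) \<longlongrightarrow> f') ?F"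
      if "(f has_vector_derivative f') ?F" for f :: "real \<Rightarrow> real" and f'
      using that
      by (simp only: has_real_derivative_iff_has_vector_derivative[symmetric]
          has_field_derivative_iff real_scaleR_def divide_inverse mult.commute)
    have "((\<lambda>t. (v t - v t0) /\<^sub>R (t - t0) - v' t0) \<longlongrightarrow> 0) ?F"
    proof (rule nondegenerate_tendsto_zero[where m=m and ?m0.0="m t0"])
      fix b :: 'f assume b: "b \<in> Basis"
      \<comment> \<open>This is \<open>m t\<close> applied to the difference quotient of
        \<open>v\<close> minus \<open>v' t0\<close>, rewritten so that only difference quotients of
        \<open>m t (v t) b\<close> and of the components of \<open>m\<close> occur, whose limits are
        known.\<close>
      let ?g = "\<lambda>t. (m t (v t) b - m t0 (v t0) b) /\<^sub>R (t - t0)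
        - (\<Sum>c\<in>Basis. (v t0 \<bullet> c) * ((m t c b - m t0 c b) /\<^sub>R (t - t0))) - m t (v' t0) b"
      have "(?g \<longlongrightarrow> p' b t0 - (\<Sum>c\<in>Basis. (v t0 \<bullet> c) * m' c b t0) - m t0 (v' t0) b) ?F"
        by (intro tendsto_diff tendsto_sum tendsto_mult tendsto_const q[OF m'(1)] q[OF p'(1)] t0 lim)
      then have "(?g \<longlongrightarrow> 0) ?F" using v'[OF t0 b] by (simp add: r_def)
      moreover have "\<forall>\<^sub>F t in ?F. ?g t = m t ((v t - v t0) /\<^sub>R (t - t0) - v' t0) b"
        using ev
      proof eventually_elim
        case (elim t)
        have l: "linear (\<lambda>u. m s u b)" if "s \<in> T" for s
          using assms(1)[OF that] by (simp add: bilinear_def)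
        have e: "(\<Sum>c\<in>Basis. (v t0 \<bullet> c) * ((m t c b - m t0 c b) /\<^sub>R (t - t0)))
            = (m t (v t0) b - m t0 (v t0) b) /\<^sub>R (t - t0)"
          unfolding linear_expansion[OF l[OF elim], of "v t0"] linear_expansion[OF l[OF t0], of "v t0"]
          by (simp add: sum_distrib_left right_diff_distrib sum_subtractf ac_simps)
        show ?case
          unfolding e linear_diff[OF l[OF elim]] linear_scale[OF l[OF elim]]
          by (simp add: algebra_simps)
      qed
      ultimately show "((\<lambda>t. m t ((v t - v t0) /\<^sub>R (t - t0) - v' t0) b) \<longlongrightarrow> 0) ?F"
        by (rule Lim_transform_eventually)
    qed (use ev lim t0 assms(1,2) in \<open>auto elim: eventually_mono\<close>)
    then have "((\<lambda>t. (v t - v t0) /\<^sub>R (t - t0)) \<longlongrightarrow> v' t0) ?F" by (simp add: LIM_zero_iff)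
    then show ?thesis
      by (rule has_vector_derivative_quotientI)
  qed
  ultimately show ?case by auto
qed

section \<open>Smooth paths from local regularity\<close>

lemma at_within_Int_ball: "0 < e \<Longrightarrow> s \<in> ball t e \<Longrightarrow> at s within (T \<inter> ball t e) = at s within T"
  by (rule at_within_nhd[of s "ball t e"]) auto

lemma smooth_path_imp_path_Ck: "smooth_path T x \<Longrightarrow> path_Ck k T x"
proof -
  assume "smooth_path T x"
  then obtain f where f: "\<And>t. t \<in> T \<Longrightarrow> f 0 t = x t"
    "\<And>t k. t \<in> T \<Longrightarrow> (f k has_vector_derivative f (Suc k) t) (at t within T)"
    unfolding smooth_path_def by blast
  have "path_Ck k T (f j)" for j
  proof (induction k arbitrary: j)
    case 0
    have "continuous (at t within T) (f j)" if "t \<in> T" for t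
      using f(2)[OF that] has_vector_derivative_continuous by blast
    then show ?case by (simp add: continuous_on_eq_continuous_within)
  next
    case (Suc k)
    then show ?case using f(2) by auto
  qed
  then show ?thesis using f(1) path_Ck_cong by blast
qed

text \<open>\<open>smooth_path\<close> asks for one sequence of derivatives of all orders on all of
  \<open>T\<close>, while \<open>path_Ck\<close> supplies unrelated witnesses for each order and
  each ball. As \<open>at t within T\<close> is nontrivial, derivatives are unique, so all witnesses
  coincide with iterates of \<open>D\<close> and glue.\<close>

lemma smooth_path_local:
  fixes x :: "real \<Rightarrow> 'v::real_normed_vector"
  assumes perfect: "\<And>t. t \<in> T \<Longrightarrow> at t within T \<noteq> bot"
    and loc: "\<And>t. t \<in> T \<Longrightarrow> \<exists>e>0. \<forall>k. path_Ck k (T \<inter> ball t e) x"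
  shows "smooth_path T x"
proof -
  define D where "D = (\<lambda>(x :: real \<Rightarrow> 'v) t. vector_derivative x (at t within T))"
  have step: "(y has_vector_derivative D y s) (at s within T) \<and> (\<forall>k. path_Ck k (T \<inter> ball t e) (D y))"
    if e: "e > 0" "\<forall>k. path_Ck k (T \<inter> ball t e) y" and s: "s \<in> T \<inter> ball t e" for y s t e
  proof -
    have *: "(y has_vector_derivative D y r) (at r within T) \<and> y' r = D y r"
      if "\<forall>r\<in>T \<inter> ball t e. (y has_vector_derivative y' r) (at r within T \<inter> ball t e)"
        "r \<in> T \<inter> ball t e" for y' r
    proof -
      have "(y has_vector_derivative y' r) (at r within T)"
        using that(1)[rule_format, OF that(2)] at_within_Int_ball[OF e(1), of r t T] that(2) by simp
      then show ?thesis
        using perfect[of r] that(2) vector_derivative_within unfolding D_def by fastforce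
    qed
    have "path_Ck k (T \<inter> ball t e) (D y)" for k
    proof -
      obtain y' where y': "\<forall>r\<in>T \<inter> ball t e. (y has_vector_derivative y' r) (at r within T \<inter> ball t e)"
        "path_Ck k (T \<inter> ball t e) y'" using e(2)[rule_format, of "Suc k"] by auto
      then show ?thesis using path_Ck_cong[OF y'(2), of "D y"] * by blast
    qed
    moreover obtain y' where "\<forall>r\<in>T \<inter> ball t e. (y has_vector_derivative y' r) (at r within T \<inter> ball t e)"
      using e(2)[rule_format, of "Suc 0"] by auto
    ultimately show ?thesis using * s by blast
  qed
  have iter: "\<exists>e>0. \<forall>k. path_Ck k (T \<inter> ball t e) ((D ^^ j) x)" if "t \<in> T" for t j
  proof (induction j)
    case (Suc j)
    then obtain e where "e > 0" "\<forall>k. path_Ck k (T \<inter> ball t e) ((D ^^ j) x)" by blast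
    then show ?case using step[of e t "(D ^^ j) x" t] that by auto
  qed (use loc that in simp)
  have "((D ^^ j) x has_vector_derivative (D ^^ Suc j) x t) (at t within T)" if "t \<in> T" for t j
    using iter[OF that, of j] step[of _ t "(D ^^ j) x" t] that by auto
  then show ?thesis unfolding smooth_path_def
    by (intro exI[of _ "\<lambda>j. (D ^^ j) x"]) auto
qed

lemma smooth_path_linear:
  assumes "bounded_linear L" "smooth_path T x"
  shows "smooth_path T (\<lambda>t. L (x t))"
proof -
  obtain f where "\<And>t. t \<in> T \<Longrightarrow> f 0 t = x t"
    "\<And>t k. t \<in> T \<Longrightarrow> (f k has_vector_derivative f (Suc k) t) (at t within T)"
    using assms(2) unfolding smooth_path_def by blast
  then show ?thesis unfolding smooth_path_def
    by (intro exI[of _ "\<lambda>k t. L (f k t)"])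
      (auto intro: bounded_linear.has_vector_derivative[OF assms(1)])
qed

lemma smooth_path_affine:
  assumes "smooth_path T x" "(\<lambda>u. a + b * u) ` T' \<subseteq> T"
  shows "smooth_path T' (\<lambda>u. x (a + b * u))"
proof -
  obtain f where f: "\<And>t. t \<in> T \<Longrightarrow> f 0 t = x t"
    "\<And>t k. t \<in> T \<Longrightarrow> (f k has_vector_derivative f (Suc k) t) (at t within T)"
    using assms(1) unfolding smooth_path_def by blast
  have "((\<lambda>u. b ^ k *\<^sub>R f k (a + b * u)) has_vector_derivative b ^ Suc k *\<^sub>R f (Suc k) (a + b * u))
      (at u within T')" if "u \<in> T'" for k u
  proof -
    have "((\<lambda>u. a + b * u) has_vector_derivative b) (at u within T')"
      by (auto intro!: derivative_eq_intros simp: has_real_derivative_iff_has_vector_derivative[symmetric])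
    moreover have "(f k has_vector_derivative f (Suc k) (a + b * u)) (at (a + b * u) within (\<lambda>u. a + b * u) ` T')"
      using f(2)[of "a + b * u" k] assms(2) that has_vector_derivative_within_subset by blast
    ultimately have "((f k \<circ> (\<lambda>u. a + b * u)) has_vector_derivative b *\<^sub>R f (Suc k) (a + b * u)) (at u within T')"
      by (rule vector_diff_chain_within)
    from has_vector_derivative_scaleR[OF DERIV_const[of "b ^ k"] this]
    show ?thesis by (simp add: o_def mult.commute)
  qed
  then show ?thesis unfolding smooth_path_def using f(1) assms(2)
    by (intro exI[of _ "\<lambda>k u. b ^ k *\<^sub>R f k (a + b * u)"]) auto
qed

lemma continuous_on_ball_preimage:
  fixes y :: "real \<Rightarrow> 'a::topological_space"
  assumes "continuous_on J y" "open U" "t \<in> J" "y t \<in> U"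
  obtains e where "0 < e" "\<And>s. s \<in> J \<Longrightarrow> dist t s < e \<Longrightarrow> y s \<in> U"
proof -
  obtain O' where "open O'" "O' \<inter> J = y -` U \<inter> J"
    using assms(1,2) continuous_on_open_invariant by metis
  moreover then obtain e where "0 < e" "ball t e \<subseteq> O'"
    using assms(3,4) open_contains_ball by (metis IntE IntI vimageI)
  ultimately show thesis using that[of e] by (metis IntE IntI mem_ball subsetD vimageE)
qed

lemma at_within_Icc_not_bot: "a < b \<Longrightarrow> t \<in> {a..b::real} \<Longrightarrow> at t within {a..b} \<noteq> bot"
  by (simp add: trivial_limit_within islimpt_Icc)


subsection \<open>The metrics in coordinates\<close>

lemma smooth_on_has_derivative:
  assumes "smooth_on f X" "x \<in> X"
  shows "(f has_derivative frechet_derivative f (at x)) (at x)"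
proof -
  have "Ck_on (Suc 0) f X" using assms(1) by (simp only: smooth_on_def)
  then show ?thesis using assms(2) by (simp add: frechet_derivative_works)
qed

lemma smooth_on_Ck_derivative:
  assumes "smooth_on f X"
  shows "Ck_on k (\<lambda>x. frechet_derivative f (at x) v) X"
proof -
  have "Ck_on (Suc k) f X" using assms by (simp only: smooth_on_def)
  then show ?thesis by simp
qed

lemma smooth_on_continuous: "smooth_on f X \<Longrightarrow> continuous_on X f"
  using Ck_on.simps(1) smooth_on_def by blast

lemma bilinear_linear_left: "bilinear m \<Longrightarrow> linear (\<lambda>u. m u v)"
  by (simp add: bilinear_def)

locale stationary =
  fixes A :: "('i, 'a::{t2_space, second_countable_topology}, 'e::euclidean_space) atlas"
    and g\<^sub>0 :: "'i \<Rightarrow> 'a \<Rightarrow> 'e \<Rightarrow> 'e \<Rightarrow> real"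
    and \<omega> :: "'i \<Rightarrow> 'a \<Rightarrow> 'e \<Rightarrow> real"
    and \<Lambda> :: "'a \<Rightarrow> real"
  assumes atlas: "smooth_atlas A"
    and metric: "riemannian_metric A g\<^sub>0"
    and form: "smooth_one_form A \<omega>"
    and form_nonzero: "\<forall>i\<in>index A. \<forall>x\<in>chart_dom A i. \<omega> i x \<noteq> (\<lambda>_. 0)"
    and Lambda_smooth: "smooth_function A \<Lambda>"
    and Lambda_nonneg: "\<forall>x. 0 \<le> \<Lambda> x"
begin

abbreviation X :: "'i \<Rightarrow> 'e set" where "X i \<equiv> chart A i ` chart_dom A i"

lemma chart_homeo:
  "i \<in> index A \<Longrightarrow> homeomorphism (chart_dom A i) (X i) (chart A i) (chart_inv A i)"
  and open_dom: "i \<in> index A \<Longrightarrow> open (chart_dom A i)"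
  and open_X: "i \<in> index A \<Longrightarrow> open (X i)"
  using atlas by (auto simp: smooth_atlas_def)

lemma chart_inv_chart: "i \<in> index A \<Longrightarrow> x \<in> chart_dom A i \<Longrightarrow> chart_inv A i (chart A i x) = x"
  using chart_homeo by (simp add: homeomorphism_def)

lemma chart_chart_inv: "i \<in> index A \<Longrightarrow> q \<in> X i \<Longrightarrow> chart A i (chart_inv A i q) = q"
  using chart_inv_chart by fastforce

lemma chart_inv_in_dom: "i \<in> index A \<Longrightarrow> q \<in> X i \<Longrightarrow> chart_inv A i q \<in> chart_dom A i"
  using chart_inv_chart by fastforce

lemma continuous_chart: "i \<in> index A \<Longrightarrow> continuous_on (chart_dom A i) (chart A i)"
  and continuous_chart_inv: "i \<in> index A \<Longrightarrow> continuous_on (X i) (chart_inv A i)"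
  using chart_homeo by (auto simp: homeomorphism_def)

lemma open_chart_preimage:
  assumes "i \<in> index A" "open U"
  shows "open {x \<in> chart_dom A i. chart A i x \<in> U}"
  using continuous_open_preimage[OF continuous_chart[OF assms(1)] open_dom[OF assms(1)] assms(2)]
  by (simp add: vimage_def Int_def)

lemma compact_chart_inv_image:
  "i \<in> index A \<Longrightarrow> compact Q \<Longrightarrow> Q \<subseteq> X i \<Longrightarrow> compact (chart_inv A i ` Q)"
  by (meson compact_continuous_image continuous_chart_inv continuous_on_subset)

lemma chart_at: "chart_at A x \<in> index A" "x \<in> chart_dom A (chart_at A x)"
proof -
  have "x \<in> (\<Union>i\<in>index A. chart_dom A i)" using atlas by (simp add: smooth_atlas_def)
  then have "\<exists>i. i \<in> index A \<and> x \<in> chart_dom A i" by blast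
  from someI_ex[OF this] show "chart_at A x \<in> index A" "x \<in> chart_dom A (chart_at A x)"
    by (simp_all add: chart_at_def)
qed

lemma times_line_simps [simp]:
  "index (times_line A) = index A"
  "chart_dom (times_line A) i = chart_dom A i \<times> UNIV"
  "chart (times_line A) i z = (chart A i (fst z), snd z)"
  by (simp_all add: times_line_def case_prod_unfold)

lemma chart_inv_times_line:
  assumes "i \<in> index A" "q \<in> X i"
  shows "chart_inv (times_line A) i (q, t) = (chart_inv A i q, t)"
  unfolding chart_inv_def
proof (rule inv_into_f_eq)
  show "inj_on (chart (times_line A) i) (chart_dom (times_line A) i)"
    using chart_inv_chart[OF assms(1)] by (auto intro!: inj_onI) metis
  have "inv_into (chart_dom A i) (chart A i) q \<in> chart_dom A i"
    using chart_inv_in_dom[OF assms] by (simp add: chart_inv_def)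
  then show "(inv_into (chart_dom A i) (chart A i) q, t) \<in> chart_dom (times_line A) i" by simp
  show "chart (times_line A) i (inv_into (chart_dom A i) (chart A i) q, t) = (q, t)"
    using chart_chart_inv[OF assms] by (simp add: chart_inv_def)
qed

definition G :: "'i \<Rightarrow> 'e \<Rightarrow> 'e \<Rightarrow> 'e \<Rightarrow> real" where "G i q = g\<^sub>0 i (chart_inv A i q)"
definition W :: "'i \<Rightarrow> 'e \<Rightarrow> 'e \<Rightarrow> real" where "W i q = \<omega> i (chart_inv A i q)"
definition L :: "'i \<Rightarrow> 'e \<Rightarrow> real" where "L i q = \<Lambda> (chart_inv A i q)"

lemma G_facts:
  assumes "i \<in> index A" "q \<in> X i"
  shows "bilinear (G i q)" "u \<noteq> 0 \<Longrightarrow> 0 < G i q u u"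
  using metric chart_inv_in_dom[OF assms] assms(1) by (auto simp: riemannian_metric_def G_def)

lemma G_nonneg: "i \<in> index A \<Longrightarrow> q \<in> X i \<Longrightarrow> 0 \<le> G i q u u"
  using G_facts[of i q] bilinear_lzero[of "G i q"] by (cases "u = 0") (auto simp: less_imp_le)

lemma W_linear: "i \<in> index A \<Longrightarrow> q \<in> X i \<Longrightarrow> linear (W i q)"
  using form chart_inv_in_dom by (auto simp: smooth_one_form_def W_def)

lemma W_nonzero: "i \<in> index A \<Longrightarrow> q \<in> X i \<Longrightarrow> \<exists>b\<in>Basis. W i q b \<noteq> 0"
proof -
  assume i: "i \<in> index A" "q \<in> X i"
  then have "W i q \<noteq> (\<lambda>_. 0)"
    using form_nonzero chart_inv_in_dom[OF i] by (simp add: W_def)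
  then obtain u where "W i q u \<noteq> 0" by auto
  then show ?thesis using linear_expansion[OF W_linear[OF i], of u] by (metis (no_types, lifting)
        scaleR_zero_right sum.neutral)
qed

lemma L_nonneg: "0 \<le> L i q" using Lambda_nonneg by (simp add: L_def)

lemma G_smooth: "i \<in> index A \<Longrightarrow> smooth_on (\<lambda>q. G i q u v) (X i)"
  and W_smooth: "i \<in> index A \<Longrightarrow> smooth_on (\<lambda>q. W i q u) (X i)"
  and L_smooth: "i \<in> index A \<Longrightarrow> smooth_on (L i) (X i)"
  using metric form Lambda_smooth
  by (auto simp: riemannian_metric_def smooth_one_form_def smooth_function_def o_def G_def W_def L_def[abs_def])

text \<open>The coordinate expression of \<open>g\<^sub>\<epsilon>\<close> is \<open>M i q u v - \<epsilon> * (snd u * snd v)\<close>; in particular its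
  Christoffel symbols of the first kind do not depend on \<open>\<epsilon>\<close>.\<close>

definition M :: "'i \<Rightarrow> 'e \<Rightarrow> 'e \<times> real \<Rightarrow> 'e \<times> real \<Rightarrow> real" where
  "M i q u v = G i q (fst u) (fst v) + W i q (fst u) * snd v + snd u * W i q (fst v)
     - L i q * (snd u * snd v)"

text \<open>The derivative of the components in direction \<open>w\<close>, with \<open>u\<close>
  and \<open>v\<close> frozen. The direction is purely spatial because no coefficient depends on
  \<open>t\<close>.\<close>

definition DM :: "'i \<Rightarrow> 'e \<Rightarrow> 'e \<Rightarrow> 'e \<times> real \<Rightarrow> 'e \<times> real \<Rightarrow> real" where
  "DM i q w u v = frechet_derivative (\<lambda>q. G i q (fst u) (fst v)) (at q) w
     + frechet_derivative (\<lambda>q. W i q (fst u)) (at q) w * snd v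
     + snd u * frechet_derivative (\<lambda>q. W i q (fst v)) (at q) w
     - frechet_derivative (L i) (at q) w * (snd u * snd v)"

lemma lorentz_metric_eq:
  "lorentz_metric g\<^sub>0 \<omega> \<Lambda> \<epsilon> i (chart_inv A i q, t) u v = M i q u v - \<epsilon> * (snd u * snd v)"
  by (simp add: lorentz_metric_def M_def G_def W_def L_def algebra_simps)

lemma M_has_derivative:
  assumes "i \<in> index A" "q \<in> X i"
  shows "((\<lambda>q. M i q u v) has_derivative (\<lambda>w. DM i q w u v)) (at q)"
  unfolding M_def DM_def
  by (auto intro!: derivative_eq_intros smooth_on_has_derivative[OF G_smooth[OF assms(1)] assms(2)]
      smooth_on_has_derivative[OF W_smooth[OF assms(1)] assms(2)]
      smooth_on_has_derivative[OF L_smooth[OF assms(1)] assms(2)])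

lemma M_bilinear: "i \<in> index A \<Longrightarrow> q \<in> X i \<Longrightarrow> bilinear (M i q)"
proof -
  assume i: "i \<in> index A" "q \<in> X i"
  note b = G_facts(1)[OF i] and w = W_linear[OF i]
  show ?thesis
    unfolding bilinear_def M_def
    by (auto intro!: linearI simp: bilinear_ladd[OF b] bilinear_radd[OF b] bilinear_lmul[OF b]
        bilinear_rmul[OF b] linear_add[OF w] linear_scale[OF w] algebra_simps)
qed

text \<open>Testing against the vector with reversed time component cancels the cross terms in
  \<omega> and leaves a sum of nonnegative terms, which kills \<open>fst u\<close>. It need not
  control \<open>snd u\<close>, as \<open>L i q + \<epsilon>\<close> may vanish; for this the
  nonvanishing of \<omega> is used.\<close>

lemma M_nondegenerate:
  assumes "i \<in> index A" "q \<in> X i" "0 \<le> \<epsilon>" "\<And>w. M i q u w - \<epsilon> * (snd u * snd w) = 0"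
  shows "u = 0"
proof -
  have "G i q (fst u) (fst u) + (L i q + \<epsilon>) * (snd u)\<^sup>2 = 0"
    using assms(4)[of "(fst u, - snd u)"] by (simp add: M_def power2_eq_square algebra_simps)
  moreover have "0 \<le> (L i q + \<epsilon>) * (snd u)\<^sup>2" using L_nonneg[of i q] assms(3) by simp
  ultimately have "G i q (fst u) (fst u) \<le> 0" by linarith
  then have f: "fst u = 0" using G_facts(2)[OF assms(1,2)] by fastforce
  obtain b where b: "W i q b \<noteq> 0" using W_nonzero[OF assms(1,2)] by blast
  have "snd u = 0"
    using assms(4)[of "(b, 0)"] f b bilinear_lzero[OF G_facts(1)[OF assms(1,2)]]
    by (simp add: M_def)
  with f show ?thesis by (simp add: prod_eq_iff)
qed

lemma DM_linear: "i \<in> index A \<Longrightarrow> q \<in> X i \<Longrightarrow> linear (\<lambda>w. DM i q w u v)"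
  using M_has_derivative has_derivative_linear by blast

text \<open>Each linearity law is a finite linear relation between the functions
  \<open>M i _ u v\<close> that holds on the whole open set \<open>X i\<close>, and derivatives obey
  every linear relation that the functions obey near the point.\<close>

lemma DM_bilinear:
  assumes i: "i \<in> index A" "q \<in> X i"
  shows "bilinear (DM i q w)"
proof -
  have *: "DM i q w u v = (\<Sum>k\<in>I. c k * DM i q w (a k) (b k))"
    if "\<And>p. p \<in> X i \<Longrightarrow> M i p u v = (\<Sum>k\<in>I. c k * M i p (a k) (b k))"
    for u v and I :: "nat set" and c a b
  proof -
    have "((\<lambda>p. \<Sum>k\<in>I. c k * M i p (a k) (b k)) has_derivative
        (\<lambda>w. \<Sum>k\<in>I. c k * DM i q w (a k) (b k))) (at q)"
      by (intro has_derivative_sum has_derivative_mult_right M_has_derivative i)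
    then have "((\<lambda>p. M i p u v) has_derivative (\<lambda>w. \<Sum>k\<in>I. c k * DM i q w (a k) (b k))) (at q)"
      by (rule has_derivative_transform_within_open[OF _ open_X[OF i(1)] i(2)]) (simp add: that)
    from has_derivative_unique[OF M_has_derivative[OF i] this] show ?thesis by metis
  qed
  have "DM i q w (u + u') v = DM i q w u v + DM i q w u' v" for u u' v
    using *[where u="u + u'" and v=v and I="{0, 1}" and c="\<lambda>_. 1" and a="\<lambda>k. if k = 0 then u else u'" and b="\<lambda>_. v"]
    by (simp add: bilinear_ladd[OF M_bilinear[OF i(1)]])
  moreover have "DM i q w v (u + u') = DM i q w v u + DM i q w v u'" for u u' v
    using *[where u=v and v="u + u'" and I="{0, 1}" and c="\<lambda>_. 1" and a="\<lambda>_. v" and b="\<lambda>k. if k = 0 then u else u'"]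
    by (simp add: bilinear_radd[OF M_bilinear[OF i(1)]])
  moreover have "DM i q w (r *\<^sub>R u) v = r * DM i q w u v" for r u v
    using *[where u="r *\<^sub>R u" and v=v and I="{0}" and c="\<lambda>_. r" and a="\<lambda>_. u" and b="\<lambda>_. v"]
    by (simp add: bilinear_lmul[OF M_bilinear[OF i(1)]])
  moreover have "DM i q w v (r *\<^sub>R u) = r * DM i q w v u" for r u v
    using *[where u=v and v="r *\<^sub>R u" and I="{0}" and c="\<lambda>_. r" and a="\<lambda>_. v" and b="\<lambda>_. u"]
    by (simp add: bilinear_rmul[OF M_bilinear[OF i(1)]])
  ultimately show ?thesis unfolding bilinear_def by (auto intro!: linearI)
qed

lemma path_Ck_M:
  assumes "i \<in> index A" "path_Ck k T q" "q ` T \<subseteq> X i"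
  shows "path_Ck k T (\<lambda>t. M i (q t) u v)" "path_Ck k T (\<lambda>t. DM i (q t) w u v)"
proof -
  have c: "path_Ck k T (\<lambda>t. f (q t))" if "Ck_on k f (X i)" for f :: "'e \<Rightarrow> real"
    using path_Ck_compose[OF that assms(2,3)] .
  note s = G_smooth[OF assms(1)] W_smooth[OF assms(1)] L_smooth[OF assms(1)]
  note c1 = s[unfolded smooth_on_def, rule_format, THEN c]
  note c2 = s[THEN smooth_on_Ck_derivative, THEN c]
  have "path_Ck k T (\<lambda>t. G i (q t) (fst u) (fst v) + W i (q t) (fst u) * snd v
      + snd u * W i (q t) (fst v) + (- 1) * (L i (q t) * (snd u * snd v)))"
    by (intro path_Ck_add path_Ck_mult path_Ck_const c1)
  then show "path_Ck k T (\<lambda>t. M i (q t) u v)" by (simp add: M_def)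
  have "path_Ck k T (\<lambda>t. frechet_derivative (\<lambda>q. G i q (fst u) (fst v)) (at (q t)) w
     + frechet_derivative (\<lambda>q. W i q (fst u)) (at (q t)) w * snd v
     + snd u * frechet_derivative (\<lambda>q. W i q (fst v)) (at (q t)) w
     + (- 1) * (frechet_derivative (L i) (at (q t)) w * (snd u * snd v)))"
    by (intro path_Ck_add path_Ck_mult path_Ck_const c2)
  then show "path_Ck k T (\<lambda>t. DM i (q t) w u v)" by (simp add: DM_def)
qed

lemma continuous_on_M: "i \<in> index A \<Longrightarrow> continuous_on (X i) (\<lambda>q. M i q u v)"
  and continuous_on_DM: "i \<in> index A \<Longrightarrow> continuous_on (X i) (\<lambda>q. DM i q w u v)"
proof -
  assume i: "i \<in> index A"
  note s = G_smooth[OF i] W_smooth[OF i] L_smooth[OF i]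
  show "continuous_on (X i) (\<lambda>q. M i q u v)"
    unfolding M_def by (intro continuous_intros s[THEN smooth_on_continuous])
  have "Ck_on 0 (\<lambda>x. frechet_derivative f (at x) w) (X i)" if "smooth_on f (X i)" for f :: "'e \<Rightarrow> real"
    using smooth_on_Ck_derivative[OF that] .
  then show "continuous_on (X i) (\<lambda>q. DM i q w u v)"
    unfolding DM_def using s by (intro continuous_intros) auto
qed

lemma continuous_on_M_joint:
  assumes "i \<in> index A" "continuous_on T q" "continuous_on T u" "continuous_on T v" "q ` T \<subseteq> X i"
  shows "continuous_on T (\<lambda>t. M i (q t) (u t) (v t))"
proof -
  have "continuous_on T (\<lambda>t. \<Sum>b\<in>Basis. \<Sum>c\<in>Basis. (u t \<bullet> b) * (v t \<bullet> c) * M i (q t) b c)"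
    by (intro continuous_intros assms continuous_on_compose2[OF continuous_on_M[OF assms(1)] assms(2)])
  then show ?thesis
  proof (rule continuous_on_eq)
    fix t assume "t \<in> T"
    then have "q t \<in> X i" using assms(5) by blast
    from bilinear_form_expansion[OF M_bilinear[OF assms(1) this], of "u t" "v t"]
    show "(\<Sum>b\<in>Basis. \<Sum>c\<in>Basis. (u t \<bullet> b) * (v t \<bullet> c) * M i (q t) b c) = M i (q t) (u t) (v t)" by simp
  qed
qed

lemma continuous_on_DM_joint:
  assumes "i \<in> index A" "continuous_on T q" "continuous_on T u" "continuous_on T v" "q ` T \<subseteq> X i"
  shows "continuous_on T (\<lambda>t. DM i (q t) w (u t) (v t))"
proof -
  have "continuous_on T (\<lambda>t. \<Sum>b\<in>Basis. \<Sum>c\<in>Basis. (u t \<bullet> b) * (v t \<bullet> c) * DM i (q t) w b c)"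
    by (intro continuous_intros assms continuous_on_compose2[OF continuous_on_DM[OF assms(1)] assms(2)])
  then show ?thesis
  proof (rule continuous_on_eq)
    fix t assume "t \<in> T"
    then have "q t \<in> X i" using assms(5) by blast
    from bilinear_form_expansion[OF DM_bilinear[OF assms(1) this], of w "u t" "v t"]
    show "(\<Sum>b\<in>Basis. \<Sum>c\<in>Basis. (u t \<bullet> b) * (v t \<bullet> c) * DM i (q t) w b c) = DM i (q t) w (u t) (v t)" by simp
  qed
qed

text \<open>In these charts the \<epsilon>-term has a constant coefficient and nothing depends on
  \<open>t\<close>; hence \<epsilon> drops out and only the spatial part of \<open>w\<close>
  survives.\<close>

lemma metric_deriv_eq:
  assumes "i \<in> index A" "x \<in> chart_dom A i"
  shows "metric_deriv (times_line A) (lorentz_metric g\<^sub>0 \<omega> \<Lambda> \<epsilon>) i (x, t) w u v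
    = DM i (chart A i x) (fst w) u v"
proof -
  let ?q = "chart A i x"
  have q: "?q \<in> X i" using assms(2) by blast
  have "((\<lambda>p. M i (fst p) u v - \<epsilon> * (snd u * snd v)) has_derivative (\<lambda>w. DM i ?q (fst w) u v)) (at (?q, t))"
    using has_derivative_compose[OF has_derivative_fst[OF has_derivative_ident],
        of "\<lambda>q. M i q u v" _ "(?q, t)" UNIV] M_has_derivative[OF assms(1) q, of u v]
    by (auto intro!: derivative_eq_intros)
  then have "((\<lambda>p. lorentz_metric g\<^sub>0 \<omega> \<Lambda> \<epsilon> i (chart_inv (times_line A) i p) u v)
      has_derivative (\<lambda>w. DM i ?q (fst w) u v)) (at (?q, t))"
  proof (rule has_derivative_transform_within_open[OF _ open_Times[OF open_X[OF assms(1)] open_UNIV]])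
    fix p assume "p \<in> X i \<times> (UNIV :: real set)"
    then show "M i (fst p) u v - \<epsilon> * (snd u * snd v)
        = lorentz_metric g\<^sub>0 \<omega> \<Lambda> \<epsilon> i (chart_inv (times_line A) i p) u v"
      using chart_inv_times_line[OF assms(1), of "fst p" "snd p"]
        lorentz_metric_eq[of \<epsilon> i "fst p" "snd p" u v] by (cases p) simp
  qed (use q in simp)
  then show ?thesis
    unfolding metric_deriv_def by (simp add: frechet_derivative_at[symmetric])
qed

lemma christoffel_eq:
  assumes "i \<in> index A" "x \<in> chart_dom A i"
  shows "christoffel (times_line A) (lorentz_metric g\<^sub>0 \<omega> \<Lambda> \<epsilon>) i (x, t) u u w
    = DM i (chart A i x) (fst u) u w - DM i (chart A i x) (fst w) u u / 2"
  by (simp add: christoffel_def metric_deriv_eq[OF assms])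

lemma has_vector_derivative_M:
  assumes i: "i \<in> index A" and T: "t \<in> T" "q t \<in> X i"
    and q: "(q has_vector_derivative q') (at t within T)"
    and u: "(u has_vector_derivative u') (at t within T)"
    and dom: "\<forall>\<^sub>F s in at t within T. q s \<in> X i"
  shows "((\<lambda>s. M i (q s) (u s) w) has_vector_derivative M i (q t) u' w + DM i (q t) q' (u t) w) (at t within T)"
proof -
  have M: "((\<lambda>s. M i (q s) b w) has_vector_derivative DM i (q t) q' b w) (at t within T)" for b
    using vector_derivative_diff_chain_within[OF q, of "\<lambda>q. M i q b w"]
      has_derivative_at_withinI[OF M_has_derivative[OF i T(2)]] by (fastforce simp: o_def)
  have e: "M i p v w = (\<Sum>b\<in>Basis. (v \<bullet> b) * M i p b w)" "DM i p y v w = (\<Sum>b\<in>Basis. (v \<bullet> b) * DM i p y b w)"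
    if "p \<in> X i" for p v y
    using linear_expansion[OF bilinear_linear_left[OF M_bilinear[OF i that]], of v w]
      linear_expansion[OF bilinear_linear_left[OF DM_bilinear[OF i that]], of y v w] by simp_all
  have u: "((\<lambda>s. u s \<bullet> b) has_vector_derivative u' \<bullet> b) (at t within T)" for b
    using bounded_linear.has_vector_derivative[OF bounded_linear_inner_left u] .
  have "((\<lambda>s. \<Sum>b\<in>Basis. (u s \<bullet> b) * M i (q s) b w) has_vector_derivative
      (\<Sum>b\<in>Basis. (u t \<bullet> b) * DM i (q t) q' b w + (u' \<bullet> b) * M i (q t) b w)) (at t within T)"
    by (intro has_vector_derivative_sum has_vector_derivative_mult u M)
  then have "((\<lambda>s. M i (q s) (u s) w) has_vector_derivative
      (\<Sum>b\<in>Basis. (u t \<bullet> b) * DM i (q t) q' b w + (u' \<bullet> b) * M i (q t) b w)) (at t within T)"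
    unfolding has_vector_derivative_def
  proof (rule has_derivative_transform_eventually)
    show "\<forall>\<^sub>F s in at t within T. (\<Sum>b\<in>Basis. (u s \<bullet> b) * M i (q s) b w) = M i (q s) (u s) w"
      using dom by eventually_elim (rule e(1)[symmetric])
  qed (use T e(1)[symmetric] in blast)+
  then show ?thesis
    by (simp only: e(1)[OF T(2), where v=u'] e(2)[OF T(2), where v="u t" and y=q'] sum.distrib add.commute)
qed

end


subsection \<open>Uniform bounds in a chart\<close>

text \<open>\<open>y\<close> and \<open>s\<close> stand for the norms of the spatial and temporal
  parts of a vector whose lowered form has size \<rho>. The second inequality gives
  \<open>s \<le> k * (\<rho> + y)\<close>; if \<open>\<rho> < y\<close>, then
  \<open>y + s \<le> (1 + 2 * k) * y\<close>, and the first one yields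
  \<open>y \<le> (1 + 2 * k) / l * \<rho>\<close>. The summand 1 in \<open>c\<close> covers the case
  \<open>y \<le> \<rho>\<close>.\<close>

lemma quadratic_estimate:
  fixes y s \<rho> l w n B :: real
  assumes "0 < l" "0 < w" "0 \<le> n" "0 \<le> B" "0 \<le> y" "0 \<le> s" "0 \<le> \<rho>"
    and 1: "l * y\<^sup>2 \<le> \<rho> * (y + s)" and 2: "w * s \<le> n * (\<rho> + B * y)"
  defines "k \<equiv> n * (1 + B) / w"
  defines "c \<equiv> 1 + (1 + 2 * k) / l"
  shows "y + s \<le> (c + k * (1 + c)) * \<rho>"
proof -
  have k0: "0 \<le> k" using assms(2,3,4) by (simp add: k_def)
  have "n * (\<rho> + B * y) \<le> n * ((1 + B) * (\<rho> + y))"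
    using assms(3-7) by (intro mult_left_mono) (auto simp: algebra_simps)
  then have s: "s \<le> k * (\<rho> + y)"
    using 2 assms(2) by (simp add: k_def pos_le_divide_eq mult.commute mult.left_commute)
  have y: "y \<le> c * \<rho>"
  proof (cases "y \<le> \<rho>")
    case True
    have "0 \<le> (1 + 2 * k) / l" using k0 assms(1) by simp
    then have "1 * \<rho> \<le> c * \<rho>" using assms(7) by (intro mult_right_mono) (auto simp: c_def)
    with True show ?thesis by simp
  next
    case False
    then have y0: "0 < y" using assms(7) by linarith
    have "k * (\<rho> + y) \<le> k * (2 * y)" using False k0 by (intro mult_left_mono) auto
    then have "y + s \<le> (1 + 2 * k) * y" using s by (simp add: algebra_simps)
    then have "\<rho> * (y + s) \<le> \<rho> * ((1 + 2 * k) * y)" using assms(7) mult_left_mono by blast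
    then have "(l * y) * y \<le> (\<rho> * (1 + 2 * k)) * y" using 1 by (simp add: power2_eq_square ac_simps)
    then have "l * y \<le> \<rho> * (1 + 2 * k)" using y0 by simp
    then have "y \<le> (1 + 2 * k) / l * \<rho>" using assms(1) by (simp add: pos_le_divide_eq mult.commute)
    also have "\<dots> \<le> c * \<rho>" using assms(7) by (intro mult_right_mono) (auto simp: c_def)
    finally show ?thesis .
  qed
  have "k * (\<rho> + y) \<le> k * ((1 + c) * \<rho>)" using y k0 by (intro mult_left_mono) (auto simp: algebra_simps)
  with s y show ?thesis by (simp add: algebra_simps)
qed

text \<open>If \<open>t < y\<close>, then \<open>B * t * t \<le> B * t * y\<close>, and one factor
  \<open>y\<close> cancels. Applied to null vectors, this bounds the slope of the light
  cones.\<close>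

lemma quadratic_estimate2:
  fixes y t l B :: real
  assumes "0 < l" "0 \<le> B" "0 \<le> y" "0 < t" "l * y\<^sup>2 \<le> B * t\<^sup>2 + 2 * B * y * t"
  shows "y \<le> (1 + 3 * B / l) * t"
proof (cases "y \<le> t")
  case True
  have "0 \<le> 3 * B / l * t" using assms by simp
  with True show ?thesis by (simp add: algebra_simps)
next
  case False
  then have "B * t * t \<le> B * t * y" using assms by (intro mult_left_mono) auto
  then have "(l * y) * y \<le> (3 * B * t) * y" using assms(5) by (simp add: power2_eq_square algebra_simps)
  then have "l * y \<le> 3 * B * t" using False assms by simp
  then have "y \<le> 3 * B / l * t" using assms(1) by (simp add: pos_le_divide_eq mult.commute)
  with assms(4) show ?thesis by (simp add: algebra_simps)
qed

context stationary
begin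

text \<open>One constant for all estimates on \<open>Q\<close>. The fourth condition bounds the
  inverse of the metric with parameter \<epsilon> by duality, the fifth the slope of its light
  cones; both include \<epsilon> = 0, where \<Lambda> may vanish.\<close>

definition chart_bound :: "'i \<Rightarrow> 'e set \<Rightarrow> real \<Rightarrow> bool" where
  "chart_bound i Q C \<longleftrightarrow> 1 \<le> C \<and> (\<forall>q\<in>Q.
     (\<forall>u v. \<bar>M i q u v\<bar> \<le> C * norm u * norm v) \<and>
     (\<forall>w u v. \<bar>DM i q w u v\<bar> \<le> C * norm w * norm u * norm v) \<and>
     (\<forall>u. (norm u)\<^sup>2 \<le> C * G i q u u) \<and>
     (\<forall>\<epsilon> a \<rho>. 0 \<le> \<epsilon> \<longrightarrow> (\<forall>w. \<bar>M i q a w - \<epsilon> * (snd a * snd w)\<bar> \<le> \<rho> * norm w) \<longrightarrow> norm a \<le> C * \<rho>) \<and>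
     (\<forall>\<epsilon> v t. 0 \<le> \<epsilon> \<longrightarrow> \<epsilon> \<le> 1 \<longrightarrow> 0 < t \<longrightarrow> M i q (v, t) (v, t) = \<epsilon> * t\<^sup>2 \<longrightarrow> norm v \<le> C * t))"

lemma chart_boundD:
  assumes "chart_bound i Q C" "q \<in> Q"
  shows "\<bar>M i q u v\<bar> \<le> C * norm u * norm v"
    and "\<bar>DM i q w u v\<bar> \<le> C * norm w * norm u * norm v"
    and "(norm x)\<^sup>2 \<le> C * G i q x x"
    and "0 \<le> \<epsilon> \<Longrightarrow> (\<And>w. \<bar>M i q a w - \<epsilon> * (snd a * snd w)\<bar> \<le> \<rho> * norm w) \<Longrightarrow> norm a \<le> C * \<rho>"
    and "0 \<le> \<epsilon> \<Longrightarrow> \<epsilon> \<le> 1 \<Longrightarrow> 0 < t \<Longrightarrow> M i q (x, t) (x, t) = \<epsilon> * t\<^sup>2 \<Longrightarrow> norm x \<le> C * t"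
    and "1 \<le> C"
  using assms unfolding chart_bound_def by blast+

lemma chart_bound_exists:
  assumes i: "i \<in> index A" and Q: "compact Q" "Q \<subseteq> X i"
  obtains C where "chart_bound i Q C"
proof (cases "Q = {}")
  case True
  then show thesis using that[of 1] by (simp add: chart_bound_def)
next
  case False
  note sub = continuous_on_subset[OF _ Q(2)]
  have bound: "\<exists>B. \<forall>q\<in>Q. f q \<le> B" if "continuous_on Q f" for f :: "'e \<Rightarrow> real"
    using compact_continuous_image[OF that Q(1)] compact_imp_bounded bounded_imp_bdd_above
    by (metis bdd_above_def image_eqI)
  have "continuous_on Q (\<lambda>q. \<Sum>b\<in>Basis. \<Sum>c\<in>Basis. \<bar>M i q b c\<bar>)"
    by (intro continuous_intros sub continuous_on_M i)
  then obtain B1 where B1: "\<And>q. q \<in> Q \<Longrightarrow> (\<Sum>b\<in>Basis. \<Sum>c\<in>Basis. \<bar>M i q b c\<bar>) \<le> B1"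
    using bound by blast
  have "continuous_on Q (\<lambda>q. \<Sum>w\<in>Basis. \<Sum>b\<in>Basis. \<Sum>c\<in>Basis. \<bar>DM i q w b c\<bar>)"
    by (intro continuous_intros sub continuous_on_DM i)
  then obtain B2 where B2: "\<And>q. q \<in> Q \<Longrightarrow> (\<Sum>w\<in>Basis. \<Sum>b\<in>Basis. \<Sum>c\<in>Basis. \<bar>DM i q w b c\<bar>) \<le> B2"
    using bound by blast
  define B where "B = max 0 B1"
  have B0: "0 \<le> B" by (simp add: B_def)
  have MB: "\<bar>M i q u v\<bar> \<le> B * norm u * norm v" if "q \<in> Q" for q u v
  proof -
    have "\<bar>M i q u v\<bar> \<le> norm u * norm v * (\<Sum>b\<in>Basis. \<Sum>c\<in>Basis. \<bar>M i q b c\<bar>)"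
      using bilinear_form_le[OF M_bilinear[OF i]] that Q(2) by blast
    also have "\<dots> \<le> norm u * norm v * B"
      using B1[OF that] by (intro mult_left_mono) (auto simp: B_def)
    finally show ?thesis by (simp add: ac_simps)
  qed
  have DB: "\<bar>DM i q w u v\<bar> \<le> B2 * norm w * norm u * norm v" if q: "q \<in> Q" for q u v w
  proof -
    have qX: "q \<in> X i" using q Q(2) by blast
    have "DM i q w u v = (\<Sum>b\<in>Basis. (w \<bullet> b) * DM i q b u v)"
      using linear_expansion[OF DM_linear[OF i qX], of w u v] by simp
    also have "\<bar>\<dots>\<bar> \<le> (\<Sum>b\<in>Basis. \<bar>(w \<bullet> b) * DM i q b u v\<bar>)" by (rule sum_abs)
    also have "\<dots> \<le> (\<Sum>b\<in>Basis. norm w * (norm u * norm v * (\<Sum>c\<in>Basis. \<Sum>d\<in>Basis. \<bar>DM i q b c d\<bar>)))"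
      unfolding abs_mult
      by (intro sum_mono mult_mono bilinear_form_le[OF DM_bilinear[OF i qX]]) (auto simp: Basis_le_norm)
    also have "\<dots> = norm w * norm u * norm v * (\<Sum>b\<in>Basis. \<Sum>c\<in>Basis. \<Sum>d\<in>Basis. \<bar>DM i q b c d\<bar>)"
      by (simp add: sum_distrib_left ac_simps)
    also have "\<dots> \<le> norm w * norm u * norm v * B2"
      using B2[OF q] by (intro mult_left_mono) auto
    finally show ?thesis by (simp add: ac_simps)
  qed
  have GM: "G i q u v = M i q (u, 0) (v, 0)" for q u v by (simp add: M_def)
  have WM: "W i q u = M i q (u, 0) (0, 1)" if "q \<in> Q" for q u
    using bilinear_rzero[OF G_facts(1)[OF i]] Q(2) that by (auto simp: M_def)
  \<comment> \<open>The form is quadratic in \<open>u\<close>, so it is enough to minimise it over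
    unit vectors, and \<open>Q\<close> times the unit sphere is compact.\<close>
  have "\<exists>l>0. \<forall>q\<in>Q. \<forall>u. l * (norm u)\<^sup>2 \<le> G i q u u"
  proof -
    let ?S = "Q \<times> sphere (0::'e) 1"
    have "continuous_on ?S (\<lambda>z. G i (fst z) (snd z) (snd z))"
      unfolding GM using Q(2) by (intro continuous_on_M_joint i continuous_intros) auto
    moreover have "compact ?S" "?S \<noteq> {}" using Q(1) False by (auto intro: compact_Times)
    ultimately obtain z where z: "z \<in> ?S" "\<And>y. y \<in> ?S \<Longrightarrow>
        G i (fst z) (snd z) (snd z) \<le> G i (fst y) (snd y) (snd y)"
      using continuous_attains_inf[of ?S "\<lambda>z. G i (fst z) (snd z) (snd z)"] by blast
    let ?l = "G i (fst z) (snd z) (snd z)"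
    have "fst z \<in> X i" "snd z \<noteq> 0" using z(1) Q(2) by (auto simp: mem_Times_iff)
    then have "0 < ?l" by (rule G_facts(2)[OF i])
    moreover have "?l * (norm u)\<^sup>2 \<le> G i q u u" if q: "q \<in> Q" for q u
    proof (cases "u = 0")
      case True
      then show ?thesis using G_nonneg[OF i, of q u] q Q(2) by auto
    next
      case False
      have b: "bilinear (G i q)" using G_facts(1)[OF i] q Q(2) by blast
      have "?l \<le> G i q (u /\<^sub>R norm u) (u /\<^sub>R norm u)"
        using z(2)[of "(q, u /\<^sub>R norm u)"] q False by simp
      also have "\<dots> = G i q u u / (norm u)\<^sup>2"
        by (simp add: bilinear_lmul[OF b] bilinear_rmul[OF b] power2_eq_square divide_inverse)
      finally show ?thesis using False by (simp add: pos_le_divide_eq)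
    qed
    ultimately show ?thesis by blast
  qed
  then obtain l where l: "0 < l" "\<And>q u. q \<in> Q \<Longrightarrow> l * (norm u)\<^sup>2 \<le> G i q u u" by blast
  have "\<exists>w>0. \<forall>q\<in>Q. w \<le> (\<Sum>b\<in>Basis. \<bar>W i q b\<bar>)"
  proof -
    have "continuous_on Q (\<lambda>q. \<Sum>b\<in>Basis. \<bar>W i q b\<bar>)"
      by (intro continuous_intros sub smooth_on_continuous W_smooth i)
    then obtain p where p: "p \<in> Q" "\<And>q. q \<in> Q \<Longrightarrow> (\<Sum>b\<in>Basis. \<bar>W i p b\<bar>) \<le> (\<Sum>b\<in>Basis. \<bar>W i q b\<bar>)"
      using continuous_attains_inf[OF Q(1) False] by metis
    obtain b where "b \<in> Basis" "W i p b \<noteq> 0" using W_nonzero[OF i] p(1) Q(2) by blast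
    then have "0 < (\<Sum>b\<in>Basis. \<bar>W i p b\<bar>)" by (intro sum_pos2[of _ b]) auto
    then show ?thesis using p(2) by blast
  qed
  then obtain w where w: "0 < w" "\<And>q. q \<in> Q \<Longrightarrow> w \<le> (\<Sum>b\<in>Basis. \<bar>W i q b\<bar>)" by blast
  define k where "k = real DIM('e) * (1 + B) / w"
  define c where "c = 1 + (1 + 2 * k) / l"
  \<comment> \<open>\<open>B\<close> and \<open>B2\<close> serve the bounds of the components and
    their derivatives, \<open>1 / l\<close> the ellipticity, and the last two entries come from
    \<open>quadratic_estimate\<close> and \<open>quadratic_estimate2\<close>. In the last one
    \<open>B + 1\<close> replaces \<open>B\<close> because of \<epsilon> \<le> 1.\<close>
  define C where "C = Max {1, B, B2, 1 / l, c + k * (1 + c), 1 + 3 * (B + 1) / l}"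
  have C: "1 \<le> C" "B \<le> C" "B2 \<le> C" "1 / l \<le> C" "c + k * (1 + c) \<le> C" "1 + 3 * (B + 1) / l \<le> C"
    unfolding C_def by (intro Max_ge; simp)+
  have "chart_bound i Q C"
    unfolding chart_bound_def
  proof (intro conjI ballI allI impI C)
    fix q assume q: "q \<in> Q"
    then have qX: "q \<in> X i" using Q(2) by blast
    show "\<bar>M i q u v\<bar> \<le> C * norm u * norm v" for u v
      using MB[OF q, of u v] mult_right_mono[OF C(2), of "norm u * norm v"] by (simp add: ac_simps)
    show "\<bar>DM i q w u v\<bar> \<le> C * norm w * norm u * norm v" for w u v
      using DB[OF q, of w u v] mult_right_mono[OF C(3), of "norm w * (norm u * norm v)"] by (simp add: ac_simps)
    show "(norm u)\<^sup>2 \<le> C * G i q u u" for u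
    proof -
      have "(norm u)\<^sup>2 \<le> 1 / l * G i q u u" using l(1) l(2)[OF q, of u] by (simp add: pos_le_divide_eq mult.commute)
      also have "\<dots> \<le> C * G i q u u" by (rule mult_right_mono[OF C(4) G_nonneg[OF i qX]])
      finally show ?thesis .
    qed
    show "norm a \<le> C * \<rho>"
      if e: "0 \<le> \<epsilon>" and r: "\<forall>w. \<bar>M i q a w - \<epsilon> * (snd a * snd w)\<bar> \<le> \<rho> * norm w" for \<epsilon> a \<rho>
    proof -
      have r0: "0 \<le> \<rho>" using r[rule_format, of "(0, 1)"] by (simp add: norm_Pair)
      have "l * (norm (fst a))\<^sup>2 \<le> G i q (fst a) (fst a)" by (rule l(2)[OF q])
      also have "\<dots> \<le> G i q (fst a) (fst a) + (L i q + \<epsilon>) * (snd a)\<^sup>2"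
        using L_nonneg[of i q] e by simp
      also have "\<dots> = M i q a (fst a, - snd a) - \<epsilon> * (snd a * snd (fst a, - snd a))"
        by (simp add: M_def power2_eq_square algebra_simps)
      also have "\<dots> \<le> \<rho> * norm (fst a, - snd a)" using r abs_le_D1 by blast
      also have "\<dots> \<le> \<rho> * (norm (fst a) + \<bar>snd a\<bar>)"
        using r0 norm_Pair_le[of "fst a" "- snd a"] by (intro mult_left_mono) auto
      finally have 1: "l * (norm (fst a))\<^sup>2 \<le> \<rho> * (norm (fst a) + \<bar>snd a\<bar>)" .
      \<comment> \<open>The time component is reached through \<omega>: paired with
        \<open>(b, 0)\<close>, the vector \<open>a\<close> gives \<open>snd a * W i q b\<close> plus
        a term in \<open>fst a\<close>, and the sum of the \<open>\<bar>W i q b\<bar>\<close> is at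
        least \<open>w\<close> on \<open>Q\<close>.\<close>
      have "w * \<bar>snd a\<bar> \<le> (\<Sum>b\<in>Basis. \<bar>W i q b\<bar>) * \<bar>snd a\<bar>"
        using w(2)[OF q] by (intro mult_right_mono) auto
      also have "\<dots> \<le> (\<Sum>b\<in>(Basis::'e set). \<rho> + B * norm (fst a))"
        unfolding sum_distrib_right
      proof (rule sum_mono)
        fix b :: 'e assume b: "b \<in> Basis"
        have "snd a * W i q b = (M i q a (b, 0) - \<epsilon> * (snd a * snd (b, 0))) - M i q (fst a, 0) (b, 0)"
          by (simp add: M_def)
        moreover have "\<bar>M i q a (b, 0) - \<epsilon> * (snd a * snd (b, 0))\<bar> \<le> \<rho>"
          using r[rule_format, of "(b, 0)"] b by (simp add: norm_Pair)
        moreover have "\<bar>M i q (fst a, 0) (b, 0)\<bar> \<le> B * norm (fst a)"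
          using MB[OF q, of "(fst a, 0)" "(b, 0)"] b by (simp add: norm_Pair)
        ultimately have "\<bar>snd a * W i q b\<bar> \<le> \<rho> + B * norm (fst a)" by linarith
        then show "\<bar>W i q b\<bar> * \<bar>snd a\<bar> \<le> \<rho> + B * norm (fst a)" by (simp add: abs_mult mult.commute)
      qed
      finally have 2: "w * \<bar>snd a\<bar> \<le> real DIM('e) * (\<rho> + B * norm (fst a))" by simp
      have "norm a \<le> norm (fst a) + \<bar>snd a\<bar>" using norm_Pair_le[of "fst a" "snd a"] by simp
      also have "\<dots> \<le> (c + k * (1 + c)) * \<rho>"
        unfolding c_def k_def
        by (rule quadratic_estimate) (use l(1) w(1) B0 r0 1 2 in auto)
      also have "\<dots> \<le> C * \<rho>" by (rule mult_right_mono[OF C(5) r0])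
      finally show ?thesis .
    qed
    show "norm v \<le> C * t"
      if e: "0 \<le> \<epsilon>" "\<epsilon> \<le> 1" and t: "0 < t" and m: "M i q (v, t) (v, t) = \<epsilon> * t\<^sup>2" for \<epsilon> v t
    proof -
      have g: "G i q v v = (L i q + \<epsilon>) * t\<^sup>2 - 2 * W i q v * t"
        using m by (simp add: M_def power2_eq_square algebra_simps)
      have "\<bar>W i q v\<bar> \<le> B * norm v" using MB[OF q, of "(v, 0)" "(0, 1)"] WM[OF q] by (simp add: norm_Pair)
      then have "\<bar>W i q v * t\<bar> \<le> B * norm v * t" using t by (simp add: abs_mult)
      moreover have "L i q = - M i q (0, 1) (0, 1)"
        using bilinear_rzero[OF G_facts(1)[OF i qX]] linear_0[OF W_linear[OF i qX]] by (simp add: M_def)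
      then have "L i q \<le> B" using MB[OF q, of "(0, 1)" "(0, 1)"] by (simp add: norm_Pair)
      then have "(L i q + \<epsilon>) * t\<^sup>2 \<le> (B + 1) * t\<^sup>2" using e by (intro mult_right_mono) auto
      moreover have "B * norm v * t \<le> (B + 1) * norm v * t" using t by (intro mult_right_mono) auto
      ultimately have "l * (norm v)\<^sup>2 \<le> (B + 1) * t\<^sup>2 + 2 * (B + 1) * norm v * t"
        using l(2)[OF q, of v] g by linarith
      then have "norm v \<le> (1 + 3 * (B + 1) / l) * t"
        using l(1) B0 t by (intro quadratic_estimate2) auto
      also have "\<dots> \<le> C * t" using t by (intro mult_right_mono C) auto
      finally show ?thesis .
    qed
  qed
  then show thesis by (rule that)
qed

end


subsection \<open>Lightlike geodesics in coordinates\<close>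

declare split_paired_All [simp del] split_paired_Ex [simp del]

lemma has_vector_derivative_affine:
  assumes "(f has_vector_derivative D) (at (c + l * s) within T)" "(\<lambda>s. c + l * s) ` S \<subseteq> T"
  shows "((\<lambda>s. f (c + l * s)) has_vector_derivative l *\<^sub>R D) (at s within S)"
proof -
  have "((\<lambda>s. c + l * s) has_vector_derivative l) (at s within S)"
    by (auto intro!: derivative_eq_intros simp: has_real_derivative_iff_has_vector_derivative[symmetric])
  moreover have "(f has_vector_derivative D) (at (c + l * s) within (\<lambda>s. c + l * s) ` S)"
    using has_vector_derivative_within_subset[OF assms] .
  ultimately have "(f \<circ> (\<lambda>s. c + l * s) has_vector_derivative l *\<^sub>R D) (at s within S)"
    by (rule vector_diff_chain_within)
  then show ?thesis by (simp add: o_def)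
qed

lemma at_within_subset_ball:
  assumes "0 < e" "J \<inter> ball s e \<subseteq> T" "T \<subseteq> J"
  shows "at s within T = at s within J"
  by (rule at_within_nhd[of s "ball s e"]) (use assms in auto)

lemma vector_derivative_pos_imp_less:
  fixes f :: "real \<Rightarrow> real"
  assumes f: "\<And>x. x \<in> {c..d} \<Longrightarrow> (f has_vector_derivative f' x) (at x within {c..d})"
    and pos: "\<And>x. x \<in> {c..d} \<Longrightarrow> 0 < f' x" and s: "c \<le> s" "s < r" "r \<le> d"
  shows "f s < f r"
proof (rule DERIV_pos_imp_increasing_open[OF s(2)])
  fix x assume x: "s < x" "x < r"
  then have xc: "x \<in> {c..d}" "at x within {c..d} = at x" using s by (auto simp: at_within_Icc_at)
  have "(f has_real_derivative f' x) (at x)"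
    using f[OF xc(1)] xc(2) by (simp add: has_real_derivative_iff_has_vector_derivative)
  then show "\<exists>y. (f has_real_derivative y) (at x) \<and> 0 < y" using pos[OF xc(1)] by blast
next
  have "continuous_on {c..d} f" using f by (rule continuous_on_vector_derivative)
  then show "continuous_on {s..r} f" by (rule continuous_on_subset) (use s in auto)
qed

lemma smooth_curve_affine:
  assumes "smooth_curve B J y" "(\<lambda>s. c + l * s) ` J' \<subseteq> J"
  shows "smooth_curve B J' (\<lambda>s. y (c + l * s))"
  unfolding smooth_curve_def
proof (intro conjI ballI)
  show "continuous_on J' (\<lambda>s. y (c + l * s))"
    using assms unfolding smooth_curve_def
    by (intro continuous_on_compose2[of J y J']) (auto intro!: continuous_intros)
  fix i assume "i \<in> index B"
  then have "smooth_path {t \<in> J. y t \<in> chart_dom B i} (\<lambda>t. chart B i (y t))"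
    using assms(1) by (simp add: smooth_curve_def)
  then show "smooth_path {t \<in> J'. y (c + l * t) \<in> chart_dom B i} (\<lambda>t. chart B i (y (c + l * t)))"
    by (rule smooth_path_affine) (use assms(2) in auto)
qed

context stationary
begin

text \<open>A lightlike geodesic \<open>s \<mapsto> (y s, \<tau> s)\<close> of \<open>g\<^sub>\<epsilon>\<close> in coordinates, with its first and second
  derivatives \<open>(v i, \<tau>1)\<close>, \<open>(a i, \<tau>2)\<close> in the chart \<open>i\<close>; only regularity of second order is
  recorded.\<close>

definition null_geodesic ::
  "real \<Rightarrow> real \<Rightarrow> real \<Rightarrow> (real \<Rightarrow> 'a) \<Rightarrow> (real \<Rightarrow> real) \<Rightarrow> ('i \<Rightarrow> real \<Rightarrow> 'e) \<Rightarrow> ('i \<Rightarrow> real \<Rightarrow> 'e) \<Rightarrow>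
   (real \<Rightarrow> real) \<Rightarrow> (real \<Rightarrow> real) \<Rightarrow> bool" where
  "null_geodesic \<epsilon> c d y \<tau> v a \<tau>1 \<tau>2 \<longleftrightarrow> c < d \<and> continuous_on {c..d} y \<and>
    (\<forall>s\<in>{c..d}. 0 < \<tau>1 s \<and> (\<tau> has_vector_derivative \<tau>1 s) (at s within {c..d}) \<and>
       (\<tau>1 has_vector_derivative \<tau>2 s) (at s within {c..d}) \<and>
       (\<forall>i\<in>index A. y s \<in> chart_dom A i \<longrightarrow>
          ((\<lambda>s. chart A i (y s)) has_vector_derivative v i s) (at s within {c..d}) \<and>
          (v i has_vector_derivative a i s) (at s within {c..d}) \<and>
          M i (chart A i (y s)) (v i s, \<tau>1 s) (v i s, \<tau>1 s) = \<epsilon> * (\<tau>1 s)\<^sup>2 \<and>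
          (\<forall>w. M i (chart A i (y s)) (a i s, \<tau>2 s) w - \<epsilon> * (\<tau>2 s * snd w)
              + DM i (chart A i (y s)) (v i s) (v i s, \<tau>1 s) w
              - DM i (chart A i (y s)) (fst w) (v i s, \<tau>1 s) (v i s, \<tau>1 s) / 2 = 0)))"

lemma null_geodesicD:
  assumes "null_geodesic \<epsilon> c d y \<tau> v a \<tau>1 \<tau>2"
  shows "c < d" "continuous_on {c..d} y"
    and "s \<in> {c..d} \<Longrightarrow> 0 < \<tau>1 s"
    and "s \<in> {c..d} \<Longrightarrow> (\<tau> has_vector_derivative \<tau>1 s) (at s within {c..d})"
    and "s \<in> {c..d} \<Longrightarrow> (\<tau>1 has_vector_derivative \<tau>2 s) (at s within {c..d})"
    and "s \<in> {c..d} \<Longrightarrow> i \<in> index A \<Longrightarrow> y s \<in> chart_dom A i \<Longrightarrow>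
          ((\<lambda>s. chart A i (y s)) has_vector_derivative v i s) (at s within {c..d})"
    and "s \<in> {c..d} \<Longrightarrow> i \<in> index A \<Longrightarrow> y s \<in> chart_dom A i \<Longrightarrow>
          (v i has_vector_derivative a i s) (at s within {c..d})"
    and "s \<in> {c..d} \<Longrightarrow> i \<in> index A \<Longrightarrow> y s \<in> chart_dom A i \<Longrightarrow>
          M i (chart A i (y s)) (v i s, \<tau>1 s) (v i s, \<tau>1 s) = \<epsilon> * (\<tau>1 s)\<^sup>2"
    and "s \<in> {c..d} \<Longrightarrow> i \<in> index A \<Longrightarrow> y s \<in> chart_dom A i \<Longrightarrow>
          M i (chart A i (y s)) (a i s, \<tau>2 s) w - \<epsilon> * (\<tau>2 s * snd w)
              + DM i (chart A i (y s)) (v i s) (v i s, \<tau>1 s) w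
              - DM i (chart A i (y s)) (fst w) (v i s, \<tau>1 s) (v i s, \<tau>1 s) / 2 = 0"
  using assms unfolding null_geodesic_def by blast+

text \<open>The geodesic equation is homogeneous: velocities scale by \<open>l\<close>,
  accelerations and all terms of the equation by \<open>l\<^sup>2\<close>. This serves to normalise
  the parameter to [0, 1], and later to make parameter length and elapsed time agree.\<close>

lemma null_geodesic_affine:
  assumes n: "null_geodesic \<epsilon> c d y \<tau> v a \<tau>1 \<tau>2" and l: "0 < l"
    and c: "p + l * c' = c" and d: "p + l * d' = d"
  shows "null_geodesic \<epsilon> c' d' (\<lambda>s. y (p + l * s)) (\<lambda>s. \<tau> (p + l * s)) (\<lambda>i s. l *\<^sub>R v i (p + l * s))
    (\<lambda>i s. l\<^sup>2 *\<^sub>R a i (p + l * s)) (\<lambda>s. l * \<tau>1 (p + l * s)) (\<lambda>s. l\<^sup>2 * \<tau>2 (p + l * s))"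
proof -
  note D = null_geodesicD[OF n]
  have "l * c' < l * d'" using D(1) c d by linarith
  then have cd: "c' < d'" using l by simp
  have img: "p + l * s \<in> {c..d}" if "s \<in> {c'..d'}" for s
    using that c d l by (auto simp: mult_left_mono)
  then have sub: "(\<lambda>s. p + l * s) ` {c'..d'} \<subseteq> {c..d}" by auto
  note aff = has_vector_derivative_affine[OF _ sub]
  show ?thesis
    unfolding null_geodesic_def
  proof (intro conjI ballI impI allI cd)
    show "continuous_on {c'..d'} (\<lambda>s. y (p + l * s))"
      by (rule continuous_on_compose2[OF D(2) _ sub]) (intro continuous_intros)
    fix s assume "s \<in> {c'..d'}"
    note s = img[OF this]
    show "0 < l * \<tau>1 (p + l * s)" using D(3)[OF s] l by simp
    show "((\<lambda>s. \<tau> (p + l * s)) has_vector_derivative l * \<tau>1 (p + l * s)) (at s within {c'..d'})"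
      using aff[OF D(4)[OF s]] by simp
    show "((\<lambda>s. l * \<tau>1 (p + l * s)) has_vector_derivative l\<^sup>2 * \<tau>2 (p + l * s)) (at s within {c'..d'})"
      using has_vector_derivative_mult_right[OF aff[OF D(5)[OF s]], of l]
      by (simp add: power2_eq_square mult.assoc)
    fix i assume i: "i \<in> index A" "y (p + l * s) \<in> chart_dom A i"
    let ?q = "chart A i (y (p + l * s))" and ?z = "(v i (p + l * s), \<tau>1 (p + l * s))"
    have q: "?q \<in> X i" using i by blast
    note bM = M_bilinear[OF i(1) q] and bD = DM_bilinear[OF i(1) q] and lD = DM_linear[OF i(1) q]
    have z: "(l *\<^sub>R v i (p + l * s), l * \<tau>1 (p + l * s)) = l *\<^sub>R ?z"
      "(l\<^sup>2 *\<^sub>R a i (p + l * s), l\<^sup>2 * \<tau>2 (p + l * s)) = l\<^sup>2 *\<^sub>R (a i (p + l * s), \<tau>2 (p + l * s))"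
      by simp_all
    show "((\<lambda>s. chart A i (y (p + l * s))) has_vector_derivative l *\<^sub>R v i (p + l * s)) (at s within {c'..d'})"
      using aff[OF D(6)[OF s i]] .
    show "((\<lambda>s. l *\<^sub>R v i (p + l * s)) has_vector_derivative l\<^sup>2 *\<^sub>R a i (p + l * s)) (at s within {c'..d'})"
      using bounded_linear.has_vector_derivative[OF bounded_linear_scaleR_right aff[OF D(7)[OF s i]], of l]
      by (simp add: power2_eq_square)
    show "M i ?q (l *\<^sub>R v i (p + l * s), l * \<tau>1 (p + l * s)) (l *\<^sub>R v i (p + l * s), l * \<tau>1 (p + l * s))
        = \<epsilon> * (l * \<tau>1 (p + l * s))\<^sup>2"
      unfolding z bilinear_lmul[OF bM] bilinear_rmul[OF bM] D(8)[OF s i]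
      by (simp add: power2_eq_square ac_simps)
    fix w
    have "M i ?q (l\<^sup>2 *\<^sub>R a i (p + l * s), l\<^sup>2 * \<tau>2 (p + l * s)) w - \<epsilon> * (l\<^sup>2 * \<tau>2 (p + l * s) * snd w)
        + DM i ?q (l *\<^sub>R v i (p + l * s)) (l *\<^sub>R v i (p + l * s), l * \<tau>1 (p + l * s)) w
        - DM i ?q (fst w) (l *\<^sub>R v i (p + l * s), l * \<tau>1 (p + l * s)) (l *\<^sub>R v i (p + l * s), l * \<tau>1 (p + l * s)) / 2
      = l\<^sup>2 * (M i ?q (a i (p + l * s), \<tau>2 (p + l * s)) w - \<epsilon> * (\<tau>2 (p + l * s) * snd w)
        + DM i ?q (v i (p + l * s)) ?z w - DM i ?q (fst w) ?z ?z / 2)"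
      unfolding z bilinear_lmul[OF bM] bilinear_lmul[OF bD] bilinear_rmul[OF bD] linear_scale[OF lD]
      by (simp add: power2_eq_square algebra_simps)
    then show "M i ?q (l\<^sup>2 *\<^sub>R a i (p + l * s), l\<^sup>2 * \<tau>2 (p + l * s)) w - \<epsilon> * (l\<^sup>2 * \<tau>2 (p + l * s) * snd w)
        + DM i ?q (l *\<^sub>R v i (p + l * s)) (l *\<^sub>R v i (p + l * s), l * \<tau>1 (p + l * s)) w
        - DM i ?q (fst w) (l *\<^sub>R v i (p + l * s), l * \<tau>1 (p + l * s)) (l *\<^sub>R v i (p + l * s), l * \<tau>1 (p + l * s)) / 2 = 0"
      unfolding D(9)[OF s i] by simp
  qed
qed

lemma smooth_curve_fst:
  assumes "smooth_curve (times_line A) J \<Gamma>"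
  shows "smooth_curve A J (\<lambda>s. fst (\<Gamma> s))"
  unfolding smooth_curve_def
proof (intro conjI ballI)
  show "continuous_on J (\<lambda>s. fst (\<Gamma> s))"
    using assms by (auto simp: smooth_curve_def intro: continuous_on_fst)
  fix i assume "i \<in> index A"
  then have "smooth_path {t \<in> J. \<Gamma> t \<in> chart_dom A i \<times> UNIV} (\<lambda>t. (chart A i (fst (\<Gamma> t)), snd (\<Gamma> t)))"
    using assms by (simp add: smooth_curve_def)
  from smooth_path_linear[OF bounded_linear_fst this]
  show "smooth_path {t \<in> J. fst (\<Gamma> t) \<in> chart_dom A i} (\<lambda>t. chart A i (fst (\<Gamma> t)))"
    by (simp add: mem_Times_iff)
qed

text \<open>In a chart the derivatives are taken within the set of parameters that the curve spends
  there; this set is relatively open in the interval, so the filters agree. In every chart the time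
  component of the velocity is the derivative of \<open>h\<close>, which is why \<tau>1 and \<tau>2
  carry no chart index.\<close>

lemma lightlike_geodesic_imp_null_geodesic:
  assumes cd: "c < d" and geo: "lightlike_geodesic (times_line A) (lorentz_metric g\<^sub>0 \<omega> \<Lambda> \<epsilon>) {c..d} \<Gamma>"
    and h: "smooth_path {c..d} h" "\<And>s. s \<in> {c..d} \<Longrightarrow> 0 < vector_derivative h (at s within {c..d})"
    and \<Gamma>h: "\<And>s. s \<in> {c..d} \<Longrightarrow> snd (\<Gamma> s) = h s"
  obtains v a \<tau>1 \<tau>2 where "null_geodesic \<epsilon> c d (\<lambda>s. fst (\<Gamma> s)) h v a \<tau>1 \<tau>2"
proof -
  let ?J = "{c..d}" and ?T = "times_line A"
  define V where "V = (\<lambda>i s. velocity ?T i ?J \<Gamma> s)"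
  define AA where "AA = (\<lambda>i s. vector_derivative (V i) (at s within ?J))"
  note bot = at_within_Icc_not_bot[OF cd]
  have sc: "smooth_curve ?T ?J \<Gamma>" using geo by (simp add: lightlike_geodesic_def is_geodesic_def)
  then have cont: "continuous_on ?J \<Gamma>" by (simp add: smooth_curve_def)
  obtain f where f0: "\<And>t. t \<in> ?J \<Longrightarrow> f 0 t = h t"
    and f: "\<And>t k. t \<in> ?J \<Longrightarrow> (f k has_vector_derivative f (Suc k) t) (at t within ?J)"
    using h(1) unfolding smooth_path_def by blast
  have h1: "(h has_vector_derivative f 1 s) (at s within ?J)" if "s \<in> ?J" for s
    using has_vector_derivative_transform[OF that f0[symmetric] f[OF that, of 0]] by simp
  then have h1': "0 < f 1 s" if "s \<in> ?J" for s
    using h(2)[OF that] vector_derivative_within[OF bot[OF that] h1[OF that]] that by simp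
  have h2: "(f 1 has_vector_derivative f 2 s) (at s within ?J)" if "s \<in> ?J" for s
    using f[OF that, of 1] by (simp add: numeral_2_eq_2)
  have chartD: "((\<lambda>s. (chart A i (fst (\<Gamma> s)), snd (\<Gamma> s))) has_vector_derivative V i s) (at s within ?J)"
    "(V i has_vector_derivative AA i s) (at s within ?J)" "snd (V i s) = f 1 s" "snd (AA i s) = f 2 s"
    if i: "i \<in> index A" and s: "s \<in> ?J" "fst (\<Gamma> s) \<in> chart_dom A i" for i s
  proof -
    define T where "T = {t \<in> ?J. \<Gamma> t \<in> chart_dom A i \<times> UNIV}"
    have "smooth_path T (\<lambda>t. (chart A i (fst (\<Gamma> t)), snd (\<Gamma> t)))"
      using sc i by (simp add: smooth_curve_def T_def)
    then obtain F where F0: "\<And>t. t \<in> T \<Longrightarrow> F 0 t = (chart A i (fst (\<Gamma> t)), snd (\<Gamma> t))"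
      and F: "\<And>t k. t \<in> T \<Longrightarrow> (F k has_vector_derivative F (Suc k) t) (at t within T)"
      unfolding smooth_path_def by blast
    have TJ: "at r within T = at r within ?J" if "r \<in> T" for r
    proof -
      have op: "open (chart_dom A i \<times> (UNIV :: real set))" by (simp add: open_Times open_dom i)
      have rT: "r \<in> ?J" "\<Gamma> r \<in> chart_dom A i \<times> UNIV" using that by (auto simp: T_def)
      obtain e where "0 < e" "\<And>s. s \<in> ?J \<Longrightarrow> dist r s < e \<Longrightarrow> \<Gamma> s \<in> chart_dom A i \<times> UNIV"
        using continuous_on_ball_preimage[OF cont op rT] by blast
      then show ?thesis by (intro at_within_subset_ball[of e]) (auto simp: T_def)
    qed
    have sT: "s \<in> T" using s by (simp add: T_def mem_Times_iff)
    have 1: "((\<lambda>s. (chart A i (fst (\<Gamma> s)), snd (\<Gamma> s))) has_vector_derivative F 1 r) (at r within T)"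
      if "r \<in> T" for r
      using has_vector_derivative_transform[OF that F0[symmetric] F[OF that, of 0]] by simp
    have V: "V i r = F 1 r" if "r \<in> T" for r
    proof -
      have "r \<in> ?J" using that by (simp add: T_def)
      from vector_derivative_within[OF bot[OF this] 1[OF that, unfolded TJ[OF that]]]
      show ?thesis by (simp add: V_def velocity_def)
    qed
    show "((\<lambda>s. (chart A i (fst (\<Gamma> s)), snd (\<Gamma> s))) has_vector_derivative V i s) (at s within ?J)"
      using 1[OF sT] V[OF sT] TJ[OF sT] by simp
    have VF: "(V i has_vector_derivative F 2 s) (at s within ?J)"
      using has_vector_derivative_transform[OF sT V F[OF sT, of 1]] TJ[OF sT] by (simp add: numeral_2_eq_2)
    moreover have "AA i s = F 2 s"
      unfolding AA_def by (rule vector_derivative_within[OF bot[OF s(1)] VF])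
    ultimately show 2: "(V i has_vector_derivative AA i s) (at s within ?J)" by simp
    have snd1: "snd (V i r) = f 1 r" if "r \<in> T" for r
    proof (rule vector_derivative_unique_within)
      show "at r within ?J \<noteq> bot" using bot that by (simp add: T_def)
      have "((\<lambda>s. snd (\<Gamma> s)) has_vector_derivative snd (V i r)) (at r within ?J)"
        using bounded_linear.has_vector_derivative[OF bounded_linear_snd 1[OF that]] V[OF that] TJ[OF that]
        by simp
      then show "(h has_vector_derivative snd (V i r)) (at r within ?J)"
        using that by (intro has_vector_derivative_transform[of r ?J h]) (auto simp: \<Gamma>h T_def)
      show "(h has_vector_derivative f 1 r) (at r within ?J)" using h1 that by (simp add: T_def)
    qed
    then show "snd (V i s) = f 1 s" using sT by blast
    show "snd (AA i s) = f 2 s"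
    proof (rule vector_derivative_unique_within[OF bot[OF s(1)]])
      have "((\<lambda>s. snd (V i s)) has_vector_derivative snd (AA i s)) (at s within T)"
        using bounded_linear.has_vector_derivative[OF bounded_linear_snd 2] TJ[OF sT] by simp
      from has_vector_derivative_transform[OF sT _ this, of "f 1"]
      show "(f 1 has_vector_derivative snd (AA i s)) (at s within ?J)"
        using snd1 TJ[OF sT] by simp
    qed (rule h2[OF s(1)])
  qed
  have "null_geodesic \<epsilon> c d (\<lambda>s. fst (\<Gamma> s)) h (\<lambda>i s. fst (V i s)) (\<lambda>i s. fst (AA i s)) (f 1) (f 2)"
    unfolding null_geodesic_def
  proof (intro conjI ballI impI allI cd h1 h1' h2)
    show "continuous_on ?J (\<lambda>s. fst (\<Gamma> s))" using cont by (rule continuous_on_fst)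
    fix s i assume s: "s \<in> ?J" and i: "i \<in> index A" "fst (\<Gamma> s) \<in> chart_dom A i"
    note C = chartD[OF i(1) s i(2)]
    let ?q = "chart A i (fst (\<Gamma> s))"
    show "((\<lambda>s. chart A i (fst (\<Gamma> s))) has_vector_derivative fst (V i s)) (at s within ?J)"
      using bounded_linear.has_vector_derivative[OF bounded_linear_fst C(1)] by simp
    show "((\<lambda>s. fst (V i s)) has_vector_derivative fst (AA i s)) (at s within ?J)"
      using bounded_linear.has_vector_derivative[OF bounded_linear_fst C(2)] by simp
    have V: "(fst (V i s), f 1 s) = V i s" "(fst (AA i s), f 2 s) = AA i s"
      using C(3,4) by (simp_all add: prod_eq_iff)
    have \<Gamma>: "\<Gamma> s = (chart_inv A i ?q, snd (\<Gamma> s))" using chart_inv_chart[OF i] by simp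
    have dom: "\<Gamma> s \<in> chart_dom ?T i" using i by (simp add: mem_Times_iff)
    have "lightlike (lorentz_metric g\<^sub>0 \<omega> \<Lambda> \<epsilon>) i (\<Gamma> s) (V i s)"
      using geo i(1) s dom by (simp add: lightlike_geodesic_def V_def)
    then have "lorentz_metric g\<^sub>0 \<omega> \<Lambda> \<epsilon> i (chart_inv A i ?q, snd (\<Gamma> s)) (V i s) (V i s) = 0"
      using \<Gamma> by (simp add: lightlike_def)
    then show "M i ?q (fst (V i s), f 1 s) (fst (V i s), f 1 s) = \<epsilon> * (f 1 s)\<^sup>2"
      unfolding V lorentz_metric_eq using C(3) by (simp add: power2_eq_square)
    fix w
    have "lorentz_metric g\<^sub>0 \<omega> \<Lambda> \<epsilon> i (\<Gamma> s) (AA i s) w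
      + christoffel ?T (lorentz_metric g\<^sub>0 \<omega> \<Lambda> \<epsilon>) i (\<Gamma> s) (V i s) (V i s) w = 0"
      using geo i(1) s dom by (simp add: lightlike_geodesic_def is_geodesic_def V_def AA_def)
    moreover have "christoffel ?T (lorentz_metric g\<^sub>0 \<omega> \<Lambda> \<epsilon>) i (\<Gamma> s) (V i s) (V i s) w
        = DM i ?q (fst (V i s)) (V i s) w - DM i ?q (fst w) (V i s) (V i s) / 2"
      using christoffel_eq[OF i, of \<epsilon> "snd (\<Gamma> s)"] by simp
    moreover have "lorentz_metric g\<^sub>0 \<omega> \<Lambda> \<epsilon> i (\<Gamma> s) (AA i s) w = M i ?q (AA i s) w - \<epsilon> * (f 2 s * snd w)"
      using lorentz_metric_eq[of \<epsilon> i ?q "snd (\<Gamma> s)" "AA i s" w] \<Gamma> C(4) by simp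
    ultimately show "M i ?q (fst (AA i s), f 2 s) w - \<epsilon> * (f 2 s * snd w)
        + DM i ?q (fst (V i s)) (fst (V i s), f 1 s) w
        - DM i ?q (fst w) (fst (V i s), f 1 s) (fst (V i s), f 1 s) / 2 = 0"
      unfolding V by simp
  qed
  then show thesis by (rule that)
qed

lemma null_geodesic_increments:
  assumes "null_geodesic \<epsilon> c d y \<tau> v a \<tau>1 \<tau>2" "c \<le> s" "s < r" "r \<le> d"
  shows "\<tau> s < \<tau> r"
  by (rule vector_derivative_pos_imp_less[OF null_geodesicD(4,3)[OF assms(1)] assms(2-4)])

text \<open>For constant \<open>w\<close> the product rule produces the acceleration term and the
  derivative of the metric along the curve; by the geodesic equation their sum is half the
  derivative of the metric along \<open>w\<close>. With \<open>w = (0, 1)\<close> the right-hand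
  side vanishes, which is the conservation law of the Killing field.\<close>

lemma null_geodesic_momentum:
  assumes n: "null_geodesic \<epsilon> c d y \<tau> v a \<tau>1 \<tau>2" and s: "s \<in> {c..d}"
    and i: "i \<in> index A" "y s \<in> chart_dom A i"
  shows "((\<lambda>s. M i (chart A i (y s)) (v i s, \<tau>1 s) w - \<epsilon> * (\<tau>1 s * snd w)) has_vector_derivative
    DM i (chart A i (y s)) (fst w) (v i s, \<tau>1 s) (v i s, \<tau>1 s) / 2) (at s within {c..d})"
proof -
  note D = null_geodesicD[OF n]
  let ?q = "\<lambda>s. chart A i (y s)"
  have z: "((\<lambda>s. (v i s, \<tau>1 s)) has_vector_derivative (a i s, \<tau>2 s)) (at s within {c..d})"
    by (intro has_vector_derivative_Pair D s i)
  obtain e where e: "0 < e" "\<And>r. r \<in> {c..d} \<Longrightarrow> dist s r < e \<Longrightarrow> y r \<in> chart_dom A i"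
    using continuous_on_ball_preimage[OF D(2) open_dom[OF i(1)] s i(2)] by blast
  then have "\<forall>\<^sub>F r in at s within {c..d}. ?q r \<in> X i"
    unfolding eventually_at by (intro exI[of _ e]) (auto simp: dist_commute)
  from has_vector_derivative_M[OF i(1) s _ D(6)[OF s i] z this]
  have "((\<lambda>s. M i (?q s) (v i s, \<tau>1 s) w) has_vector_derivative
    M i (?q s) (a i s, \<tau>2 s) w + DM i (?q s) (v i s) (v i s, \<tau>1 s) w) (at s within {c..d})"
    using i(2) by simp
  moreover have "((\<lambda>s. \<epsilon> * (\<tau>1 s * snd w)) has_vector_derivative \<epsilon> * (\<tau>2 s * snd w)) (at s within {c..d})"
    by (intro has_vector_derivative_mult_right has_vector_derivative_mult_left D s)
  ultimately have "((\<lambda>s. M i (?q s) (v i s, \<tau>1 s) w - \<epsilon> * (\<tau>1 s * snd w)) has_vector_derivative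
    (M i (?q s) (a i s, \<tau>2 s) w + DM i (?q s) (v i s) (v i s, \<tau>1 s) w) - \<epsilon> * (\<tau>2 s * snd w)) (at s within {c..d})"
    by (rule has_vector_derivative_diff)
  moreover have "(M i (?q s) (a i s, \<tau>2 s) w + DM i (?q s) (v i s) (v i s, \<tau>1 s) w) - \<epsilon> * (\<tau>2 s * snd w)
      = DM i (?q s) (fst w) (v i s, \<tau>1 s) (v i s, \<tau>1 s) / 2"
    using D(9)[OF s i, of w] by linarith
  ultimately show ?thesis by simp
qed

end


subsection \<open>Compactness and equicontinuity\<close>

text \<open>A bootstrap: an estimate that is available only while the curve stays in
  \<open>U\<close> places it in the smaller set \<open>C\<close>. A first time outside
  \<open>U\<close> would be a limit of times with values in \<open>C\<close>, and \<open>C\<close>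
  is closed and contained in \<open>U\<close>.\<close>

lemma continuous_stays_in_closed:
  fixes f :: "real \<Rightarrow> 'b::topological_space"
  assumes f: "continuous_on {a..b} f" "f a \<in> C" and C: "closed C" "C \<subseteq> U" "open U"
    and step: "\<And>u. u \<in> {a..b} \<Longrightarrow> f ` {a..u} \<subseteq> U \<Longrightarrow> f u \<in> C"
    and u: "u \<in> {a..b}"
  shows "f u \<in> C"
proof -
  define B where "B = {u \<in> {a..b}. f u \<in> - U}"
  have "B = {}"
  proof (rule ccontr)
    assume ne: "B \<noteq> {}"
    have "closed B"
      using continuous_closed_preimage[OF f(1) closed_atLeastAtMost, of "- U"] C(3)
      by (simp add: B_def vimage_def Int_def closed_Compl)
    then have "compact B" by (metis (no_types, lifting) B_def compact_Icc compact_Int_closed inf.absorb_iff2 mem_Collect_eq subsetI)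
    then obtain w where w: "w \<in> B" "\<And>x. x \<in> B \<Longrightarrow> w \<le> x"
      using compact_attains_inf[OF _ ne] by blast
    have before: "f x \<in> C" if "x \<in> {a..<w}" for x
    proof (rule step)
      show "x \<in> {a..b}" using that w(1) by (auto simp: B_def)
      then show "f ` {a..x} \<subseteq> U" using w(2) that by (fastforce simp: B_def)
    qed
    have "a \<noteq> w" using f(2) C(2) w(1) by (auto simp: B_def)
    then have aw: "a < w" using w(1) by (auto simp: B_def)
    have "closed {x \<in> {a..b}. f x \<in> C}"
      using continuous_closed_preimage[OF f(1) closed_atLeastAtMost C(1)]
      by (simp add: vimage_def Int_def)
    moreover have "{a..<w} \<subseteq> {x \<in> {a..b}. f x \<in> C}" using before w(1) by (auto simp: B_def)
    ultimately have "closure {a..<w} \<subseteq> {x \<in> {a..b}. f x \<in> C}" by (rule closure_minimal[rotated])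
    moreover have "w \<in> closure {a..<w}" using aw by simp
    ultimately have "f w \<in> C" by blast
    then show False using C(2) w(1) by (auto simp: B_def)
  qed
  then have "f ` {a..u} \<subseteq> U" using u by (fastforce simp: B_def)
  then show ?thesis by (rule step[OF u])
qed

text \<open>The integral of a non-integrable function is 0 by convention. Lengths are therefore
  nonnegative without any proof that the integrand, whose chart changes along the curve, is
  integrable.\<close>

lemma integral_nonneg_or_zero:
  fixes f :: "real \<Rightarrow> real"
  assumes "\<And>x. 0 \<le> f x"
  shows "0 \<le> integral S f"
  by (cases "f integrable_on S") (auto simp: not_integrable_integral assms intro: integral_nonneg)

section \<open>Randers length, elapsed time and equicontinuity\<close>

context stationary
begin

lemma randers_nonneg: 
  assumes "i \<in> index A" "x \<in> chart_dom A i" "0 < \<epsilon>"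
  shows "0 \<le> randers g\<^sub>0 \<omega> \<Lambda> \<epsilon> i x v"
proof -
  have "0 \<le> g\<^sub>0 i x v v"
    using G_nonneg[of i "chart A i x" v] assms chart_inv_chart[OF assms(1,2)] by (simp add: G_def)
  then have "sqrt ((\<omega> i x v)\<^sup>2) \<le> sqrt ((\<Lambda> x + \<epsilon>) * g\<^sub>0 i x v v + (\<omega> i x v)\<^sup>2)"
    using Lambda_nonneg assms(3) by (intro real_sqrt_le_mono) simp
  then have "0 \<le> sqrt ((\<Lambda> x + \<epsilon>) * g\<^sub>0 i x v v + (\<omega> i x v)\<^sup>2) + \<omega> i x v" by simp
  then show ?thesis using Lambda_nonneg assms(3) by (simp add: randers_def)
qed

lemma randers_le:
  assumes i: "i \<in> index A" "x \<in> chart_dom A i" and e: "0 < \<epsilon>'" "\<epsilon> \<le> \<epsilon>'" and t: "0 \<le> t"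
    and m: "M i (chart A i x) (v, t) (v, t) = \<epsilon> * t\<^sup>2"
  shows "randers g\<^sub>0 \<omega> \<Lambda> \<epsilon>' i x v \<le> t"
proof -
  define l where "l = \<Lambda> x + \<epsilon>'"
  define w where "w = \<omega> i x v"
  define g where "g = g\<^sub>0 i x v v"
  have l: "0 < l" using Lambda_nonneg e(1) by (simp add: l_def add_nonneg_pos)
  have "g + 2 * w * t = (\<Lambda> x + \<epsilon>) * t\<^sup>2"
    using m by (simp add: M_def G_def W_def L_def chart_inv_chart[OF i] w_def g_def power2_eq_square algebra_simps)
  also have "\<dots> \<le> l * t\<^sup>2" using e(2) by (intro mult_right_mono) (auto simp: l_def)
  finally have 1: "g \<le> l * t\<^sup>2 - 2 * w * t" by simp
  have "0 \<le> g"
    using G_nonneg[of i "chart A i x" v] i chart_inv_chart[OF i] by (simp add: G_def g_def)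
  then have 2: "2 * w * t \<le> l * t\<^sup>2" using 1 by linarith
  \<comment> \<open>This is the position relative to the vertex. For \<open>t > 0\<close> it follows
    from \<open>2\<close>, which rests on \<open>0 \<le> g\<close>; for \<open>t = 0\<close> the
    inequality \<open>1\<close> forces \<open>v = 0\<close> and hence \<open>w = 0\<close>.\<close>
  have 3: "0 \<le> l * t - w"
  proof (cases "w \<le> 0")
    case True
    have "0 \<le> l * t" using l t by simp
    with True show ?thesis by linarith
  next
    case False
    show ?thesis
    proof (cases "t = 0")
      case True
      then have "\<not> 0 < g" using 1 by simp
      then have "v = 0"
        using G_facts(2)[of i "chart A i x" v] i chart_inv_chart[OF i] by (auto simp: G_def g_def)
      then have "w = 0"
        using linear_0[OF W_linear[of i "chart A i x"]] i chart_inv_chart[OF i] by (simp add: W_def w_def)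
      then show ?thesis using True by simp
    next
      case False2: False
      then have "(2 * w) * t \<le> (l * t) * t" using 2 by (simp add: power2_eq_square mult.assoc)
      then have "2 * w \<le> l * t" using False2 t by (simp add: mult_le_cancel_right)
      then show ?thesis using False by linarith
    qed
  qed
  have "l * g + w\<^sup>2 \<le> l * (l * t\<^sup>2 - 2 * w * t) + w\<^sup>2" using 1 l by simp
  also have "\<dots> = (l * t - w)\<^sup>2" by (simp add: power2_eq_square algebra_simps)
  finally have "sqrt (l * g + w\<^sup>2) \<le> l * t - w" using 3 by (simp add: real_le_lsqrt)
  then have "(sqrt (l * g + w\<^sup>2) + w) / l \<le> t" using l by (simp add: pos_divide_le_eq mult.commute)
  then show ?thesis by (simp add: randers_def l_def w_def g_def)
qed

lemma velocity_affine:
  assumes n: "null_geodesic \<epsilon> 0 1 y \<tau> v a \<tau>1 \<tau>2" and ab: "0 \<le> \<alpha>" "0 \<le> l" "\<alpha> + l \<le> 1"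
    and u: "u \<in> {0..1}" and i: "i \<in> index A" "y (\<alpha> + l * u) \<in> chart_dom A i"
  shows "velocity A i {0..1} (\<lambda>u. y (\<alpha> + l * u)) u = l *\<^sub>R v i (\<alpha> + l * u)"
proof -
  have *: "0 \<le> \<alpha> + l * u" "\<alpha> + l * u \<le> 1" if "u \<in> {0..1}" for u
    using ab that mult_left_le[of u l] by auto
  have "((\<lambda>u. chart A i (y (\<alpha> + l * u))) has_vector_derivative l *\<^sub>R v i (\<alpha> + l * u)) (at u within {0..1})"
    by (rule has_vector_derivative_affine[OF null_geodesicD(6)[OF n _ i]]) (use * u in auto)
  then show ?thesis unfolding velocity_def
    by (rule vector_derivative_within[OF at_within_Icc_not_bot[OF _ u], rotated]) simp
qed

text \<open>The piece of the geodesic between the two parameters, rescaled to [0, 1], competes in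
  the infimum, and its Randers speed is at most the rate at which time elapses.\<close>

lemma path_distance_le_time:
  assumes n: "null_geodesic \<epsilon> 0 1 y \<tau> v a \<tau>1 \<tau>2" and y: "smooth_curve A {0..1} y"
    and e: "0 < \<epsilon>'" "\<epsilon> \<le> \<epsilon>'" and ab: "0 \<le> \<alpha>" "\<alpha> \<le> \<beta>" "\<beta> \<le> 1"
  shows "path_distance A (randers g\<^sub>0 \<omega> \<Lambda> \<epsilon>') (y \<alpha>) (y \<beta>) \<le> \<tau> \<beta> - \<tau> \<alpha>"
proof -
  note D = null_geodesicD[OF n]
  define l where "l = \<beta> - \<alpha>"
  define \<rho> where "\<rho> = (\<lambda>u. y (\<alpha> + l * u))"
  let ?R = "randers g\<^sub>0 \<omega> \<Lambda> \<epsilon>'"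
  let ?f = "\<lambda>s. ?R (chart_at A (\<rho> s)) (\<rho> s) (velocity A (chart_at A (\<rho> s)) {0..1} \<rho> s)"
  have l: "0 \<le> l" "\<alpha> + l \<le> 1" using ab by (auto simp: l_def)
  have in01: "\<alpha> + l * u \<in> {0..1}" if "u \<in> {0..1}" for u
    using l ab(1) that mult_left_le[of u l] by auto
  have "smooth_curve A {0..1} \<rho>"
    unfolding \<rho>_def by (rule smooth_curve_affine[OF y]) (use in01 in auto)
  then have "piecewise_smooth_curve A \<rho>"
    unfolding piecewise_smooth_curve_def
    by (auto simp: smooth_curve_def intro!: exI[of _ "1::nat"] exI[of _ "real"])
  then have mem: "curve_length A ?R \<rho> \<in>
      {curve_length A ?R \<sigma> |\<sigma>. piecewise_smooth_curve A \<sigma> \<and> \<sigma> 0 = y \<alpha> \<and> \<sigma> 1 = y \<beta>}"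
    by (auto simp: \<rho>_def l_def)
  have "0 \<le> curve_length A ?R \<sigma>" for \<sigma>
    unfolding curve_length_def
    by (rule integral_nonneg_or_zero) (use randers_nonneg chart_at e in blast)
  then have bdd: "bdd_below {curve_length A ?R \<sigma> |\<sigma>. piecewise_smooth_curve A \<sigma> \<and> \<sigma> 0 = y \<alpha> \<and> \<sigma> 1 = y \<beta>}"
    by (intro bdd_belowI[of _ 0]) auto
  have I: "((\<lambda>u. l * \<tau>1 (\<alpha> + l * u)) has_integral (\<tau> (\<alpha> + l * 1) - \<tau> (\<alpha> + l * 0))) {0..1}"
  proof (rule fundamental_theorem_of_calculus)
    fix u :: real assume "u \<in> {0..1}"
    from has_vector_derivative_affine[OF D(4)[OF in01[OF this]], of "{0..1}"]
    moreover have "(\<lambda>u. \<alpha> + l * u) ` {0..1} \<subseteq> {0..1}" using in01 by blast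
    ultimately show "((\<lambda>u. \<tau> (\<alpha> + l * u)) has_vector_derivative l * \<tau>1 (\<alpha> + l * u)) (at u within {0..1})"
      by simp
  qed simp
  have le: "?f u \<le> l * \<tau>1 (\<alpha> + l * u)" if u: "u \<in> {0..1}" for u
  proof -
    let ?i = "chart_at A (\<rho> u)" and ?s = "\<alpha> + l * u"
    have i: "?i \<in> index A" "y ?s \<in> chart_dom A ?i" using chart_at[of "\<rho> u"] by (auto simp: \<rho>_def)
    have q: "chart A ?i (y ?s) \<in> X ?i" using i by blast
    have v: "velocity A ?i {0..1} \<rho> u = l *\<^sub>R v ?i ?s"
      unfolding \<rho>_def by (rule velocity_affine[OF n ab(1) l u]) (use i in \<open>auto simp: \<rho>_def\<close>)
    have "M ?i (chart A ?i (y ?s)) (l *\<^sub>R (v ?i ?s, \<tau>1 ?s)) (l *\<^sub>R (v ?i ?s, \<tau>1 ?s)) = \<epsilon> * (l * \<tau>1 ?s)\<^sup>2"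
      unfolding bilinear_lmul[OF M_bilinear[OF i(1) q]] bilinear_rmul[OF M_bilinear[OF i(1) q]]
        D(8)[OF in01[OF u] i] by (simp add: power2_eq_square ac_simps)
    then have "?R ?i (y ?s) (l *\<^sub>R v ?i ?s) \<le> l * \<tau>1 ?s"
      using l D(3)[OF in01[OF u]] by (intro randers_le[OF i e]) (auto simp: less_imp_le)
    then show ?thesis by (simp add: v) (simp add: \<rho>_def)
  qed
  have tau: "0 \<le> \<tau> (\<alpha> + l * 1) - \<tau> (\<alpha> + l * 0)"
    by (rule has_integral_nonneg[OF I]) (use l D(3) in01 in \<open>simp add: less_imp_le\<close>)
  \<comment> \<open>Comparing integrals needs an integrable integrand. If it is not integrable, the
    length is 0 by convention and so at most the nonnegative elapsed time.\<close>
  have "curve_length A ?R \<rho> \<le> \<tau> (\<alpha> + l * 1) - \<tau> (\<alpha> + l * 0)"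
  proof (cases "?f integrable_on {0..1}")
    case True
    then have "(?f has_integral curve_length A ?R \<rho>) {0..1}"
      unfolding curve_length_def by (rule integrable_integral)
    from has_integral_le[OF this I le] show ?thesis by simp
  next
    case False
    then show ?thesis using tau by (simp add: curve_length_def not_integrable_integral)
  qed
  then show ?thesis
    unfolding path_distance_def by (intro order_trans[OF cInf_lower[OF mem bdd]]) (simp add: l_def)
qed

text \<open>The slope bound of the light cones makes the coordinates Lipschitz in the elapsed time,
  with a constant that depends neither on the geodesic nor on \<epsilon>.\<close>

lemma null_geodesic_speed:
  assumes n: "null_geodesic \<epsilon> c d y \<tau> v a \<tau>1 \<tau>2" and e: "0 \<le> \<epsilon>" "\<epsilon> \<le> 1"
    and i: "i \<in> index A" "chart_bound i Q C"
    and sr: "c \<le> s" "s \<le> r" "r \<le> d"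
    and Q: "\<And>u. u \<in> {s..r} \<Longrightarrow> y u \<in> chart_dom A i \<and> chart A i (y u) \<in> Q"
  shows "norm (chart A i (y r) - chart A i (y s)) \<le> C * (\<tau> r - \<tau> s)"
proof (cases "s = r")
  case False
  note D = null_geodesicD[OF n]
  have sub: "{s..r} \<subseteq> {c..d}" using sr by auto
  have "norm (chart A i (y r) - chart A i (y s)) \<le> C * \<tau> r - C * \<tau> s"
  proof (rule differentiable_bound_general[where f'="v i" and \<phi>'="\<lambda>u. C * \<tau>1 u"])
    show "s < r" using sr False by simp
    show "continuous_on {s..r} (\<lambda>u. chart A i (y u))"
      using Q i(1) continuous_on_subset[OF D(2) sub]
      by (intro continuous_on_compose2[OF continuous_chart]) auto
    have "continuous_on {c..d} \<tau>" using D(4) by (rule continuous_on_vector_derivative)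
    then show "continuous_on {s..r} (\<lambda>u. C * \<tau> u)"
      by (intro continuous_intros) (rule continuous_on_subset[OF _ sub])
    fix u assume u: "s < u" "u < r"
    then have uc: "u \<in> {c..d}" "at u within {c..d} = at u" using sr by (auto simp: at_within_Icc_at)
    have ui: "y u \<in> chart_dom A i" "chart A i (y u) \<in> Q" using Q u by auto
    show "((\<lambda>u. chart A i (y u)) has_vector_derivative v i u) (at u)"
      using D(6)[OF uc(1) i(1) ui(1)] uc(2) by simp
    show "((\<lambda>u. C * \<tau> u) has_vector_derivative C * \<tau>1 u) (at u)"
      using has_vector_derivative_mult_right[OF D(4)[OF uc(1)], of C] uc(2) by simp
    show "norm (v i u) \<le> C * \<tau>1 u"
      by (rule chart_boundD(5)[OF i(2) ui(2) e D(3)[OF uc(1)] D(8)[OF uc(1) i(1) ui(1)]])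
  qed
  then show ?thesis by (simp add: algebra_simps)
qed simp

lemma chart_neighbourhood:
  assumes "open V" "p \<in> V" "i \<in> index A" "p \<in> chart_dom A i"
  obtains r where "0 < r" "cball (chart A i p) r \<subseteq> X i" "chart_inv A i ` cball (chart A i p) r \<subseteq> V"
proof -
  have "open (X i \<inter> chart_inv A i -` V)"
    by (rule continuous_open_preimage[OF continuous_chart_inv open_X]) (use assms in auto)
  moreover have "chart A i p \<in> X i \<inter> chart_inv A i -` V" using assms chart_inv_chart by auto
  ultimately obtain r where "0 < r" "cball (chart A i p) r \<subseteq> X i \<inter> chart_inv A i -` V"
    using open_contains_cball by blast
  then show thesis using that[of r] by auto
qed

text \<open>The speed bound is valid only inside the chart ball, hence the bootstrap: a curve that
  starts within \<open>r0 / 3\<close> of the centre and moves by less than \<open>r0 / 3\<close>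
  remains within \<open>2 * r0 / 3\<close>, well inside the ball of radius \<open>r0\<close>. The
  conclusion is membership in a closed set so that it survives limits.\<close>

lemma null_geodesic_equicontinuous:
  assumes V: "open V" "p \<in> V"
  obtains U K \<delta> where "open U" "p \<in> U" "closed K" "K \<subseteq> V" "0 < \<delta>"
    "\<And>\<epsilon> c d y \<tau> v a \<tau>1 \<tau>2 s r. null_geodesic \<epsilon> c d y \<tau> v a \<tau>1 \<tau>2 \<Longrightarrow> 0 \<le> \<epsilon> \<Longrightarrow> \<epsilon> \<le> 1 \<Longrightarrow>
       s \<in> {c..d} \<Longrightarrow> r \<in> {c..d} \<Longrightarrow> y s \<in> U \<Longrightarrow> \<bar>\<tau> r - \<tau> s\<bar> < \<delta> \<Longrightarrow> y r \<in> K"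
proof -
  define i where "i = chart_at A p"
  have i: "i \<in> index A" "p \<in> chart_dom A i" using chart_at by (auto simp: i_def)
  define q where "q = chart A i p"
  obtain r0 where r0: "0 < r0" "cball q r0 \<subseteq> X i" "chart_inv A i ` cball q r0 \<subseteq> V"
    using chart_neighbourhood[OF V i] by (auto simp: q_def)
  obtain C where C: "chart_bound i (cball q r0) C"
    using chart_bound_exists[OF i(1) compact_cball r0(2)] by blast
  have C1: "1 \<le> C" using C by (simp add: chart_bound_def)
  define U where "U = (\<lambda>r. {x \<in> chart_dom A i. chart A i x \<in> ball q r})"
  define K where "K = chart_inv A i ` cball q (2 * r0 / 3)"
  have opU: "open (U r)" for r unfolding U_def by (rule open_chart_preimage[OF i(1) open_ball])
  have small: "cball q (2 * r0 / 3) \<subseteq> cball q r0" using r0(1) by (intro subset_cball) simp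
  have clK: "closed K"
    unfolding K_def using small r0(2) by (intro compact_imp_closed compact_chart_inv_image i) auto
  have KV: "K \<subseteq> V" using small r0(3) by (auto simp: K_def)
  have memK: "x \<in> K" if "x \<in> chart_dom A i" "dist q (chart A i x) \<le> 2 * r0 / 3" for x
    using that chart_inv_chart[OF i(1)] unfolding K_def by (metis image_eqI mem_cball)
  have KU: "K \<subseteq> U r0"
  proof
    fix x assume "x \<in> K"
    then obtain z where z: "z \<in> cball q (2 * r0 / 3)" "x = chart_inv A i z" by (auto simp: K_def)
    moreover have "z \<in> X i" using z(1) small r0(2) by blast
    ultimately show "x \<in> U r0"
      using r0(1) chart_inv_in_dom[OF i(1)] chart_chart_inv[OF i(1)] by (auto simp: U_def)
  qed
  have UK: "U (r0 / 3) \<subseteq> K" using memK r0(1) by (fastforce simp: U_def)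
  have inK: "y r \<in> K"
    if n: "null_geodesic \<epsilon> c d y \<tau> v a \<tau>1 \<tau>2" and e: "0 \<le> \<epsilon>" "\<epsilon> \<le> 1"
      and s: "s \<in> {c..d}" "r \<in> {c..d}" "y s \<in> U (r0 / 3)" "\<bar>\<tau> r - \<tau> s\<bar> < r0 / (3 * C)"
    for \<epsilon> c d y \<tau> v a \<tau>1 \<tau>2 s r
  proof -
    note D = null_geodesicD[OF n]
    have mono: "\<tau> a \<le> \<tau> b" if "c \<le> a" "a \<le> b" "b \<le> d" for a b
      using null_geodesic_increments[OF n, of a b] that by (cases "a = b") auto
    have key: "y w \<in> K" if w: "c \<le> min s w" "max s w \<le> d"
      and small: "\<bar>\<tau> w - \<tau> s\<bar> < r0 / (3 * C)" and im: "y ` {min s w..max s w} \<subseteq> U r0" for w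
    proof (rule memK)
      have "w \<in> {min s w..max s w}" by simp
      then have "y w \<in> U r0" using im by blast
      then show "y w \<in> chart_dom A i" by (simp add: U_def)
      have "norm (chart A i (y (max s w)) - chart A i (y (min s w))) \<le> C * (\<tau> (max s w) - \<tau> (min s w))"
      proof (rule null_geodesic_speed[OF n e i(1) C])
        fix u assume "u \<in> {min s w..max s w}"
        then have "y u \<in> U r0" using im by blast
        then show "y u \<in> chart_dom A i \<and> chart A i (y u) \<in> cball q r0" by (simp add: U_def)
      qed (use w in auto)
      also have "\<tau> (max s w) - \<tau> (min s w) = \<bar>\<tau> w - \<tau> s\<bar>"
        using mono[of s w] mono[of w s] w by (auto simp: max_def min_def)
      also have "C * \<bar>\<tau> w - \<tau> s\<bar> < r0 / 3" using small C1 by (simp add: field_simps)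
      finally have "dist (chart A i (y s)) (chart A i (y w)) < r0 / 3"
        by (auto simp: dist_norm max_def min_def norm_minus_commute split: if_splits)
      moreover have "dist q (chart A i (y s)) < r0 / 3" using s(3) by (simp add: U_def)
      ultimately show "dist q (chart A i (y w)) \<le> 2 * r0 / 3"
        using dist_triangle[of q "chart A i (y w)" "chart A i (y s)"] by linarith
    qed
    show ?thesis
    proof (cases "s \<le> r")
      case True
      show ?thesis
      proof (rule continuous_stays_in_closed[of s r y K "U r0"])
        show "continuous_on {s..r} y" using D(2) by (rule continuous_on_subset) (use s in auto)
        fix u assume u: "u \<in> {s..r}" and im: "y ` {s..u} \<subseteq> U r0"
        have "\<tau> s \<le> \<tau> u" "\<tau> u \<le> \<tau> r" using mono u s by auto
        then show "y u \<in> K" using u im s by (intro key) auto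
      qed (use s UK KU clK opU True in auto)
    next
      case False
      \<comment> \<open>The bootstrap runs forward in the parameter; parameters before
        \<open>s\<close> are reached by reversing it.\<close>
      have "(\<lambda>u. y (- u)) (- r) \<in> K"
      proof (rule continuous_stays_in_closed[of "- s" "- r" "\<lambda>u. y (- u)" K "U r0"])
        show "continuous_on {- s..- r} (\<lambda>u. y (- u))"
          by (rule continuous_on_compose2[OF D(2)]) (use s in \<open>auto intro!: continuous_intros\<close>)
        fix u assume u: "u \<in> {- s..- r}" and im: "(\<lambda>u. y (- u)) ` {- s..u} \<subseteq> U r0"
        have "\<tau> (- u) \<le> \<tau> s" "\<tau> r \<le> \<tau> (- u)" using mono u s by auto
        moreover have "y ` {- u..s} \<subseteq> U r0"
        proof
          fix x assume "x \<in> y ` {- u..s}"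
          then obtain t where "t \<in> {- u..s}" "x = y t" by blast
          then have "x = (\<lambda>u. y (- u)) (- t)" "- t \<in> {- s..u}" by auto
          then show "x \<in> U r0" using im by blast
        qed
        ultimately show "y (- u) \<in> K" using u s by (intro key) auto
      qed (use s UK KU clK opU False in auto)
      then show ?thesis by simp
    qed
  qed
  have pU: "p \<in> U (r0 / 3)" using r0(1) i(2) by (simp add: U_def q_def)
  have "0 < r0 / (3 * C)" using r0(1) C1 by simp
  from that[OF opU pU clK KV this] inK show thesis by blast
qed

end

text \<open>Convergence at rationals along a diagonal subsequence is obtained from the compactness and
  first countability of the countable product \<open>nat \<Rightarrow> 'b\<close>.\<close>

lemma diagonal_subsequence:
  fixes g :: "nat \<Rightarrow> nat \<Rightarrow> 'b::{t2_space, first_countable_topology}"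
  assumes K: "compact K" and g: "\<And>n j. g n j \<in> K"
  obtains k l where "strict_mono (k :: nat \<Rightarrow> nat)" "\<And>j. l j \<in> K" "\<And>j. (\<lambda>n. g (k n) j) \<longlonglongrightarrow> l j"
proof -
  have "compactin (product_topology (\<lambda>_. euclidean) (UNIV :: nat set)) (PiE UNIV (\<lambda>_. K))"
    using K by (simp add: compactin_PiE)
  then have "compact (PiE UNIV (\<lambda>_ :: nat. K))" by (simp add: euclidean_product_topology)
  then have sc: "seq_compact (PiE UNIV (\<lambda>_ :: nat. K))" by (rule compact_imp_seq_compact)
  have "\<forall>n. g n \<in> PiE UNIV (\<lambda>_. K)" using g by auto
  from seq_compactE[OF sc this] obtain l k where l: "l \<in> PiE UNIV (\<lambda>_. K)" "strict_mono (k :: nat \<Rightarrow> nat)" "(g \<circ> k) \<longlonglongrightarrow> l"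
    by metis
  show thesis
  proof (rule that[OF l(2)])
    show "l j \<in> K" for j using l(1) by (rule PiE_mem) simp
    from continuous_on_tendsto_compose[OF continuous_on_product_coordinates l(3) UNIV_I always_eventually]
    show "(\<lambda>n. g (k n) j) \<longlonglongrightarrow> l j" for j by (simp add: o_def)
  qed
qed

text \<open>Equicontinuity in terms of neighbourhoods replaces a distance on the target. The
  convergence obtained lets the argument move with \<open>n\<close>, which is what composition with
  converging time functions requires.\<close>

lemma Arzela_Ascoli_topological:
  fixes f :: "nat \<Rightarrow> real \<Rightarrow> 'b::{t2_space, first_countable_topology}"
  assumes ab: "a < b" and K: "compact K" and fK: "\<And>n t. t \<in> {a..b} \<Longrightarrow> f n t \<in> K"
    and equi: "\<And>p V. p \<in> K \<Longrightarrow> open V \<Longrightarrow> p \<in> V \<Longrightarrow> \<exists>U C \<delta>. open U \<and> p \<in> U \<and> closed C \<and> C \<subseteq> V \<and> 0 < \<delta> \<and>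
        (\<forall>n. \<forall>s\<in>{a..b}. \<forall>t\<in>{a..b}. \<bar>s - t\<bar> < \<delta> \<longrightarrow> f n s \<in> U \<longrightarrow> f n t \<in> C)"
  obtains k F where "strict_mono (k :: nat \<Rightarrow> nat)" "continuous_on {a..b} F" "\<And>t. t \<in> {a..b} \<Longrightarrow> F t \<in> K"
    "\<And>t V. t \<in> {a..b} \<Longrightarrow> open V \<Longrightarrow> F t \<in> V \<Longrightarrow>
      \<exists>\<delta>>0. \<exists>N. \<forall>n\<ge>N. \<forall>s\<in>{a..b}. \<bar>s - t\<bar> < \<delta> \<longrightarrow> f (k n) s \<in> V"
proof -
  \<comment> \<open>An enumeration of the rational points of the interval; indices of other
    rationals are sent to \<open>a\<close>.\<close>
  define q where "q = (\<lambda>j :: nat. if of_rat (from_nat j) \<in> {a..b} then of_rat (from_nat j) else a)"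
  have qab: "q j \<in> {a..b}" for j using ab by (simp add: q_def)
  have dense: "\<exists>j. \<bar>q j - t\<bar> < \<delta>" if "t \<in> {a..b}" "0 < \<delta>" for t \<delta>
  proof -
    have "max a (t - \<delta>) < min b (t + \<delta>)" using that ab by auto
    then obtain r where r: "max a (t - \<delta>) < of_rat r" "of_rat r < min b (t + \<delta>)"
      using of_rat_dense by blast
    then have "q (to_nat r) = of_rat r" by (simp add: q_def)
    then show ?thesis using r by (intro exI[of _ "to_nat r"]) auto
  qed
  obtain k l where k: "strict_mono (k :: nat \<Rightarrow> nat)" and lK: "\<And>j. l j \<in> K"
    and l: "\<And>j. (\<lambda>n. f (k n) (q j)) \<longlonglongrightarrow> l j"
    using diagonal_subsequence[OF K, of "\<lambda>n j. f n (q j)"] fK qab by blast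
  \<comment> \<open>\<open>L t p\<close> says that \<open>p\<close> is the limit at \<open>t\<close>
    even for moving arguments. The neighbourhoods are closed so that the limit function inherits the
    property, which gives its continuity.\<close>
  define L where "L = (\<lambda>t p. \<forall>V. open V \<longrightarrow> p \<in> V \<longrightarrow> (\<exists>C \<delta> N. closed C \<and> C \<subseteq> V \<and> 0 < \<delta> \<and>
      (\<forall>n\<ge>N. \<forall>s\<in>{a..b}. \<bar>s - t\<bar> < \<delta> \<longrightarrow> f (k n) s \<in> C)))"
  have "\<exists>p. p \<in> K \<and> L t p" if t: "t \<in> {a..b}" for t
  proof -
    have "seq_compact K" using K by (rule compact_imp_seq_compact)
    moreover have "\<forall>n. f (k n) t \<in> K" using fK t by blast
    ultimately obtain p r where p: "p \<in> K" "strict_mono (r :: nat \<Rightarrow> nat)" "((\<lambda>n. f (k n) t) \<circ> r) \<longlonglongrightarrow> p"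
      unfolding seq_compact_def by meson
    show ?thesis
      unfolding L_def
    proof (intro exI[of _ p] conjI p(1) allI impI)
      fix V assume V: "open V" "p \<in> V"
      obtain U1 C1 d1 where 1: "open U1" "p \<in> U1" "closed C1" "C1 \<subseteq> V" "0 < d1"
        "\<And>n s t. s \<in> {a..b} \<Longrightarrow> t \<in> {a..b} \<Longrightarrow> \<bar>s - t\<bar> < d1 \<Longrightarrow> f n s \<in> U1 \<Longrightarrow> f n t \<in> C1"
        using equi[OF p(1) V] by meson
      obtain U2 C2 d2 where 2: "open U2" "p \<in> U2" "closed C2" "C2 \<subseteq> U1" "0 < d2"
        "\<And>n s t. s \<in> {a..b} \<Longrightarrow> t \<in> {a..b} \<Longrightarrow> \<bar>s - t\<bar> < d2 \<Longrightarrow> f n s \<in> U2 \<Longrightarrow> f n t \<in> C2"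
        using equi[OF p(1) 1(1,2)] by meson
      \<comment> \<open>A rational time near \<open>t\<close> passes the information from the
        subsequence \<open>r\<close> to the whole sequence: along \<open>r\<close> the values at
        \<open>q j\<close> lie in \<open>C2\<close>, hence so does their limit \<open>l j\<close>.
        As all \<open>f (k n)\<close> converge at \<open>q j\<close>, these values are eventually in
        \<open>U1\<close>, and nearby values in \<open>C1\<close>.\<close>
      obtain j where j: "\<bar>q j - t\<bar> < min (d1 / 2) d2" using dense[OF t, of "min (d1 / 2) d2"] 1(5) 2(5) by auto
      have "\<forall>\<^sub>F n in sequentially. f (k (r n)) t \<in> U2"
        using topological_tendstoD[OF p(3) 2(1,2)] by (simp add: o_def)
      then have "\<forall>\<^sub>F n in sequentially. f (k (r n)) (q j) \<in> C2"
        by (rule eventually_mono) (use 2(6) t qab j in \<open>auto simp: abs_minus_commute\<close>)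
      moreover have "(\<lambda>n. f (k (r n)) (q j)) \<longlonglongrightarrow> l j"
        using LIMSEQ_subseq_LIMSEQ[OF l p(2)] by (simp add: o_def)
      ultimately have "l j \<in> C2"
        using Lim_in_closed_set[OF 2(3)] by (metis sequentially_bot)
      then have "l j \<in> U1" using 2(4) by blast
      then have "\<forall>\<^sub>F n in sequentially. f (k n) (q j) \<in> U1"
        using topological_tendstoD[OF l 1(1)] by blast
      then obtain N where N: "\<And>n. n \<ge> N \<Longrightarrow> f (k n) (q j) \<in> U1"
        unfolding eventually_sequentially by blast
      have "f (k n) s \<in> C1" if "n \<ge> N" "s \<in> {a..b}" "\<bar>s - t\<bar> < d1 / 2" for n s
      proof (rule 1(6)[OF qab[of j] that(2) _ N[OF that(1)]])
        show "\<bar>q j - s\<bar> < d1" using that(3) j by linarith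
      qed
      then show "\<exists>C \<delta> N. closed C \<and> C \<subseteq> V \<and> 0 < \<delta> \<and>
          (\<forall>n\<ge>N. \<forall>s\<in>{a..b}. \<bar>s - t\<bar> < \<delta> \<longrightarrow> f (k n) s \<in> C)"
        using 1(3,4,5) by (intro exI[of _ C1] exI[of _ "d1 / 2"] exI[of _ N]) auto
    qed
  qed
  then obtain F where FL: "\<And>t. t \<in> {a..b} \<Longrightarrow> F t \<in> K" "\<And>t. t \<in> {a..b} \<Longrightarrow> L t (F t)" by metis
  have F: "\<And>t. t \<in> {a..b} \<Longrightarrow> F t \<in> K"
    "\<And>t V. t \<in> {a..b} \<Longrightarrow> open V \<Longrightarrow> F t \<in> V \<Longrightarrow> \<exists>C \<delta> N. closed C \<and> C \<subseteq> V \<and> 0 < \<delta> \<and>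
      (\<forall>n\<ge>N. \<forall>s\<in>{a..b}. \<bar>s - t\<bar> < \<delta> \<longrightarrow> f (k n) s \<in> C)"
    using FL unfolding L_def by blast+
  have Fev: "\<exists>\<delta>>0. \<exists>N. \<forall>n\<ge>N. \<forall>s\<in>{a..b}. \<bar>s - t\<bar> < \<delta> \<longrightarrow> f (k n) s \<in> V"
    if "t \<in> {a..b}" "open V" "F t \<in> V" for t V
    using F(2)[OF that] by (meson subsetD)
  have lim: "(\<lambda>n. f (k n) t) \<longlonglongrightarrow> F t" if t: "t \<in> {a..b}" for t
  proof (rule topological_tendstoI)
    fix V assume "open V" "F t \<in> V"
    then obtain \<delta> N where "0 < \<delta>" "\<forall>n\<ge>N. \<forall>s\<in>{a..b}. \<bar>s - t\<bar> < \<delta> \<longrightarrow> f (k n) s \<in> V"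
      using Fev t by blast
    then show "\<forall>\<^sub>F n in sequentially. f (k n) t \<in> V"
      using t unfolding eventually_sequentially by (intro exI[of _ N]) auto
  qed
  have "continuous_on {a..b} F"
    unfolding continuous_on_def
  proof (intro ballI topological_tendstoI)
    fix t V assume t: "t \<in> {a..b}" and V: "open V" "F t \<in> V"
    obtain C \<delta> N where C: "closed C" "C \<subseteq> V" "0 < \<delta>"
      "\<And>n s. n \<ge> N \<Longrightarrow> s \<in> {a..b} \<Longrightarrow> \<bar>s - t\<bar> < \<delta> \<Longrightarrow> f (k n) s \<in> C" using F(2)[OF t V] by blast
    have "F s \<in> V" if "s \<in> {a..b}" "\<bar>s - t\<bar> < \<delta>" for s
    proof -
      have "\<forall>\<^sub>F n in sequentially. f (k n) s \<in> C"
        using C(4) that unfolding eventually_sequentially by blast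
      then have "F s \<in> C" using Lim_in_closed_set[OF C(1) _ _ lim[OF that(1)]] by simp
      then show ?thesis using C(2) by blast
    qed
    then show "\<forall>\<^sub>F s in at t within {a..b}. F s \<in> V"
      using C(3) unfolding eventually_at by (intro exI[of _ \<delta>]) (auto simp: dist_real_def)
  qed
  then show thesis
  proof (rule that[OF k])
    show "F t \<in> K" if "t \<in> {a..b}" for t by (rule F(1)[OF that])
    show "\<exists>\<delta>>0. \<exists>N. \<forall>n\<ge>N. \<forall>s\<in>{a..b}. \<bar>s - t\<bar> < \<delta> \<longrightarrow> f (k n) s \<in> V"
      if "t \<in> {a..b}" "open V" "F t \<in> V" for t V by (rule Fev[OF that])
  qed
qed

section \<open>Acceleration bounds and the oscillation of the time speed\<close>

context stationary
begin

text \<open>The geodesic equation makes the lowered acceleration quadratic in the velocity, which is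
  at most \<open>(C + 1) * \<tau>1\<close>; the fourth condition of \<open>chart_bound\<close>
  raises the index. The two derivative terms, with weights 1 and 1/2, are covered by the factor
  2.\<close>

lemma null_geodesic_acceleration:
  assumes n: "null_geodesic \<epsilon> c d y \<tau> v a \<tau>1 \<tau>2" and e: "0 \<le> \<epsilon>" "\<epsilon> \<le> 1"
    and C: "chart_bound i Q C" and s: "s \<in> {c..d}"
    and i: "i \<in> index A" "y s \<in> chart_dom A i" "chart A i (y s) \<in> Q"
  shows "norm (v i s) \<le> C * \<tau>1 s" "norm (a i s, \<tau>2 s) \<le> 2 * C\<^sup>2 * (C + 1)\<^sup>2 * (\<tau>1 s)\<^sup>2"
proof -
  note D = null_geodesicD[OF n] and B = chart_boundD[OF C i(3)]
  note t = D(3)[OF s]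
  show v: "norm (v i s) \<le> C * \<tau>1 s"
    by (rule B(5)[OF e t D(8)[OF s i(1,2)]])
  let ?q = "chart A i (y s)" and ?z = "(v i s, \<tau>1 s)"
  have z: "norm ?z \<le> (C + 1) * \<tau>1 s"
    using norm_Pair_le[of "v i s" "\<tau>1 s"] v t by (simp add: algebra_simps)
  have vz: "norm (v i s) \<le> norm ?z" using norm_fst_le[of "v i s" "\<tau>1 s"] .
  have "norm (a i s, \<tau>2 s) \<le> C * (2 * C * (norm ?z)\<^sup>2)"
  proof (rule B(4)[OF e(1)])
    fix w :: "'e \<times> real"
    have "\<bar>DM i ?q (v i s) ?z w\<bar> \<le> C * norm (v i s) * norm ?z * norm w" by (rule B(2))
    also have "\<dots> \<le> C * norm ?z * norm ?z * norm w"
      using vz B(6) by (intro mult_right_mono mult_left_mono) auto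
    finally have 1: "\<bar>DM i ?q (v i s) ?z w\<bar> \<le> C * norm ?z * norm ?z * norm w" .
    have "\<bar>DM i ?q (fst w) ?z ?z\<bar> \<le> C * norm (fst w) * norm ?z * norm ?z" by (rule B(2))
    also have "\<dots> \<le> C * norm w * norm ?z * norm ?z"
      using norm_fst_le[of "fst w" "snd w"] B(6) by (intro mult_right_mono mult_left_mono) auto
    finally have 2: "\<bar>DM i ?q (fst w) ?z ?z\<bar> \<le> C * norm ?z * norm ?z * norm w" by (simp only: mult_ac)
    have "\<bar>M i ?q (a i s, \<tau>2 s) w - \<epsilon> * (\<tau>2 s * snd w)\<bar> \<le> 2 * (C * norm ?z * norm ?z * norm w)"
      using D(9)[OF s i(1,2), of w] 1 2 by linarith
    then show "\<bar>M i ?q (a i s, \<tau>2 s) w - \<epsilon> * (snd (a i s, \<tau>2 s) * snd w)\<bar> \<le> 2 * C * (norm ?z)\<^sup>2 * norm w"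
      by (simp only: power2_eq_square mult.assoc snd_conv)
  qed
  also have "\<dots> = 2 * C\<^sup>2 * (norm ?z)\<^sup>2" by (simp add: power2_eq_square)
  also have "\<dots> \<le> 2 * C\<^sup>2 * ((C + 1) * \<tau>1 s)\<^sup>2"
    using z by (intro mult_left_mono power_mono) auto
  finally show "norm (a i s, \<tau>2 s) \<le> 2 * C\<^sup>2 * (C + 1)\<^sup>2 * (\<tau>1 s)\<^sup>2"
    by (simp add: power_mult_distrib)
qed

text \<open>Unlike the spatial components, \<tau>2 does not depend on a chart, so the bounds from
  finitely many charts covering \<open>K\<close> combine into one.\<close>

lemma time_acceleration_bound:
  assumes K: "compact K"
  obtains B where "0 < B"
    "\<And>\<epsilon> c d y \<tau> v a \<tau>1 \<tau>2 s. null_geodesic \<epsilon> c d y \<tau> v a \<tau>1 \<tau>2 \<Longrightarrow> 0 \<le> \<epsilon> \<Longrightarrow> \<epsilon> \<le> 1 \<Longrightarrow>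
       s \<in> {c..d} \<Longrightarrow> y s \<in> K \<Longrightarrow> \<bar>\<tau>2 s\<bar> \<le> B * (\<tau>1 s)\<^sup>2"
proof -
  define P where "P = (\<lambda>U B. \<forall>\<epsilon> c d y \<tau> v a \<tau>1 \<tau>2 s. null_geodesic \<epsilon> c d y \<tau> v a \<tau>1 \<tau>2 \<longrightarrow>
      0 \<le> \<epsilon> \<longrightarrow> \<epsilon> \<le> 1 \<longrightarrow> s \<in> {c..d} \<longrightarrow> y s \<in> U \<longrightarrow> \<bar>\<tau>2 s\<bar> \<le> B * (\<tau>1 s)\<^sup>2)"
  have "\<exists>U B. open U \<and> p \<in> U \<and> P U B" for p
  proof -
    define i where "i = chart_at A p"
    have i: "i \<in> index A" "p \<in> chart_dom A i" using chart_at by (auto simp: i_def)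
    obtain r where r: "0 < r" "cball (chart A i p) r \<subseteq> X i"
      by (rule chart_neighbourhood[OF open_UNIV UNIV_I i]) (rule that)
    obtain C where C: "chart_bound i (cball (chart A i p) r) C"
      using chart_bound_exists[OF i(1) compact_cball r(2)] by blast
    let ?U = "{x \<in> chart_dom A i. chart A i x \<in> ball (chart A i p) r}"
    have "\<bar>\<tau>2 s\<bar> \<le> 2 * C\<^sup>2 * (C + 1)\<^sup>2 * (\<tau>1 s)\<^sup>2"
      if "null_geodesic \<epsilon> c d y \<tau> v a \<tau>1 \<tau>2" "0 \<le> \<epsilon>" "\<epsilon> \<le> 1" "s \<in> {c..d}" "y s \<in> ?U" for \<epsilon> c d y \<tau> v a \<tau>1 \<tau>2 s
    proof -
      have "norm (\<tau>2 s) \<le> norm (a i s, \<tau>2 s)" by (rule norm_snd_le)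
      also have "\<dots> \<le> 2 * C\<^sup>2 * (C + 1)\<^sup>2 * (\<tau>1 s)\<^sup>2"
        by (rule null_geodesic_acceleration(2)[OF that(1-3) C that(4) i(1)]) (use that(5) in auto)
      finally show ?thesis by simp
    qed
    then have "P ?U (2 * C\<^sup>2 * (C + 1)\<^sup>2)" unfolding P_def by blast
    moreover have "open ?U" by (rule open_chart_preimage[OF i(1) open_ball])
    moreover have "p \<in> ?U" using i(2) r(1) by simp
    ultimately show ?thesis by blast
  qed
  then obtain U B where U: "\<And>p. open (U p)" "\<And>p. p \<in> U p" and PB: "\<And>p. P (U p) (B p)" by metis
  obtain D where D: "D \<subseteq> K" "finite D" "K \<subseteq> (\<Union>p\<in>D. U p)"
    by (rule compactE_image[OF K, of K U]) (use U in auto)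
  define b where "b = Max (insert 1 (B ` D))"
  have b: "1 \<le> b" "\<And>p. p \<in> D \<Longrightarrow> B p \<le> b" using D(2) by (auto simp: b_def)
  show thesis
  proof (rule that[of b])
    fix \<epsilon> c d y \<tau> v a \<tau>1 \<tau>2 s
    assume n: "null_geodesic \<epsilon> c d y \<tau> v a \<tau>1 \<tau>2" "0 \<le> \<epsilon>" "\<epsilon> \<le> 1" "s \<in> {c..d}" and yK: "y s \<in> K"
    obtain p where p: "p \<in> D" "y s \<in> U p" using yK D(3) by blast
    have "\<bar>\<tau>2 s\<bar> \<le> B p * (\<tau>1 s)\<^sup>2" using PB[of p] n p(2) unfolding P_def by blast
    also have "\<dots> \<le> b * (\<tau>1 s)\<^sup>2" using b(2)[OF p(1)] by (intro mult_right_mono) auto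
    finally show "\<bar>\<tau>2 s\<bar> \<le> b * (\<tau>1 s)\<^sup>2" .
  qed (use b(1) in simp)
qed

text \<open>The logarithmic derivative of \<tau>1 is at most \<open>B * \<tau>1\<close>, so
  \<open>ln \<tau>1\<close> varies by at most \<open>B\<close> times the elapsed time. The mean
  value theorem supplies a parameter at which \<tau>1 equals the mean speed.\<close>

lemma time_speed_ratio:
  assumes n: "null_geodesic \<epsilon> c d y \<tau> v a \<tau>1 \<tau>2" and B: "\<And>s. s \<in> {c..d} \<Longrightarrow> \<bar>\<tau>2 s\<bar> \<le> B * (\<tau>1 s)\<^sup>2" "0 \<le> B"
    and s: "s \<in> {c..d}"
  shows "(\<tau> d - \<tau> c) / (d - c) * exp (- B * (\<tau> d - \<tau> c)) \<le> \<tau>1 s"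
    "\<tau>1 s \<le> (\<tau> d - \<tau> c) / (d - c) * exp (B * (\<tau> d - \<tau> c))"
proof -
  note D = null_geodesicD[OF n]
  have at: "at u within {c..d} = at u" if "c < u" "u < d" for u using that by (simp add: at_within_Icc_at)
  have contt: "continuous_on {c..d} \<tau>" "continuous_on {c..d} \<tau>1"
    using D(4,5) continuous_on_vector_derivative by blast+
  have "(\<tau> has_derivative (\<lambda>h. h * \<tau>1 u)) (at u)" if "c < u" "u < d" for u
    using D(4)[of u] at[OF that] that by (simp add: has_vector_derivative_def)
  from mvt[OF D(1) contt(1) this]
  have "\<exists>r. c < r \<and> r < d \<and> \<tau> d - \<tau> c = (d - c) * \<tau>1 r" by metis
  then obtain r where "c < r" "r < d" and r2: "\<tau> d - \<tau> c = (d - c) * \<tau>1 r" by blast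
  then have r: "r \<in> {c..d}" "\<tau> d - \<tau> c = (d - c) * \<tau>1 r" by auto
  have mono: "\<tau> x \<le> \<tau> z" if "c \<le> x" "x \<le> z" "z \<le> d" for x z
    using null_geodesic_increments[OF n, of x z] that by (cases "x = z") auto
  have inc: "\<bar>ln (\<tau>1 z) - ln (\<tau>1 x)\<bar> \<le> B * (\<tau> d - \<tau> c)" if x: "c \<le> x" "x < z" "z \<le> d" for x z
  proof -
    have sub: "{x..z} \<subseteq> {c..d}" using x by auto
    have "norm (ln (\<tau>1 z) - ln (\<tau>1 x)) \<le> B * \<tau> z - B * \<tau> x"
    proof (rule differentiable_bound_general[where f'="\<lambda>u. \<tau>2 u / \<tau>1 u" and \<phi>'="\<lambda>u. B * \<tau>1 u"])
      show "continuous_on {x..z} (\<lambda>u. ln (\<tau>1 u))"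
        by (intro continuous_on_ln continuous_on_subset[OF contt(2) sub]) (use D(3) sub in fastforce)
      show "continuous_on {x..z} (\<lambda>u. B * \<tau> u)"
        by (intro continuous_intros continuous_on_subset[OF contt(1) sub])
      fix u assume u: "x < u" "u < z"
      then have uc: "u \<in> {c..d}" "at u within {c..d} = at u" using x at by auto
      have "(\<tau>1 has_real_derivative \<tau>2 u) (at u)"
        using D(5)[OF uc(1)] uc(2) by (simp add: has_real_derivative_iff_has_vector_derivative)
      from DERIV_chain2[OF DERIV_ln[OF D(3)[OF uc(1)]] this]
      show "((\<lambda>u. ln (\<tau>1 u)) has_vector_derivative \<tau>2 u / \<tau>1 u) (at u)"
        by (simp add: has_real_derivative_iff_has_vector_derivative divide_inverse mult.commute)
      show "((\<lambda>u. B * \<tau> u) has_vector_derivative B * \<tau>1 u) (at u)"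
        using has_vector_derivative_mult_right[OF D(4)[OF uc(1)], of B] uc(2) by simp
      show "norm (\<tau>2 u / \<tau>1 u) \<le> B * \<tau>1 u"
        using B(1)[OF uc(1)] D(3)[OF uc(1)] by (simp add: pos_divide_le_eq power2_eq_square mult.assoc)
    qed (rule x)
    also have "\<dots> \<le> B * (\<tau> d - \<tau> c)"
      using mono[of z d] mono[of c x] x B(2) by (simp add: right_diff_distrib[symmetric] mult_left_mono)
    finally show ?thesis by simp
  qed
  have "\<bar>ln (\<tau>1 s) - ln (\<tau>1 r)\<bar> \<le> B * (\<tau> d - \<tau> c)"
  proof (cases s r rule: linorder_cases)
    case equal
    then show ?thesis using mono[of c d] D(1) B(2) by simp
  qed (use inc[of s r] inc[of r s] s r(1) in \<open>auto simp: abs_minus_commute\<close>)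
  then have l: "ln (\<tau>1 r) + (- B * (\<tau> d - \<tau> c)) \<le> ln (\<tau>1 s)" "ln (\<tau>1 s) \<le> ln (\<tau>1 r) + B * (\<tau> d - \<tau> c)"
    by linarith+
  have pos: "0 < \<tau>1 s" "0 < \<tau>1 r" using D(3) s r(1) by auto
  have r': "(\<tau> d - \<tau> c) / (d - c) = \<tau>1 r" using r(2) D(1) by simp
  show "(\<tau> d - \<tau> c) / (d - c) * exp (- B * (\<tau> d - \<tau> c)) \<le> \<tau>1 s"
    unfolding r' using iffD2[OF exp_le_cancel_iff l(1)] pos by (simp add: exp_diff exp_minus divide_inverse)
  show "\<tau>1 s \<le> (\<tau> d - \<tau> c) / (d - c) * exp (B * (\<tau> d - \<tau> c))"
    unfolding r' using iffD2[OF exp_le_cancel_iff l(2)] pos by (simp add: exp_add)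
qed

end


subsection \<open>Absence of short lightlike loops\<close>

lemma vector_derivative_bound:
  fixes f :: "real \<Rightarrow> 'v::real_normed_vector"
  assumes f: "\<And>x. x \<in> {a..b} \<Longrightarrow> (f has_vector_derivative f' x) (at x within {a..b})"
    and B: "\<And>x. x \<in> {a..b} \<Longrightarrow> norm (f' x) \<le> B" and x: "x \<in> {a..b}" "y \<in> {a..b}"
  shows "norm (f x - f y) \<le> B * \<bar>x - y\<bar>"
proof -
  have "norm (f x - f y) \<le> B * norm (x - y)"
  proof (rule differentiable_bound[OF convex_real_interval(5) _ _ x])
    fix z assume z: "z \<in> {a..b}"
    show "(f has_derivative (\<lambda>h. h *\<^sub>R f' z)) (at z within {a..b})"
      using f[OF z] by (simp add: has_vector_derivative_def)
    show "onorm (\<lambda>h. h *\<^sub>R f' z) \<le> B"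
    proof (rule onorm_bound)
      show "0 \<le> B" using order_trans[OF norm_ge_zero B[OF z]] .
      show "norm (h *\<^sub>R f' z) \<le> B * norm h" for h
        using mult_right_mono[OF B[OF z], of "norm h"] by (simp add: mult.commute)
    qed
  qed
  then show ?thesis by simp
qed

lemma differentiable_imp_Lipschitz_at:
  fixes f :: "'v::real_normed_vector \<Rightarrow> 'w::real_normed_vector"
  assumes "f differentiable (at p)"
  obtains K r where "0 \<le> K" "0 < r" "\<And>q. dist p q < r \<Longrightarrow> norm (f q - f p) \<le> K * norm (q - p)"
proof -
  obtain f' where f': "(f has_derivative f') (at p)" using assms by (auto simp: differentiable_def)
  obtain B where B: "0 < B" "\<And>x. norm (f' x) \<le> norm x * B"
    using bounded_linear.pos_bounded[OF has_derivative_bounded_linear[OF f']] by blast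
  have "\<forall>\<^sub>F q in at p. norm (f q - f p - f' (q - p)) \<le> 1 * norm (q - p)"
    using f' unfolding has_derivative_within_alt2 by (meson zero_less_one)
  then obtain r where r: "0 < r" "\<And>q. q \<noteq> p \<Longrightarrow> dist q p < r \<Longrightarrow> norm (f q - f p - f' (q - p)) \<le> norm (q - p)"
    unfolding eventually_at by auto
  have "norm (f q - f p) \<le> (1 + B) * norm (q - p)" if "dist p q < r" for q
  proof (cases "q = p")
    case False
    then have "norm (f q - f p - f' (q - p)) \<le> norm (q - p)" using r(2) that by (simp add: dist_commute)
    moreover have "norm (f q - f p) \<le> norm (f q - f p - f' (q - p)) + norm (f' (q - p))"
      using norm_triangle_sub[of "f q - f p" "f' (q - p)"] by simp
    ultimately show ?thesis using B(2)[of "q - p"] by (simp add: algebra_simps)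
  qed simp
  then show thesis using that[of "1 + B" r] r(1) B(1) by simp
qed

context stationary
begin

lemma DM_differentiable:
  assumes "i \<in> index A" "q \<in> X i"
  shows "(\<lambda>q. DM i q w u v) differentiable (at q)"
proof -
  have *: "(\<lambda>x. frechet_derivative f (at x) w) differentiable (at q)" if "smooth_on f (X i)" for f :: "'e \<Rightarrow> real"
  proof -
    have "\<forall>x\<in>X i. (\<lambda>x. frechet_derivative f (at x) w) differentiable (at x)"
      using smooth_on_Ck_derivative[OF that, of "Suc 0" w, unfolded Ck_on.simps(2)] by blast
    then show ?thesis using assms(2) by blast
  qed
  note s = G_smooth[OF assms(1), THEN *] W_smooth[OF assms(1), THEN *] L_smooth[OF assms(1), THEN *]
  show ?thesis unfolding DM_def by (intro differentiable_add differentiable_diff differentiable_mult s differentiable_const)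
qed

text \<open>Let \<open>m = (\<Lambda> + \<epsilon>) \<tau>1 - \<omega>(v)\<close> be the conserved momentum along a loop from \<open>p\<close> of length \<open>D\<close> in
  time. As \<open>\<bar>d\<Lambda>\<bar> = O(\<surd>\<Lambda>)\<close> at \<open>p\<close> (because \<open>\<Lambda> \<ge> 0\<close>), velocity and acceleration are \<open>O(\<surd>m)\<close>;
  since the velocity has mean zero, it is even \<open>O(D \<surd>m)\<close>, and then
  \<open>\<omega>(v) = m - g\<^sub>0(v, v) / \<tau>1\<close> stays close to \<open>m > 0\<close>, so that the loop cannot close up.\<close>

lemma no_short_null_loop:
  fixes p :: 'a
  obtains \<delta> where "0 < \<delta>"
    "\<And>\<epsilon> D y \<tau> v a \<tau>1 \<tau>2. null_geodesic \<epsilon> 0 D y \<tau> v a \<tau>1 \<tau>2 \<Longrightarrow> 0 < \<epsilon> \<Longrightarrow> \<epsilon> \<le> 1 \<Longrightarrow>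
       D < \<delta> \<Longrightarrow> \<tau> D - \<tau> 0 < \<delta> \<Longrightarrow> \<forall>s\<in>{0..D}. 1 / 2 \<le> \<tau>1 s \<and> \<tau>1 s \<le> 2 \<Longrightarrow> y 0 = p \<Longrightarrow> y D \<noteq> p"
proof -
  define i where "i = chart_at A p"
  have i: "i \<in> index A" "p \<in> chart_dom A i" using chart_at by (auto simp: i_def)
  define q0 where "q0 = chart A i p"
  have q0: "q0 \<in> X i" using i by (simp add: q0_def)
  obtain r0 where "0 < r0" "cball (chart A i p) r0 \<subseteq> X i"
    by (rule chart_neighbourhood[OF open_UNIV UNIV_I i]) (rule that)
  then have r0: "0 < r0" "cball q0 r0 \<subseteq> X i" by (simp_all add: q0_def)
  obtain C where C: "chart_bound i (cball q0 r0) C"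
    using chart_bound_exists[OF i(1) compact_cball r0(2)] by blast
  have C1: "1 \<le> C" using C by (simp add: chart_bound_def)
  let ?e = "(0, 1) :: 'e \<times> real"
  \<comment> \<open>\<open>gr\<close> is minus the gradient of \<open>L i\<close>, because
    \<open>M i q ?e ?e = - L i q\<close>; \<open>cv\<close> represents \<omega>. Both use the inner
    product of the coordinates.\<close>
  define gr where "gr = (\<lambda>q. \<Sum>b\<in>Basis. DM i q b ?e ?e *\<^sub>R b)"
  define cv where "cv = (\<lambda>q. \<Sum>b\<in>Basis. W i q b *\<^sub>R b)"
  have gr: "DM i q w ?e ?e = gr q \<bullet> w" if "q \<in> X i" for q w
    using linear_expansion[OF DM_linear[OF i(1) that], of w ?e ?e]
    by (simp add: gr_def inner_sum_left inner_commute[of w] mult.commute)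
  have cv: "W i q w = cv q \<bullet> w" if "q \<in> X i" for q w
    using linear_expansion[OF W_linear[OF i(1) that], of w]
    by (simp add: cv_def inner_sum_left inner_commute[of w] mult.commute)
  have "gr differentiable (at q0)"
    unfolding gr_def by (intro differentiable_sum finite_Basis ballI differentiable_scaleR DM_differentiable i q0 differentiable_const)
  then obtain K1 r1 where K1: "0 \<le> K1" "0 < r1" "\<And>q. dist q0 q < r1 \<Longrightarrow> norm (gr q - gr q0) \<le> K1 * norm (q - q0)"
    using differentiable_imp_Lipschitz_at by metis
  have "(\<lambda>q. W i q b) differentiable (at q0)" for b
    using smooth_on_has_derivative[OF W_smooth[OF i(1)] q0] differentiableI by blast
  then have "cv differentiable (at q0)"
    unfolding cv_def by (intro differentiable_sum finite_Basis ballI differentiable_scaleR differentiable_const)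
  then obtain K2 r2 where K2: "0 \<le> K2" "0 < r2" "\<And>q. dist q0 q < r2 \<Longrightarrow> norm (cv q - cv q0) \<le> K2 * norm (q - q0)"
    using differentiable_imp_Lipschitz_at by metis
  have LM: "L i q = - M i q ?e ?e" if "q \<in> X i" for q
    using bilinear_rzero[OF G_facts(1)[OF i(1) that]] linear_0[OF W_linear[OF i(1) that]] by (simp add: M_def)
  \<comment> \<open>Only the single point \<open>q0\<close> is concerned. If \<open>L i\<close>
    vanishes there, it has a minimum and its gradient is zero; otherwise the quotient itself serves
    as the constant.\<close>
  have "\<exists>K0\<ge>0. norm (gr q0) \<le> K0 * sqrt (L i q0)"
  proof (cases "L i q0 = 0")
    case True
    have "(\<lambda>w. DM i q0 w ?e ?e) = (\<lambda>w. 0)"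
    proof (rule differential_zero_maxmin[OF q0 open_X[OF i(1)] M_has_derivative[OF i(1) q0]])
      show "(\<forall>q\<in>X i. M i q ?e ?e \<le> M i q0 ?e ?e) \<or> (\<forall>q\<in>X i. M i q0 ?e ?e \<le> M i q ?e ?e)"
      proof (intro disjI1 ballI)
        fix q assume "q \<in> X i"
        then show "M i q ?e ?e \<le> M i q0 ?e ?e" using LM[of q] LM[OF q0] L_nonneg[of i q] True by linarith
      qed
    qed
    then have "gr q0 = 0" using fun_cong[of _ _ "gr q0"] gr[OF q0, of "gr q0"] by fastforce
    then show ?thesis by auto
  next
    case False
    then have "0 < sqrt (L i q0)" using L_nonneg[of i q0] by simp
    then show ?thesis by (intro exI[of _ "norm (gr q0) / sqrt (L i q0)"]) auto
  qed
  then obtain K0 where K0: "0 \<le> K0" "norm (gr q0) \<le> K0 * sqrt (L i q0)" by blast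
  \<comment> \<open>Let \<mu> be the square root of the conserved momentum \<open>m\<close>. Then
    \<open>c1 * \<mu>\<close> bounds the spatial velocity, \<open>c2 * \<mu>\<close> bounds
    \<open>gr\<close> along the loop, \<open>Z\<close> the full velocity, \<open>c3 * \<mu>\<close>
    the lowered acceleration and \<open>c4 * \<mu>\<close> the acceleration;
    \<open>c5 * D\<^sup>2 * m\<close> is the total error in the final estimate of
    \<omega>(v).\<close>
  define c1 where "c1 = 2 * C"
  define c2 where "c2 = 2 * K0 + K1 * c1"
  define Z where "Z = 2 * C + 2"
  define c3 where "c3 = 2 * (C * c1 * Z) + 2 * (C * c1) + 4 * c2"
  define c4 where "c4 = C * c3"
  define c5 where "c5 = 2 * C * c4\<^sup>2 + K2 * c1 * c4"
  have nn: "0 \<le> c1" "0 \<le> c2" "0 \<le> Z" "0 \<le> c3" "0 \<le> c4" "0 \<le> c5"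
    using C1 K0(1) K1(1) K2(1) by (auto simp: c1_def c2_def Z_def c3_def c4_def c5_def)
  define r where "r = min r0 (min r1 r2)"
  define V where "V = {x \<in> chart_dom A i. chart A i x \<in> ball q0 r}"
  have opV: "open V" unfolding V_def by (rule open_chart_preimage[OF i(1) open_ball])
  have pV: "p \<in> V" using i r0(1) K1(2) K2(2) by (simp add: V_def q0_def r_def)
  obtain U K \<delta>0 where eq: "open U" "p \<in> U" "closed K" "K \<subseteq> V" "0 < \<delta>0"
    "\<And>\<epsilon> c d y \<tau> v a \<tau>1 \<tau>2 s r. null_geodesic \<epsilon> c d y \<tau> v a \<tau>1 \<tau>2 \<Longrightarrow> 0 \<le> \<epsilon> \<Longrightarrow> \<epsilon> \<le> 1 \<Longrightarrow>
       s \<in> {c..d} \<Longrightarrow> r \<in> {c..d} \<Longrightarrow> y s \<in> U \<Longrightarrow> \<bar>\<tau> r - \<tau> s\<bar> < \<delta>0 \<Longrightarrow> y r \<in> K"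
    by (rule null_geodesic_equicontinuous[OF opV pV]) (rule that; assumption)
  \<comment> \<open>The first entry keeps the loop in the chart, the second ensures
    \<open>D \<le> 1\<close> and \<open>c5 * D\<^sup>2 < 1\<close>.\<close>
  define \<delta> where "\<delta> = min \<delta>0 (1 / (c5 + 1))"
  have \<delta>: "0 < \<delta>" "\<delta> \<le> \<delta>0" "\<delta> * (c5 + 1) \<le> 1" "\<delta> \<le> 1"
  proof -
    show "0 < \<delta>" "\<delta> \<le> \<delta>0" using eq(5) nn by (auto simp: \<delta>_def)
    have "\<delta> \<le> 1 / (c5 + 1)" by (simp add: \<delta>_def)
    then show "\<delta> * (c5 + 1) \<le> 1" using nn by (simp add: pos_le_divide_eq)
    have "1 / (c5 + 1) \<le> 1" using nn by simp
    then show "\<delta> \<le> 1" by (simp add: \<delta>_def)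
  qed
  have "y D \<noteq> p"
    if n: "null_geodesic \<epsilon> 0 D y \<tau> v a \<tau>1 \<tau>2" and e: "0 < \<epsilon>" "\<epsilon> \<le> 1" and D: "D < \<delta>" "\<tau> D - \<tau> 0 < \<delta>"
      and t1': "\<forall>s\<in>{0..D}. 1 / 2 \<le> \<tau>1 s \<and> \<tau>1 s \<le> 2" and y0: "y 0 = p"
    for \<epsilon> D y \<tau> v a \<tau>1 \<tau>2
  proof
    assume "y D = p"
    note y = y0 this and t1 = t1'[rule_format]
    note N = null_geodesicD[OF n]
    define q where "q = (\<lambda>s. chart A i (y s))"
    have D0: "0 < D" using N(1) .
    have D1: "D \<le> 1" using D(1) \<delta>(4) by simp
    have inV: "y s \<in> V" if s: "s \<in> {0..D}" for s
    proof -
      have "\<tau> 0 \<le> \<tau> s" using null_geodesic_increments[OF n, of 0 s] s by (cases "s = 0") auto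
      moreover have "\<tau> s \<le> \<tau> D" using null_geodesic_increments[OF n, of s D] s by (cases "s = D") auto
      ultimately have "\<bar>\<tau> s - \<tau> 0\<bar> < \<delta>0" using D(2) \<delta>(2) by simp
      then have "y s \<in> K" using eq(6)[OF n less_imp_le[OF e(1)] e(2), of 0 s] s y(1) eq(2) D0 by auto
      then show ?thesis using eq(4) by blast
    qed
    have yi: "y s \<in> chart_dom A i" and qr: "dist q0 (q s) < r" and qQ: "q s \<in> cball q0 r0" and qX: "q s \<in> X i"
      if "s \<in> {0..D}" for s
    proof -
      show "y s \<in> chart_dom A i" "dist q0 (q s) < r" using inV[OF that] by (auto simp: V_def q_def)
      then show "q s \<in> cball q0 r0" "q s \<in> X i" by (auto simp: r_def q_def)
    qed
    have qv: "(q has_vector_derivative v i s) (at s within {0..D})" if "s \<in> {0..D}" for s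
      using N(6)[OF that i(1) yi[OF that]] by (simp add: q_def)
    have va: "(v i has_vector_derivative a i s) (at s within {0..D})" if "s \<in> {0..D}" for s
      using N(7)[OF that i(1) yi[OF that]] .
    have q_ends: "q 0 = q0" "q D = q0" using y by (simp_all add: q_def q0_def)
    have "\<exists>m. \<forall>s\<in>{0..D}. W i (q s) (v i s) - L i (q s) * \<tau>1 s - \<epsilon> * \<tau>1 s = m"
    proof -
      have "\<exists>m. \<forall>s\<in>{0..D}. M i (q s) (v i s, \<tau>1 s) ?e - \<epsilon> * (\<tau>1 s * snd ?e) = m"
      proof (rule has_vector_derivative_zero_constant)
        fix s assume s: "s \<in> {0..D}"
        have "DM i (q s) (fst ?e) (v i s, \<tau>1 s) (v i s, \<tau>1 s) = 0"
          using linear_0[OF DM_linear[OF i(1) qX[OF s]]] by simp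
        then show "((\<lambda>s. M i (q s) (v i s, \<tau>1 s) ?e - \<epsilon> * (\<tau>1 s * snd ?e)) has_vector_derivative 0) (at s within {0..D})"
          using null_geodesic_momentum[OF n s i(1) yi[OF s], of ?e] by (simp add: q_def)
      qed auto
      moreover have "M i (q s) (v i s, \<tau>1 s) ?e = W i (q s) (v i s) - L i (q s) * \<tau>1 s" if "s \<in> {0..D}" for s
        using bilinear_rzero[OF G_facts(1)[OF i(1) qX[OF that]]] linear_0[OF W_linear[OF i(1) qX[OF that]]]
        by (simp add: M_def)
      ultimately show ?thesis by (metis (no_types, lifting) mult.right_neutral snd_conv)
    qed
    then obtain m' where m': "\<And>s. s \<in> {0..D} \<Longrightarrow> W i (q s) (v i s) - L i (q s) * \<tau>1 s - \<epsilon> * \<tau>1 s = m'" by blast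
    define m where "m = - m'"
    have Wv: "W i (q s) (v i s) = (L i (q s) + \<epsilon>) * \<tau>1 s - m" if "s \<in> {0..D}" for s
      using m'[OF that] by (simp add: m_def algebra_simps)
    \<comment> \<open>The null condition with \<omega>(v) eliminated through the momentum. Both
      summands on the right are nonnegative, so \<open>m\<close> is positive and each summand is of
      order \<open>m\<close>.\<close>
    have mG: "2 * m * \<tau>1 s = (L i (q s) + \<epsilon>) * (\<tau>1 s)\<^sup>2 + G i (q s) (v i s) (v i s)" if s: "s \<in> {0..D}" for s
    proof -
      have "G i (q s) (v i s) (v i s) + 2 * W i (q s) (v i s) * \<tau>1 s = (L i (q s) + \<epsilon>) * (\<tau>1 s)\<^sup>2"
        using N(8)[OF s i(1) yi[OF s]] by (simp add: M_def q_def power2_eq_square algebra_simps)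
      then show ?thesis unfolding Wv[OF s] by (simp add: power2_eq_square algebra_simps)
    qed
    have zero: "0 \<in> {0..D}" using D0 by simp
    have m0: "0 < m"
    proof -
      have "0 < (L i (q 0) + \<epsilon>) * (\<tau>1 0)\<^sup>2" using L_nonneg[of i "q 0"] e(1) N(3)[OF zero] by (intro mult_pos_pos) auto
      then have "0 < 2 * m * \<tau>1 0" using mG[OF zero] G_nonneg[OF i(1) qX[OF zero], of "v i 0"] by linarith
      then show ?thesis using N(3)[OF zero] by (simp add: zero_less_mult_iff)
    qed
    define \<mu> where "\<mu> = sqrt m"
    have \<mu>: "0 < \<mu>" "\<mu> * \<mu> = m" using m0 by (simp_all add: \<mu>_def)
    have v1: "norm (v i s) \<le> c1 * \<mu>" if s: "s \<in> {0..D}" for s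
    proof -
      have "(norm (v i s))\<^sup>2 \<le> C * G i (q s) (v i s) (v i s)" by (rule chart_boundD(3)[OF C qQ[OF s]])
      also have "\<dots> \<le> C * (2 * m * \<tau>1 s)"
        using mG[OF s] L_nonneg[of i "q s"] e(1) C1 by (intro mult_left_mono) auto
      also have "\<dots> \<le> C * (2 * m * 2)" using t1[OF s] m0 C1 by (intro mult_left_mono) auto
      also have "\<dots> \<le> (C * C) * (4 * m)" using C1 m0 mult_right_mono[of 1 C "C * (4 * m)"] by (simp add: mult.assoc)
      also have "\<dots> = (c1 * \<mu>)\<^sup>2" by (simp add: c1_def power2_eq_square \<mu>(2)[symmetric])
      finally show ?thesis by (rule power2_le_imp_le) (use nn \<mu> in simp)
    qed
    have qd: "norm (q s - q0) \<le> c1 * \<mu> * D" if s: "s \<in> {0..D}" for s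
    proof -
      have "norm (q s - q 0) \<le> c1 * \<mu> * \<bar>s - 0\<bar>" by (rule vector_derivative_bound[OF qv v1 s zero])
      also have "\<dots> \<le> c1 * \<mu> * D" using s nn \<mu> by (intro mult_left_mono) auto
      finally show ?thesis by (simp add: q_ends)
    qed
    \<comment> \<open>With \<open>K0\<close> this makes the gradient at \<open>q0\<close> of order
      \<mu>; the bound 1/2 \<le> \<tau>1 enters here.\<close>
    have Lq0: "sqrt (L i q0) \<le> 2 * \<mu>"
    proof -
      have "(L i q0 + \<epsilon>) * (\<tau>1 0 * \<tau>1 0) \<le> (2 * m) * \<tau>1 0"
        using mG[OF zero] G_nonneg[OF i(1) qX[OF zero], of "v i 0"] by (simp add: q_ends power2_eq_square)
      then have "((L i q0 + \<epsilon>) * \<tau>1 0) * \<tau>1 0 \<le> (2 * m) * \<tau>1 0" by (simp add: mult.assoc)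
      then have "(L i q0 + \<epsilon>) * \<tau>1 0 \<le> 2 * m" using N(3)[OF zero] by (simp add: mult_le_cancel_right)
      moreover have "(L i q0 + \<epsilon>) * (1 / 2) \<le> (L i q0 + \<epsilon>) * \<tau>1 0"
        using t1[OF zero] L_nonneg[of i q0] e(1) by (intro mult_left_mono) auto
      ultimately have "L i q0 \<le> 4 * m" using e(1) by simp
      also have "\<dots> = (2 * \<mu>)\<^sup>2" by (simp add: power2_eq_square \<mu>(2)[symmetric])
      finally show ?thesis using \<mu>(1) by (intro real_le_lsqrt) (auto simp: L_nonneg)
    qed
    have g: "norm (gr (q s)) \<le> c2 * \<mu>" if s: "s \<in> {0..D}" for s
    proof -
      have "norm (gr (q s) - gr q0) \<le> K1 * norm (q s - q0)" using qr[OF s] by (intro K1(3)) (simp add: r_def)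
      also have "\<dots> \<le> K1 * (c1 * \<mu> * D)" by (intro mult_left_mono qd s K1(1))
      also have "\<dots> \<le> K1 * (c1 * \<mu> * 1)" using D1 K1(1) nn \<mu> by (intro mult_left_mono) auto
      finally have "norm (gr (q s) - gr q0) \<le> K1 * c1 * \<mu>" by simp
      moreover have "norm (gr q0) \<le> K0 * (2 * \<mu>)"
        using K0(2) mult_left_mono[OF Lq0 K0(1)] by linarith
      moreover have "norm (gr (q s)) \<le> norm (gr (q s) - gr q0) + norm (gr q0)"
        using norm_triangle_sub[of "gr (q s)" "gr q0"] by simp
      ultimately show ?thesis by (simp add: c2_def algebra_simps)
    qed
    have acc: "norm (a i s) \<le> c4 * \<mu>" if s: "s \<in> {0..D}" for s
    proof -
      note B = chart_boundD[OF C qQ[OF s]]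
      note bD = DM_bilinear[OF i(1) qX[OF s]]
      let ?z = "(v i s, \<tau>1 s)"
      have qs: "chart A i (y s) = q s" by (simp add: q_def)
      have vC: "norm (v i s) \<le> C * \<tau>1 s"
        using null_geodesic_acceleration(1)[OF n less_imp_le[OF e(1)] e(2) C s i(1) yi[OF s]] qQ[OF s] by (simp add: q_def)
      also have "\<dots> \<le> C * 2" using t1[OF s] C1 by (intro mult_left_mono) auto
      finally have z: "norm ?z \<le> Z"
        using norm_Pair_le[of "v i s" "\<tau>1 s"] t1[OF s] N(3)[OF s] by (simp add: Z_def)
      have est: "\<bar>DM i (q s) w1 u w2\<bar> \<le> C * x * y' * z'"
        if "norm w1 \<le> x" "norm u \<le> y'" "norm w2 \<le> z'" for w1 u w2 x y' z'
      proof -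
        have 0: "0 \<le> x" "0 \<le> y'" "0 \<le> z'" using that norm_ge_zero order_trans by blast+
        have "\<bar>DM i (q s) w1 u w2\<bar> \<le> C * norm w1 * norm u * norm w2" by (rule B(2))
        also have "\<dots> \<le> C * x * y' * z'" using that 0 C1 by (intro mult_mono) auto
        finally show ?thesis .
      qed
      have "norm (a i s, \<tau>2 s) \<le> C * (c3 * \<mu>)"
      proof (rule B(4)[OF less_imp_le[OF e(1)]])
        fix w :: "'e \<times> real"
        have fw: "norm (fst w) \<le> norm w" using norm_fst_le[of "fst w" "snd w"] by simp
        have v0: "norm (v i s, 0::real) \<le> c1 * \<mu>" using v1[OF s] by (simp add: norm_Pair)
        have 1: "\<bar>DM i (q s) (v i s) ?z w\<bar> \<le> C * (c1 * \<mu>) * Z * norm w"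
          by (rule est[OF v1[OF s] z order_refl])
        \<comment> \<open>Splitting off the time direction: every term of the expansion contains the
          velocity \<open>v i s\<close>, of order \<mu>, except the one with \<open>?e\<close> in
          both slots. That one is a derivative of \<open>L i\<close> and is controlled by
          \<open>g\<close>.\<close>
        have zz: "?z = (v i s, 0) + \<tau>1 s *\<^sub>R ?e" by simp
        have split: "DM i (q s) (fst w) ?z ?z = DM i (q s) (fst w) (v i s, 0) ?z
            + \<tau>1 s * DM i (q s) (fst w) ?e (v i s, 0) + \<tau>1 s * \<tau>1 s * DM i (q s) (fst w) ?e ?e"
        proof -
          have "DM i (q s) (fst w) ?z x = DM i (q s) (fst w) (v i s, 0) x + \<tau>1 s * DM i (q s) (fst w) ?e x" for x
            unfolding zz bilinear_ladd[OF bD] bilinear_lmul[OF bD] by simp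
          moreover have "DM i (q s) (fst w) ?e ?z = DM i (q s) (fst w) ?e (v i s, 0) + \<tau>1 s * DM i (q s) (fst w) ?e ?e"
            unfolding zz bilinear_radd[OF bD] bilinear_rmul[OF bD] by simp
          ultimately show ?thesis by (simp add: algebra_simps)
        qed
        have 2: "\<bar>DM i (q s) (fst w) (v i s, 0) ?z\<bar> \<le> C * norm w * (c1 * \<mu>) * Z"
          by (rule est[OF fw v0 z])
        have "\<bar>DM i (q s) (fst w) ?e (v i s, 0)\<bar> \<le> C * norm w * 1 * (c1 * \<mu>)"
          by (rule est[OF fw _ v0]) (simp add: norm_Pair)
        then have "\<bar>\<tau>1 s\<bar> * \<bar>DM i (q s) (fst w) ?e (v i s, 0)\<bar> \<le> 2 * (C * norm w * 1 * (c1 * \<mu>))"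
          using t1[OF s] by (intro mult_mono) auto
        then have 3: "\<bar>\<tau>1 s * DM i (q s) (fst w) ?e (v i s, 0)\<bar> \<le> 2 * (C * norm w * (c1 * \<mu>))"
          by (simp add: abs_mult)
        have "\<bar>gr (q s) \<bullet> fst w\<bar> \<le> (c2 * \<mu>) * norm w"
          using Cauchy_Schwarz_ineq2[of "gr (q s)" "fst w"] mult_mono[OF g[OF s] fw] nn \<mu> by simp
        moreover have "\<tau>1 s * \<tau>1 s \<le> 2 * 2" using t1[OF s] by (intro mult_mono) auto
        then have "\<bar>\<tau>1 s * \<tau>1 s\<bar> \<le> 2 * 2" by simp
        ultimately have "\<bar>\<tau>1 s * \<tau>1 s\<bar> * \<bar>gr (q s) \<bullet> fst w\<bar> \<le> (2 * 2) * ((c2 * \<mu>) * norm w)"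
          by (intro mult_mono) auto
        then have 4: "\<bar>\<tau>1 s * \<tau>1 s * DM i (q s) (fst w) ?e ?e\<bar> \<le> 4 * (c2 * \<mu> * norm w)"
          unfolding gr[OF qX[OF s]] by (simp add: abs_mult)
        have "\<bar>M i (q s) (a i s, \<tau>2 s) w - \<epsilon> * (\<tau>2 s * snd w)\<bar>
            \<le> C * (c1 * \<mu>) * Z * norm w + (C * norm w * (c1 * \<mu>) * Z + 2 * (C * norm w * (c1 * \<mu>)) + 4 * (c2 * \<mu> * norm w))"
          using N(9)[OF s i(1) yi[OF s], of w, unfolded qs] 1 2 3 4 split by linarith
        also have "\<dots> = c3 * \<mu> * norm w" by (simp add: c3_def algebra_simps)
        finally show "\<bar>M i (q s) (a i s, \<tau>2 s) w - \<epsilon> * (snd (a i s, \<tau>2 s) * snd w)\<bar> \<le> c3 * \<mu> * norm w"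
          by simp
      qed
      then show ?thesis using norm_fst_le[of "a i s" "\<tau>2 s"] by (simp add: c4_def)
    qed
    \<comment> \<open>The loop closes, so its velocity has mean zero and is bounded by its own
      oscillation, at most the acceleration bound times \<open>D\<close>. Formally, the derivative
      of \<open>q u - u *\<^sub>R v i s\<close> is estimated and the function compared at the two
      ends.\<close>
    have v2: "norm (v i s) \<le> c4 * \<mu> * D" if s: "s \<in> {0..D}" for s
    proof -
      have "norm ((q D - D *\<^sub>R v i s) - (q 0 - 0 *\<^sub>R v i s)) \<le> (c4 * \<mu> * D) * \<bar>D - 0\<bar>"
      proof (rule vector_derivative_bound)
        fix u assume u: "u \<in> {0..D}"
        show "((\<lambda>u. q u - u *\<^sub>R v i s) has_vector_derivative v i u - v i s) (at u within {0..D})"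
          using has_vector_derivative_diff[OF qv[OF u] has_vector_derivative_scaleR[OF DERIV_ident has_vector_derivative_const]]
          by simp
        have "norm (v i u - v i s) \<le> c4 * \<mu> * \<bar>u - s\<bar>" by (rule vector_derivative_bound[OF va acc u s])
        also have "\<dots> \<le> c4 * \<mu> * D" using u s nn \<mu> by (intro mult_left_mono) auto
        finally show "norm (v i u - v i s) \<le> c4 * \<mu> * D" .
      qed (use D0 in auto)
      then have "D * norm (v i s) \<le> D * (c4 * \<mu> * D)" using q_ends D0 by (simp add: mult.commute)
      then show ?thesis using D0 by simp
    qed
    have pos: "0 < cv q0 \<bullet> v i s" if s: "s \<in> {0..D}" for s
    proof -
      have "G i (q s) (v i s) (v i s) = M i (q s) (v i s, 0) (v i s, 0)" by (simp add: M_def)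
      then have "G i (q s) (v i s) (v i s) \<le> C * norm (v i s) * norm (v i s)"
        using chart_boundD(1)[OF C qQ[OF s], of "(v i s, 0)" "(v i s, 0)"] by (simp add: norm_Pair)
      also have "\<dots> \<le> C * (c4 * \<mu> * D) * (c4 * \<mu> * D)" using v2[OF s] C1 nn \<mu> D0 by (intro mult_mono) auto
      also have "\<dots> = C * c4\<^sup>2 * D\<^sup>2 * m" by (simp add: power2_eq_square \<mu>(2)[symmetric])
      finally have G: "G i (q s) (v i s) (v i s) \<le> C * c4\<^sup>2 * D\<^sup>2 * m" .
      \<comment> \<open>The bound 1/2 \<le> \<tau>1 supplies a factor \<tau>1, so that it can be
        cancelled from the null relation.\<close>
      also have "\<dots> \<le> (2 * \<tau>1 s) * (C * c4\<^sup>2 * D\<^sup>2 * m)"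
        using t1[OF s] C1 m0 mult_right_mono[of 1 "2 * \<tau>1 s" "C * c4\<^sup>2 * D\<^sup>2 * m"] by simp
      finally have "(2 * m - 2 * C * c4\<^sup>2 * D\<^sup>2 * m) * \<tau>1 s \<le> ((L i (q s) + \<epsilon>) * \<tau>1 s) * \<tau>1 s"
        using mG[OF s] by (simp add: power2_eq_square algebra_simps)
      then have "2 * m - 2 * C * c4\<^sup>2 * D\<^sup>2 * m \<le> (L i (q s) + \<epsilon>) * \<tau>1 s"
        using N(3)[OF s] by (simp add: mult_le_cancel_right)
      then have 1: "m - 2 * C * c4\<^sup>2 * D\<^sup>2 * m \<le> cv (q s) \<bullet> v i s"
        using Wv[OF s] cv[OF qX[OF s], of "v i s"] by linarith
      \<comment> \<open>The covector is frozen at \<open>q0\<close>: a fixed linear functional that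
        increases strictly along the loop contradicts \<open>q 0 = q D\<close>.\<close>
      have "norm (cv (q s) - cv q0) \<le> K2 * norm (q s - q0)" using qr[OF s] by (intro K2(3)) (simp add: r_def)
      also have "\<dots> \<le> K2 * (c1 * \<mu> * D)" by (intro mult_left_mono qd s K2(1))
      finally have "norm (cv (q s) - cv q0) * norm (v i s) \<le> (K2 * (c1 * \<mu> * D)) * (c4 * \<mu> * D)"
        using v2[OF s] K2(1) nn \<mu> D0 by (intro mult_mono) auto
      also have "\<dots> = K2 * c1 * c4 * D\<^sup>2 * m" by (simp add: power2_eq_square \<mu>(2)[symmetric])
      finally have 2: "\<bar>(cv (q s) - cv q0) \<bullet> v i s\<bar> \<le> K2 * c1 * c4 * D\<^sup>2 * m"
        using Cauchy_Schwarz_ineq2 order_trans by blast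
      have "D * D * c5 \<le> D * c5" using D0 D1 nn mult_right_mono[of "D * D" D c5] by (simp add: mult_left_le)
      also have "\<dots> \<le> \<delta> * c5" using D(1) nn by (intro mult_right_mono) auto
      also have "\<dots> < 1" using \<delta>(1,3) by (simp add: algebra_simps)
      finally have "D\<^sup>2 * c5 < 1" by (simp add: power2_eq_square)
      then have "(D\<^sup>2 * c5) * m < 1 * m" using m0 by (intro mult_strict_right_mono) auto
      then have "2 * C * c4\<^sup>2 * D\<^sup>2 * m + K2 * c1 * c4 * D\<^sup>2 * m < m" by (simp add: c5_def algebra_simps)
      with 1 2 show ?thesis by (simp add: inner_diff_left)
    qed
    have "cv q0 \<bullet> q 0 < cv q0 \<bullet> q D"
    proof (rule DERIV_pos_imp_increasing_open[OF D0])
      fix x assume x: "0 < x" "x < D"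
      then have xs: "x \<in> {0..D}" "at x within {0..D} = at x" by (auto simp: at_within_Icc_at)
      have "((\<lambda>s. cv q0 \<bullet> q s) has_vector_derivative cv q0 \<bullet> v i x) (at x)"
        using bounded_linear.has_vector_derivative[OF bounded_linear_inner_right qv[OF xs(1)]] xs(2) by simp
      then show "\<exists>d. ((\<lambda>s. cv q0 \<bullet> q s) has_real_derivative d) (at x) \<and> 0 < d"
        using pos[OF xs(1)] has_real_derivative_iff_has_vector_derivative by blast
    next
      show "continuous_on {0..D} (\<lambda>s. cv q0 \<bullet> q s)"
        by (intro continuous_on_inner continuous_on_const continuous_on_vector_derivative[OF qv])
    qed
    then show False using q_ends by simp
  qed
  with that[OF \<delta>(1)] show thesis by blast
qed

end


subsection \<open>Passage to the limit\<close>

lemma uniform_limit_vector_derivative: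
  fixes f :: "nat \<Rightarrow> real \<Rightarrow> 'v::banach"
  assumes f: "\<And>n x. x \<in> {a..b} \<Longrightarrow> (f n has_vector_derivative f' n x) (at x within {a..b})"
    and f': "\<And>e. 0 < e \<Longrightarrow> \<exists>N. \<forall>n\<ge>N. \<forall>x\<in>{a..b}. norm (f' n x - g' x) < e"
    and g: "\<And>x. x \<in> {a..b} \<Longrightarrow> (\<lambda>n. f n x) \<longlonglongrightarrow> g x" and x: "x \<in> {a..b}"
  shows "(g has_vector_derivative g' x) (at x within {a..b})"
proof -
  have "\<exists>h. \<forall>x\<in>{a..b}. (\<lambda>n. f n x) \<longlonglongrightarrow> h x \<and> (h has_derivative (\<lambda>t. t *\<^sub>R g' x)) (at x within {a..b})"
  proof (rule has_derivative_sequence[where f=f and f'="\<lambda>n x t. t *\<^sub>R f' n x" and ?x0.0=x and l="g x"])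
    show "convex {a..b}" "x \<in> {a..b}" "(\<lambda>n. f n x) \<longlonglongrightarrow> g x"
      using x g[OF x] by (simp_all add: convex_real_interval)
    show "(f n has_derivative (\<lambda>t. t *\<^sub>R f' n x)) (at x within {a..b})" if "x \<in> {a..b}" for n x
      using f[OF that] by (simp add: has_vector_derivative_def)
    fix e :: real assume "0 < e"
    then obtain N where N: "\<forall>n\<ge>N. \<forall>x\<in>{a..b}. norm (f' n x - g' x) < e" using f' by blast
    have "norm (t *\<^sub>R f' n x - t *\<^sub>R g' x) \<le> e * norm t" if "n \<ge> N" "x \<in> {a..b}" for n x t
      using mult_left_mono[of "norm (f' n x - g' x)" e "norm t"] N that
      by (simp add: scaleR_diff_right[symmetric] less_imp_le mult.commute)
    then show "\<forall>\<^sub>F n in sequentially. \<forall>x\<in>{a..b}. \<forall>t. norm (t *\<^sub>R f' n x - t *\<^sub>R g' x) \<le> e * norm t"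
      unfolding eventually_sequentially by blast
  qed
  then obtain h where "\<forall>x\<in>{a..b}. (\<lambda>n. f n x) \<longlonglongrightarrow> h x \<and> (h has_derivative (\<lambda>t. t *\<^sub>R g' x)) (at x within {a..b})"
    by blast
  then have h: "\<And>x. x \<in> {a..b} \<Longrightarrow> (\<lambda>n. f n x) \<longlonglongrightarrow> h x"
    "\<And>x. x \<in> {a..b} \<Longrightarrow> (h has_vector_derivative g' x) (at x within {a..b})"
    by (simp_all add: has_vector_derivative_def)
  have "g z = h z" if "z \<in> {a..b}" for z using LIMSEQ_unique[OF g[OF that] h(1)[OF that]] .
  then show ?thesis using has_vector_derivative_transform[OF x _ h(2)[OF x]] by simp
qed

context stationary
begin

text \<open>\<open>\<xi>\<close> is the coordinate velocity of the curve with components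
  \<open>Y\<close> and \<open>H\<close>. The data are local because C^1 convergence is extracted
  chart by chart, along subsequences that depend on the point; the germs fit together since they
  describe the same curve.\<close>

definition null_germ :: "'i \<Rightarrow> (real \<Rightarrow> 'a) \<Rightarrow> (real \<Rightarrow> real) \<Rightarrow> real set \<Rightarrow> (real \<Rightarrow> 'e \<times> real) \<Rightarrow> bool" where
  "null_germ i Y H I \<xi> \<longleftrightarrow> (\<forall>k. path_Ck k I \<xi>) \<and> (\<forall>s\<in>I. Y s \<in> chart_dom A i \<and>
     ((\<lambda>s. (chart A i (Y s), H s)) has_vector_derivative \<xi> s) (at s within I) \<and> 0 < snd (\<xi> s) \<and>
     M i (chart A i (Y s)) (\<xi> s) (\<xi> s) = 0 \<and>
     (\<exists>\<alpha>. (\<xi> has_vector_derivative \<alpha>) (at s within I) \<and>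
        (\<forall>w. M i (chart A i (Y s)) \<alpha> w + DM i (chart A i (Y s)) (fst (\<xi> s)) (\<xi> s) w
             - DM i (chart A i (Y s)) (fst w) (\<xi> s) (\<xi> s) / 2 = 0)))"

text \<open>The geodesic equation in the form \<open>d/ds g(z', w) = (D\<^sub>w g)(z', z') / 2\<close> survives the \<open>C\<^sup>1\<close> limit;
  smoothness of the limit is then recovered by solving for \<open>z'\<close>.\<close>

lemma momentum_equation_regularity:
  assumes i: "i \<in> index A" and ab: "a < b"
    and Y: "\<And>s. s \<in> {a..b} \<Longrightarrow> Y s \<in> chart_dom A i"
    and \<xi>: "\<And>s. s \<in> {a..b} \<Longrightarrow> ((\<lambda>s. (chart A i (Y s), H s)) has_vector_derivative \<xi> s) (at s within {a..b})"
    and cont: "continuous_on {a..b} \<xi>"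
    and P: "\<And>s w. s \<in> {a..b} \<Longrightarrow> ((\<lambda>s. M i (chart A i (Y s)) (\<xi> s) w) has_vector_derivative
              DM i (chart A i (Y s)) (fst w) (\<xi> s) (\<xi> s) / 2) (at s within {a..b})"
    and pos: "\<And>s. s \<in> {a..b} \<Longrightarrow> 0 < snd (\<xi> s)"
    and null: "\<And>s. s \<in> {a..b} \<Longrightarrow> M i (chart A i (Y s)) (\<xi> s) (\<xi> s) = 0"
  shows "null_germ i Y H {a..b} \<xi>"
proof -
  let ?J = "{a..b}" and ?q = "\<lambda>s. chart A i (Y s)"
  have qX: "?q s \<in> X i" if "s \<in> ?J" for s using Y[OF that] by blast
  then have qX': "?q ` ?J \<subseteq> X i" by blast
  have q: "(?q has_vector_derivative fst (\<xi> s)) (at s within ?J)" if "s \<in> ?J" for s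
    using bounded_linear.has_vector_derivative[OF bounded_linear_fst \<xi>[OF that]] by simp
  \<comment> \<open>Each step gains one order: if \<xi> is C^k, then \<open>?q\<close> and with it
    the coefficients are C^(k+1), and the momenta are C^(k+1) because their derivatives are C^k.
    Solving for \<xi> transfers this to \<xi>.\<close>
  have smooth: "path_Ck k ?J \<xi>" for k
  proof (induction k)
    case 0
    then show ?case using cont by simp
  next
    case (Suc k)
    have qk: "path_Ck (Suc k) ?J ?q"
      using q path_Ck_linear[OF bounded_linear_fst Suc] by (auto intro!: exI[of _ "\<lambda>s. fst (\<xi> s)"])
    show ?case
    proof (rule path_Ck_solve[where m="\<lambda>s. M i (?q s)"])
      fix w :: "'e \<times> real"
      have "path_Ck k ?J (\<lambda>s. DM i (?q s) (fst w) (\<xi> s) (\<xi> s))"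
        by (rule path_Ck_bilinear[where m="\<lambda>s. DM i (?q s) (fst w)", OF DM_bilinear[OF i qX]
            path_Ck_M(2)[OF i path_Ck_SucD[OF qk] qX'] Suc Suc])
      from path_Ck_mult[OF this path_Ck_const[of k ?J "1 / 2"]]
      have "path_Ck k ?J (\<lambda>s. DM i (?q s) (fst w) (\<xi> s) (\<xi> s) / 2)" by simp
      then show "path_Ck (Suc k) ?J (\<lambda>s. M i (?q s) (\<xi> s) w)"
        unfolding path_Ck.simps
        by (intro exI[of _ "\<lambda>s. DM i (?q s) (fst w) (\<xi> s) (\<xi> s) / 2"] conjI ballI P)
    next
      show "u = 0" if "s \<in> ?J" "\<And>w. M i (?q s) u w = 0" for s u
        using M_nondegenerate[OF i qX[OF that(1)], of 0 u] that(2) by simp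
    qed (intro M_bilinear[OF i qX] path_Ck_M(1)[OF i qk qX'] | assumption)+
  qed
  have "path_Ck (Suc 0) ?J \<xi>" by (rule smooth)
  then obtain \<alpha> where \<alpha>: "\<And>s. s \<in> ?J \<Longrightarrow> (\<xi> has_vector_derivative \<alpha> s) (at s within ?J)"
    unfolding path_Ck.simps by blast
  \<comment> \<open>Once \<xi> is differentiable, the product rule and the momentum equation compute
    the same derivative.\<close>
  have eq: "M i (?q s) (\<alpha> s) w + DM i (?q s) (fst (\<xi> s)) (\<xi> s) w
      - DM i (?q s) (fst w) (\<xi> s) (\<xi> s) / 2 = 0" if s: "s \<in> ?J" for s w
  proof -
    have "\<forall>\<^sub>F r in at s within ?J. ?q r \<in> X i" using qX by (auto simp: eventually_at_filter)
    from has_vector_derivative_M[OF i s qX[OF s] q[OF s] \<alpha>[OF s] this, of w]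
    have "M i (?q s) (\<alpha> s) w + DM i (?q s) (fst (\<xi> s)) (\<xi> s) w = DM i (?q s) (fst w) (\<xi> s) (\<xi> s) / 2"
      by (rule vector_derivative_unique_within[OF at_within_Icc_not_bot[OF ab s] _ P[OF s]])
    then show ?thesis by simp
  qed
  show ?thesis unfolding null_germ_def
    by (intro conjI allI ballI smooth Y \<xi> pos null) (use \<alpha> eq in blast)+
qed

lemma null_germ_subset:
  assumes "null_germ i Y H J \<xi>" "I = J \<inter> ball s e" "0 < e"
  shows "null_germ i Y H I \<xi>"
proof -
  have "at r within I = at r within J" if "r \<in> I" for r
    using at_within_Int_ball[OF assms(3), of r s J] that assms(2) by auto
  moreover have "I \<subseteq> J" using assms(2) by blast
  ultimately show ?thesis
    using assms(1) unfolding null_germ_def by (auto intro: path_Ck_subset)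
qed

text \<open>In a fixed chart positions and velocities are uniformly bounded and Lipschitz, so both
  converge along a further subsequence. Its dependence on \<open>s0\<close> is harmless: the limit
  of the positions is already known, and the limit of the velocities is its derivative.\<close>

lemma limit_null_germ:
  fixes y :: "nat \<Rightarrow> real \<Rightarrow> 'a"
  assumes n: "\<And>n. null_geodesic (\<epsilon> n) 0 1 (y n) (\<tau> n) (v n) (a n) (\<tau>1 n) (\<tau>2 n)"
    and e: "\<And>n. 0 < \<epsilon> n" "\<And>n. \<epsilon> n \<le> 1" "\<epsilon> \<longlonglongrightarrow> 0"
    and c: "0 < c" "\<And>n s. s \<in> {0..1} \<Longrightarrow> c \<le> \<tau>1 n s" "\<And>n s. s \<in> {0..1} \<Longrightarrow> \<tau>1 n s \<le> B"
    and Tb: "\<And>n s. s \<in> {0..1} \<Longrightarrow> \<bar>\<tau> n s\<bar> \<le> Tb"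
    and Y: "\<And>s V. s \<in> {0..1} \<Longrightarrow> open V \<Longrightarrow> Y s \<in> V \<Longrightarrow>
        \<exists>\<delta>>0. \<exists>N. \<forall>n\<ge>N. \<forall>r\<in>{0..1}. \<bar>r - s\<bar> < \<delta> \<longrightarrow> y n r \<in> V"
    and H: "\<And>s. s \<in> {0..1} \<Longrightarrow> (\<lambda>n. \<tau> n s) \<longlonglongrightarrow> H s"
    and i: "i \<in> index A" and s0: "s0 \<in> {0..1}" "Y s0 \<in> chart_dom A i"
  obtains d \<xi> where "0 < d" "null_germ i Y H ({0..1} \<inter> ball s0 d) \<xi>"
proof -
  define q0 where "q0 = chart A i (Y s0)"
  obtain r where "0 < r" "cball (chart A i (Y s0)) r \<subseteq> X i"
    by (rule chart_neighbourhood[OF open_UNIV UNIV_I i s0(2)]) (rule that)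
  then have r: "0 < r" "cball q0 r \<subseteq> X i" by (simp_all add: q0_def)
  obtain C where C: "chart_bound i (cball q0 r) C"
    using chart_bound_exists[OF i compact_cball r(2)] by blast
  have C1: "1 \<le> C" using C by (simp add: chart_bound_def)
  let ?V = "{x \<in> chart_dom A i. chart A i x \<in> ball q0 r}"
  have opV: "open ?V" by (rule open_chart_preimage[OF i open_ball])
  have "Y s0 \<in> ?V" using s0(2) r(1) by (simp add: q0_def)
  from Y[OF s0(1) opV this] obtain \<delta> N where \<delta>: "0 < \<delta>"
    and N': "\<forall>n\<ge>N. \<forall>r\<in>{0..1}. \<bar>r - s0\<bar> < \<delta> \<longrightarrow> y n r \<in> ?V"
    by (elim exE conjE)
  have N: "y n r \<in> ?V" if "n \<ge> N" "r \<in> {0..1}" "\<bar>r - s0\<bar> < \<delta>" for n r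
    using N' that by (simp only: simp_thms)
  define d where "d = \<delta> / 2"
  define \<alpha> where "\<alpha> = max 0 (s0 - d)"
  define \<beta> where "\<beta> = min 1 (s0 + d)"
  have d0: "0 < d" "d < \<delta>" using \<delta> by (auto simp: d_def)
  have ab: "\<alpha> < \<beta>" using s0(1) d0(1) by (auto simp: \<alpha>_def \<beta>_def)
  let ?J = "{\<alpha>..\<beta>}"
  have J: "s \<in> {0..1}" "\<bar>s - s0\<bar> < \<delta>" if "s \<in> ?J" for s
    using that d0 by (auto simp: \<alpha>_def \<beta>_def)
  have JI: "?J \<subseteq> {0..1}" using J(1) by blast
  \<comment> \<open>The shift by \<open>N\<close> discards the curves that may leave the chart ball
    over \<open>?J\<close>.\<close>
  define Z where "Z = (\<lambda>n s. (chart A i (y (n + N) s), \<tau> (n + N) s))"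
  define Z1 where "Z1 = (\<lambda>n s. (v (n + N) i s, \<tau>1 (n + N) s))"
  define Z2 where "Z2 = (\<lambda>n s. (a (n + N) i s, \<tau>2 (n + N) s))"
  have yV: "y (n + N) s \<in> chart_dom A i" "fst (Z n s) \<in> cball q0 r" if "s \<in> ?J" for n s
    using N[OF _ J[OF that], of "n + N"] by (auto simp: Z_def)
  have c': "0 < \<tau>1 n s" if "s \<in> {0..1}" for n s using c(1) c(2)[OF that, of n] by linarith
  define B1 where "B1 = (C + 1) * B"
  define B2 where "B2 = 2 * C\<^sup>2 * (C + 1)\<^sup>2 * B\<^sup>2"
  have Z1b: "norm (Z1 n s) \<le> B1" and Z2b: "norm (Z2 n s) \<le> B2" if s: "s \<in> ?J" for n s
  proof -
    note acc = null_geodesic_acceleration[OF n less_imp_le[OF e(1)] e(2) C J(1)[OF s] i yV(1)[OF s]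
        yV(2)[OF s, unfolded Z_def fst_conv]]
    have "norm (Z1 n s) \<le> norm (v (n + N) i s) + \<bar>\<tau>1 (n + N) s\<bar>"
      using norm_Pair_le[of "v (n + N) i s" "\<tau>1 (n + N) s"] by (simp add: Z1_def)
    also have "\<dots> \<le> (C + 1) * \<tau>1 (n + N) s" using acc(1)[of n] c'[OF J(1)[OF s], of "n + N"] by (simp add: algebra_simps)
    also have "\<dots> \<le> B1" unfolding B1_def using c(3)[OF J(1)[OF s]] C1 by (intro mult_left_mono) auto
    finally show "norm (Z1 n s) \<le> B1" .
    have "norm (Z2 n s) \<le> 2 * C\<^sup>2 * (C + 1)\<^sup>2 * (\<tau>1 (n + N) s)\<^sup>2" using acc(2)[of n] by (simp add: Z2_def)
    also have "\<dots> \<le> B2" unfolding B2_def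
      using c(3)[OF J(1)[OF s]] c'[OF J(1)[OF s], of "n + N"] by (intro mult_left_mono power_mono) auto
    finally show "norm (Z2 n s) \<le> B2" .
  qed
  have dZ: "(Z n has_vector_derivative Z1 n s) (at s within ?J)"
    and dZ1: "(Z1 n has_vector_derivative Z2 n s) (at s within ?J)" if s: "s \<in> ?J" for n s
  proof -
    show "(Z n has_vector_derivative Z1 n s) (at s within ?J)" unfolding Z_def Z1_def
      by (intro has_vector_derivative_within_subset[OF _ JI] has_vector_derivative_Pair
          null_geodesicD(4,6)[OF n] J(1)[OF s] i yV[OF s])
    show "(Z1 n has_vector_derivative Z2 n s) (at s within ?J)" unfolding Z1_def Z2_def
      by (intro has_vector_derivative_within_subset[OF _ JI] has_vector_derivative_Pair
          null_geodesicD(5,7)[OF n] J(1)[OF s] i yV[OF s])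
  qed
  \<comment> \<open>A compact set containing all positions and velocities. Continuity of
    \<open>M\<close> on it gives convergence of the momenta, uniform continuity of \<open>DM\<close>
    the uniform convergence of their derivatives.\<close>
  define S where "S = (cball q0 r \<times> cball (0::real) Tb) \<times> cball (0 :: 'e \<times> real) B1"
  have compS: "compact S" unfolding S_def by (intro compact_Times compact_cball)
  have ZS: "(Z n s, Z1 n s) \<in> S" if "s \<in> ?J" for n s
    using yV(2)[OF that, of n] Tb[OF J(1)[OF that], of "n + N"] Z1b[OF that, of n]
    by (simp add: S_def mem_Times_iff Z_def del: mem_cball)
  obtain Mb where Mb: "\<And>z. z \<in> S \<Longrightarrow> norm z \<le> Mb"
    using compact_imp_bounded[OF compS] by (auto simp: bounded_iff)
  have B12: "0 \<le> B1" "0 \<le> B2"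
    using order_trans[OF norm_ge_zero Z1b[of \<alpha> 0]] order_trans[OF norm_ge_zero Z2b[of \<alpha> 0]] ab by simp_all
  have equi: "norm ((Z n x, Z1 n x) - (Z n z, Z1 n z)) \<le> (B1 + B2) * \<bar>x - z\<bar>"
    if "x \<in> ?J" "z \<in> ?J" for n x z
  proof -
    have "norm ((Z n x, Z1 n x) - (Z n z, Z1 n z)) \<le> norm (Z n x - Z n z) + norm (Z1 n x - Z1 n z)"
      using norm_Pair_le[of "Z n x - Z n z" "Z1 n x - Z1 n z"] by simp
    also have "\<dots> \<le> B1 * \<bar>x - z\<bar> + B2 * \<bar>x - z\<bar>"
      by (intro add_mono vector_derivative_bound[OF dZ Z1b that] vector_derivative_bound[OF dZ1 Z2b that])
    finally show ?thesis by (simp add: distrib_right)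
  qed
  obtain g k where g: "continuous_on ?J g" "strict_mono (k :: nat \<Rightarrow> nat)"
    and gk: "\<And>e. 0 < e \<Longrightarrow> \<exists>N. \<forall>n x. n \<ge> N \<and> x \<in> ?J \<longrightarrow> norm ((Z (k n) x, Z1 (k n) x) - g x) < e"
  proof (rule Arzela_Ascoli[of ?J "\<lambda>n s. (Z n s, Z1 n s)" Mb])
    show "norm (Z n x, Z1 n x) \<le> Mb" if "x \<in> ?J" for n x using Mb ZS that by blast
    fix x and e' :: real assume x: "x \<in> ?J" "0 < e'"
    show "\<exists>d>0. \<forall>n z. z \<in> ?J \<and> norm (x - z) < d \<longrightarrow> norm ((Z n x, Z1 n x) - (Z n z, Z1 n z)) < e'"
    proof (intro exI[of _ "e' / (B1 + B2 + 1)"] conjI allI impI)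
      show "0 < e' / (B1 + B2 + 1)" using x(2) B12 by simp
      fix n z assume z: "z \<in> ?J \<and> norm (x - z) < e' / (B1 + B2 + 1)"
      have "norm ((Z n x, Z1 n x) - (Z n z, Z1 n z)) \<le> (B1 + B2) * \<bar>x - z\<bar>" using equi x(1) z by blast
      also have "\<dots> \<le> (B1 + B2 + 1) * \<bar>x - z\<bar>" by (intro mult_right_mono) auto
      also have "\<dots> < e'" using z B12 by (simp add: pos_less_divide_eq mult.commute)
      finally show "norm ((Z n x, Z1 n x) - (Z n z, Z1 n z)) < e'" .
    qed
  qed (simp_all add: that)
  define \<xi> where "\<xi> = (\<lambda>s. snd (g s))"
  have glim: "(\<lambda>n. (Z (k n) s, Z1 (k n) s)) \<longlonglongrightarrow> g s" if "s \<in> ?J" for s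
    unfolding LIMSEQ_iff using gk that by blast
  have gS: "g s \<in> S" if "s \<in> ?J" for s
    using Lim_in_closed_set[OF compact_imp_closed[OF compS] _ _ glim[OF that]] ZS[OF that] by simp
  have kN: "filterlim (\<lambda>n. k n + N) sequentially sequentially"
    using filterlim_compose[OF filterlim_add_const_nat_at_top filterlim_subseq[OF g(2)]] by simp
  have Ydom: "Y s \<in> chart_dom A i" and gz: "fst (g s) = (chart A i (Y s), H s)" if s: "s \<in> ?J" for s
  proof -
    have "(\<lambda>n. y n s) \<longlonglongrightarrow> Y s"
    proof (rule topological_tendstoI)
      fix V assume "open V" "Y s \<in> V"
      then obtain \<delta> N where "0 < \<delta>" "\<forall>n\<ge>N. \<forall>r\<in>{0..1}. \<bar>r - s\<bar> < \<delta> \<longrightarrow> y n r \<in> V"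
        using Y[OF J(1)[OF s]] by blast
      then show "\<forall>\<^sub>F n in sequentially. y n s \<in> V"
        using J(1)[OF s] unfolding eventually_sequentially by (intro exI[of _ N]) auto
    qed
    then have yl: "(\<lambda>n. y (k n + N) s) \<longlonglongrightarrow> Y s" by (rule filterlim_compose[OF _ kN])
    have "closed (chart_inv A i ` cball q0 r)"
      by (intro compact_imp_closed compact_chart_inv_image i compact_cball r)
    moreover have "y (k n + N) s \<in> chart_inv A i ` cball q0 r" for n
      using yV[OF s, of "k n"] chart_inv_chart[OF i, of "y (k n + N) s"] unfolding Z_def
      by (metis fst_conv image_eqI)
    ultimately have "Y s \<in> chart_inv A i ` cball q0 r"
      using Lim_in_closed_set[OF _ _ _ yl] by simp
    then obtain z where z: "Y s = chart_inv A i z" "z \<in> cball q0 r" by (rule imageE)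
    show Yd: "Y s \<in> chart_dom A i" unfolding z(1) by (rule chart_inv_in_dom[OF i subsetD[OF r(2) z(2)]])
    have "(\<lambda>n. chart A i (y (k n + N) s)) \<longlonglongrightarrow> chart A i (Y s)"
      by (rule continuous_on_tendsto_compose[OF continuous_chart[OF i] yl Yd]) (simp add: yV[OF s])
    moreover have "(\<lambda>n. \<tau> (k n + N) s) \<longlonglongrightarrow> H s" by (rule filterlim_compose[OF H[OF J(1)[OF s]] kN])
    ultimately have "(\<lambda>n. Z (k n) s) \<longlonglongrightarrow> (chart A i (Y s), H s)"
      unfolding Z_def by (rule tendsto_Pair)
    moreover have "(\<lambda>n. Z (k n) s) \<longlonglongrightarrow> fst (g s)" using tendsto_fst[OF glim[OF s]] by simp
    ultimately show "fst (g s) = (chart A i (Y s), H s)" using LIMSEQ_unique by blast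
  qed
  have g_eq: "g s = ((chart A i (Y s), H s), \<xi> s)" if "s \<in> ?J" for s
    using gz[OF that] by (simp add: \<xi>_def prod_eq_iff)
  have clim: "(\<lambda>n. \<Psi> (Z (k n) s, Z1 (k n) s)) \<longlonglongrightarrow> \<Psi> ((chart A i (Y s), H s), \<xi> s)"
    if "continuous_on S \<Psi>" "s \<in> ?J" for s and \<Psi> :: "('e \<times> real) \<times> ('e \<times> real) \<Rightarrow> real"
    using continuous_on_tendsto_compose[OF that(1) glim[OF that(2)] gS[OF that(2)]] ZS[OF that(2)]
      g_eq[OF that(2)] by simp
  have SX: "fst (fst z) \<in> X i" if "z \<in> S" for z using that r(2) by (auto simp: S_def mem_Times_iff)
  have contz: "continuous_on S (\<lambda>z. fst (fst z))" "continuous_on S snd" by (intro continuous_intros)+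
  have imX: "(\<lambda>z. fst (fst z)) ` S \<subseteq> X i" using SX by blast
  have contM: "continuous_on S (\<lambda>z. M i (fst (fst z)) (snd z) w)" for w
    by (rule continuous_on_M_joint[OF i contz continuous_on_const imX])
  have contMM: "continuous_on S (\<lambda>z. M i (fst (fst z)) (snd z) (snd z))"
    by (rule continuous_on_M_joint[OF i contz contz(2) imX])
  have "continuous_on S (\<lambda>z. DM i (fst (fst z)) (fst w) (snd z) (snd z) * (1 / 2))" for w :: "'e \<times> real"
    by (rule continuous_on_mult_right[OF continuous_on_DM_joint[OF i contz contz(2) imX]])
  then have contD: "continuous_on S (\<lambda>z. DM i (fst (fst z)) (fst w) (snd z) (snd z) / 2)" for w :: "'e \<times> real"
    by simp
  have elim: "(\<lambda>n. \<epsilon> (k n + N)) \<longlonglongrightarrow> 0" by (rule filterlim_compose[OF e(3) kN])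
  have null: "null_germ i Y H ?J \<xi>"
  proof (rule momentum_equation_regularity[OF i ab Ydom])
    show "continuous_on ?J \<xi>" unfolding \<xi>_def using g(1) by (rule continuous_on_snd)
    fix s assume s: "s \<in> ?J"
    show "((\<lambda>s. (chart A i (Y s), H s)) has_vector_derivative \<xi> s) (at s within ?J)"
    proof (rule uniform_limit_vector_derivative[where f="\<lambda>n. Z (k n)" and f'="\<lambda>n. Z1 (k n)"])
      show "(\<lambda>n. Z (k n) s) \<longlonglongrightarrow> (chart A i (Y s), H s)" if "s \<in> ?J" for s
        using tendsto_fst[OF glim[OF that]] gz[OF that] by simp
      fix e' :: real assume "0 < e'"
      then obtain N' where N': "\<forall>n x. n \<ge> N' \<and> x \<in> ?J \<longrightarrow> norm ((Z (k n) x, Z1 (k n) x) - g x) < e'"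
        using gk by blast
      have "norm (Z1 (k n) x - \<xi> x) \<le> norm ((Z (k n) x, Z1 (k n) x) - g x)" for n x
        using norm_snd_le[of "Z1 (k n) x - snd (g x)" "Z (k n) x - fst (g x)"]
        unfolding \<xi>_def by (cases "g x") simp
      then show "\<exists>N. \<forall>n\<ge>N. \<forall>x\<in>?J. norm (Z1 (k n) x - \<xi> x) < e'"
        using N' by (meson order_le_less_trans)
    qed (use dZ s in auto)
    show "((\<lambda>s. M i (chart A i (Y s)) (\<xi> s) w) has_vector_derivative
        DM i (chart A i (Y s)) (fst w) (\<xi> s) (\<xi> s) / 2) (at s within ?J)" for w
    proof (rule uniform_limit_vector_derivative[where
          f="\<lambda>n s. M i (fst (Z (k n) s)) (Z1 (k n) s) w - \<epsilon> (k n + N) * (\<tau>1 (k n + N) s * snd w)" and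
          f'="\<lambda>n s. DM i (fst (Z (k n) s)) (fst w) (Z1 (k n) s) (Z1 (k n) s) / 2"])
      show "((\<lambda>s. M i (fst (Z (k n) s)) (Z1 (k n) s) w - \<epsilon> (k n + N) * (\<tau>1 (k n + N) s * snd w))
          has_vector_derivative DM i (fst (Z (k n) s)) (fst w) (Z1 (k n) s) (Z1 (k n) s) / 2) (at s within ?J)"
        if s: "s \<in> ?J" for n s
        using has_vector_derivative_within_subset[OF null_geodesic_momentum[OF n J(1)[OF s] i yV(1)[OF s], where w=w] JI]
        by (simp add: Z_def Z1_def)
      show "(\<lambda>n. M i (fst (Z (k n) s)) (Z1 (k n) s) w - \<epsilon> (k n + N) * (\<tau>1 (k n + N) s * snd w))
          \<longlonglongrightarrow> M i (chart A i (Y s)) (\<xi> s) w" if s: "s \<in> ?J" for s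
      proof -
        have "(\<lambda>n. \<tau>1 (k n + N) s) \<longlonglongrightarrow> snd (\<xi> s)"
          using tendsto_snd[OF tendsto_snd[OF glim[OF s]]] by (simp add: Z1_def \<xi>_def)
        then have "(\<lambda>n. M i (fst (Z (k n) s)) (Z1 (k n) s) w - \<epsilon> (k n + N) * (\<tau>1 (k n + N) s * snd w))
          \<longlonglongrightarrow> M i (chart A i (Y s)) (\<xi> s) w - 0 * (snd (\<xi> s) * snd w)"
          using clim[OF contM s, of w] by (intro tendsto_intros elim) simp_all
        then show ?thesis by simp
      qed
      fix e' :: real assume "0 < e'"
      let ?\<Psi> = "\<lambda>z. DM i (fst (fst z)) (fst w) (snd z) (snd z) / 2"
      have "uniformly_continuous_on S ?\<Psi>" by (rule compact_uniformly_continuous[OF contD compS])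
      then obtain d' where d': "0 < d'" "\<And>z z'. z \<in> S \<Longrightarrow> z' \<in> S \<Longrightarrow> dist z' z < d' \<Longrightarrow> dist (?\<Psi> z') (?\<Psi> z) < e'"
        using \<open>0 < e'\<close> unfolding uniformly_continuous_on_def by meson
      obtain N' where N': "\<And>n x. n \<ge> N' \<Longrightarrow> x \<in> ?J \<Longrightarrow> norm ((Z (k n) x, Z1 (k n) x) - g x) < d'"
        using gk[OF d'(1)] by blast
      have "norm (?\<Psi> (Z (k n) x, Z1 (k n) x) - ?\<Psi> ((chart A i (Y x), H x), \<xi> x)) < e'"
        if "n \<ge> N'" "x \<in> ?J" for n x
        using d'(2)[OF gS[OF that(2)] ZS[OF that(2)], of "k n"] N'[OF that] g_eq[OF that(2)]
        by (simp add: dist_norm)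
      then show "\<exists>N'. \<forall>n\<ge>N'. \<forall>x\<in>?J. norm (DM i (fst (Z (k n) x)) (fst w) (Z1 (k n) x) (Z1 (k n) x) / 2
          - DM i (chart A i (Y x)) (fst w) (\<xi> x) (\<xi> x) / 2) < e'"
        by (intro exI[of _ N']) simp
    qed (rule s)
    have t1: "(\<lambda>n. \<tau>1 (k n + N) s) \<longlonglongrightarrow> snd (\<xi> s)"
      using tendsto_snd[OF tendsto_snd[OF glim[OF s]]] by (simp add: Z1_def \<xi>_def)
    \<comment> \<open>The uniform lower bound on the time speed keeps the limit velocity from
      degenerating.\<close>
    then have "c \<le> snd (\<xi> s)" by (rule LIMSEQ_le_const) (use c(2) J(1)[OF s] in blast)
    then show "0 < snd (\<xi> s)" using c(1) by linarith
    have "(\<lambda>n. M i (fst (Z (k n) s)) (Z1 (k n) s) (Z1 (k n) s)) \<longlonglongrightarrow> M i (chart A i (Y s)) (\<xi> s) (\<xi> s)"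
      using clim[OF contMM s] by simp
    moreover have "M i (fst (Z (k n) s)) (Z1 (k n) s) (Z1 (k n) s) = \<epsilon> (k n + N) * (\<tau>1 (k n + N) s)\<^sup>2" for n
      using null_geodesicD(8)[OF n J(1)[OF s] i yV(1)[OF s]] by (simp add: Z_def Z1_def)
    ultimately have "(\<lambda>n. \<epsilon> (k n + N) * (\<tau>1 (k n + N) s)\<^sup>2) \<longlonglongrightarrow> M i (chart A i (Y s)) (\<xi> s) (\<xi> s)" by simp
    moreover have "(\<lambda>n. \<epsilon> (k n + N) * (\<tau>1 (k n + N) s)\<^sup>2) \<longlonglongrightarrow> 0 * (snd (\<xi> s))\<^sup>2"
      by (intro tendsto_intros elim t1)
    ultimately show "M i (chart A i (Y s)) (\<xi> s) (\<xi> s) = 0" using LIMSEQ_unique by fastforce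
  qed
  have "{0..1} \<inter> ball s0 d = ?J \<inter> ball s0 d" by (auto simp: \<alpha>_def \<beta>_def dist_real_def)
  from that[OF d0(1) null_germ_subset[OF null this d0(1)]] show thesis .
qed

end


subsection \<open>From local data to the limit pregeodesic\<close>

text \<open>Compactness of the interval makes the inverse continuous, so the difference quotients of
  \<open>H\<close> can be substituted; the derivatives may be one-sided.\<close>

lemma inverse_has_vector_derivative:
  fixes H :: "real \<Rightarrow> real"
  assumes cont: "continuous_on {a..b} H" and inv: "\<And>s. s \<in> {a..b} \<Longrightarrow> g (H s) = s"
    and s: "s \<in> {a..b}" and H: "(H has_vector_derivative D) (at s within {a..b})" "D \<noteq> 0"
  shows "(g has_vector_derivative 1 / D) (at (H s) within H ` {a..b})"
proof (rule has_vector_derivative_quotientI)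
  let ?F = "at (H s) within H ` {a..b}"
  have "continuous_on (H ` {a..b}) g"
    using inv by (intro continuous_on_inv[OF cont compact_Icc]) auto
  then have "(g \<longlongrightarrow> g (H s)) ?F"
    using s unfolding continuous_on_def by blast
  then have "(g \<longlongrightarrow> s) ?F" using inv[OF s] by simp
  moreover have "\<forall>\<^sub>F t in ?F. g t \<in> {a..b} \<and> g t \<noteq> s"
    unfolding eventually_at_filter by (rule always_eventually) (use inv in auto)
  ultimately have g: "filterlim g (at s within {a..b}) ?F"
    by (auto simp: filterlim_at elim: eventually_mono)
  have "((\<lambda>u. (H u - H s) / (u - s)) \<longlongrightarrow> D) (at s within {a..b})"
    using H(1) by (simp add: has_real_derivative_iff_has_vector_derivative[symmetric] has_field_derivative_iff)
  then have "((\<lambda>u. 1 / ((H u - H s) / (u - s))) \<longlongrightarrow> 1 / D) (at s within {a..b})"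
    using H(2) by (intro tendsto_intros)
  from filterlim_compose[OF this g]
  have "((\<lambda>t. 1 / ((H (g t) - H s) / (g t - s))) \<longlongrightarrow> 1 / D) ?F" .
  moreover have "\<forall>\<^sub>F t in ?F. 1 / ((H (g t) - H s) / (g t - s)) = (g t - g (H s)) /\<^sub>R (t - H s)"
    unfolding eventually_at_filter
    by (rule always_eventually) (use inv s in \<open>auto simp: divide_inverse mult.commute\<close>)
  ultimately show "((\<lambda>t. (g t - g (H s)) /\<^sub>R (t - H s)) \<longlongrightarrow> 1 / D) ?F"
    by (rule Lim_transform_eventually)
qed

context stationary
begin

lemma null_germ_path_Ck:
  assumes "null_germ i Y H I \<xi>"
  shows "path_Ck k I (\<lambda>s. (chart A i (Y s), H s))"
  by (rule path_Ck_SucD) (use assms in \<open>auto simp: null_germ_def\<close>)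

text \<open>Smoothness and the geodesic equation are local, and by uniqueness of derivatives each
  \<xi> is the velocity of the one curve \<Gamma> near its point. \<Gamma> is kept apart from the
  pair so that it can be a composition as in \<open>lightlike_pregeodesic\<close>.\<close>

lemma lightlike_geodesic_of_germs:
  assumes Y: "continuous_on {0..1} Y"
    and germ: "\<And>i s. i \<in> index A \<Longrightarrow> s \<in> {0..1} \<Longrightarrow> Y s \<in> chart_dom A i \<Longrightarrow>
      \<exists>d>0. \<exists>\<xi>. null_germ i Y H ({0..1} \<inter> ball s d) \<xi>"
    and \<Gamma>: "\<And>s. s \<in> {0..1} \<Longrightarrow> \<Gamma> s = (Y s, H s)"
  shows "smooth_path {0..1} H"
    and "\<And>s. s \<in> {0..1} \<Longrightarrow> 0 < vector_derivative H (at s within {0..1})"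
    and "lightlike_geodesic (times_line A) (lorentz_metric g\<^sub>0 \<omega> \<Lambda> 0) {0..1} \<Gamma>"
proof -
  let ?J = "{0..1::real}" and ?T = "times_line A"
  have bot: "at s within ?J \<noteq> bot" if "s \<in> ?J" for s by (rule at_within_Icc_not_bot[OF zero_less_one that])
  have loc: "at r within (?J \<inter> ball s d) = at r within ?J" if "0 < d" "r \<in> ?J \<inter> ball s d" for r s d
    using at_within_Int_ball[OF that(1), of r s ?J] that(2) by blast
  have chart_at_germ: "\<exists>i d \<xi>. i \<in> index A \<and> 0 < d \<and> null_germ i Y H (?J \<inter> ball s d) \<xi>" if "s \<in> ?J" for s
    using germ[OF chart_at(1) that chart_at(2)] chart_at(1) by blast
  show "smooth_path ?J H"
  proof (rule smooth_path_local[OF bot])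
    fix t assume "t \<in> ?J"
    then obtain i d \<xi> where d: "0 < d" "null_germ i Y H (?J \<inter> ball t d) \<xi>" using chart_at_germ by blast
    have "path_Ck k (?J \<inter> ball t d) H" for k
      using path_Ck_linear[OF bounded_linear_snd null_germ_path_Ck[OF d(2)]] by simp
    then show "\<exists>e>0. \<forall>k. path_Ck k (?J \<inter> ball t e) H" using d(1) by blast
  qed
  have H': "(H has_vector_derivative snd (\<xi> r)) (at r within ?J)"
    if "0 < d" "null_germ i Y H (?J \<inter> ball s d) \<xi>" "r \<in> ?J \<inter> ball s d" for i s d \<xi> r
  proof -
    have "((\<lambda>s. (chart A i (Y s), H s)) has_vector_derivative \<xi> r) (at r within ?J)"
      using that unfolding null_germ_def loc[OF that(1,3), symmetric] by blast
    from bounded_linear.has_vector_derivative[OF bounded_linear_snd this] show ?thesis by simp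
  qed
  show "0 < vector_derivative H (at s within ?J)" if s: "s \<in> ?J" for s
  proof -
    obtain i d \<xi> where d: "0 < d" "null_germ i Y H (?J \<inter> ball s d) \<xi>" using chart_at_germ[OF s] by blast
    then have ss: "s \<in> ?J \<inter> ball s d" using s by simp
    have "0 < snd (\<xi> s)" using d(2) ss by (simp add: null_germ_def)
    then show ?thesis using vector_derivative_within[OF bot[OF s] H'[OF d ss]] by simp
  qed
  have contG: "continuous_on ?J \<Gamma>"
  proof -
    have "continuous_on ?J H"
      using \<open>smooth_path ?J H\<close> smooth_path_imp_path_Ck path_Ck_continuous by blast
    with Y have "continuous_on ?J (\<lambda>s. (Y s, H s))" by (rule continuous_on_Pair)
    then show ?thesis by (rule continuous_on_eq) (simp add: \<Gamma>)
  qed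
  have sc: "smooth_curve ?T ?J \<Gamma>"
    unfolding smooth_curve_def
  proof (intro conjI contG ballI)
    fix i assume "i \<in> index ?T"
    then have i: "i \<in> index A" by simp
    define T where "T = {t \<in> ?J. \<Gamma> t \<in> chart_dom ?T i}"
    have T: "t \<in> ?J" "Y t \<in> chart_dom A i" if "t \<in> T" for t using that \<Gamma>[of t] by (auto simp: T_def)
    have "smooth_path T (\<lambda>t. (chart A i (Y t), H t))"
    proof (rule smooth_path_local)
      fix t assume t: "t \<in> T"
      obtain d \<xi> where d: "0 < d" "null_germ i Y H (?J \<inter> ball t d) \<xi>" using germ[OF i T[OF t]] by blast
      have "?J \<inter> ball t d \<subseteq> T" using d(2) \<Gamma> by (auto simp: T_def null_germ_def)
      then have "at t within T = at t within ?J"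
        by (rule at_within_subset_ball[OF d(1)]) (auto simp: T_def)
      then show "at t within T \<noteq> bot" using bot[OF T(1)[OF t]] by simp
      have "path_Ck k (T \<inter> ball t d) (\<lambda>t. (chart A i (Y t), H t))" for k
        by (rule path_Ck_subset[OF null_germ_path_Ck[OF d(2)]]) (auto simp: T_def)
      then show "\<exists>e>0. \<forall>k. path_Ck k (T \<inter> ball t e) (\<lambda>t. (chart A i (Y t), H t))" using d(1) by blast
    qed
    then obtain f where "\<forall>t\<in>T. f 0 t = (chart A i (Y t), H t) \<and>
        (\<forall>k. (f k has_vector_derivative f (Suc k) t) (at t within T))"
      unfolding smooth_path_def by blast
    moreover have "(chart A i (Y t), H t) = chart ?T i (\<Gamma> t)" if "t \<in> T" for t using \<Gamma> T(1)[OF that] by simp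
    ultimately have "smooth_path T (\<lambda>t. chart ?T i (\<Gamma> t))" unfolding smooth_path_def by (intro exI[of _ f]) simp
    then show "smooth_path {t \<in> ?J. \<Gamma> t \<in> chart_dom ?T i} (\<lambda>t. chart ?T i (\<Gamma> t))" by (simp only: T_def)
  qed
  have main: "lightlike (lorentz_metric g\<^sub>0 \<omega> \<Lambda> 0) i (\<Gamma> t) (velocity ?T i ?J \<Gamma> t) \<and>
      lorentz_metric g\<^sub>0 \<omega> \<Lambda> 0 i (\<Gamma> t) (vector_derivative (velocity ?T i ?J \<Gamma>) (at t within ?J)) w
      + christoffel ?T (lorentz_metric g\<^sub>0 \<omega> \<Lambda> 0) i (\<Gamma> t) (velocity ?T i ?J \<Gamma> t) (velocity ?T i ?J \<Gamma> t) w = 0"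
    if i: "i \<in> index A" and t: "t \<in> ?J" "Y t \<in> chart_dom A i" for i t w
  proof -
    obtain d \<xi> where d: "0 < d" and g: "null_germ i Y H (?J \<inter> ball t d) \<xi>" using germ[OF i t] by blast
    let ?I = "?J \<inter> ball t d" and ?q = "chart A i (Y t)"
    have tI: "t \<in> ?I" using t(1) d by simp
    have V: "velocity ?T i ?J \<Gamma> r = \<xi> r" if r: "r \<in> ?I" for r
    proof -
      have rJ: "r \<in> ?J" using r by blast
      have "((\<lambda>s. (chart A i (Y s), H s)) has_vector_derivative \<xi> r) (at r within ?J)"
        using g r unfolding null_germ_def loc[OF d r, symmetric] by blast
      then have "((\<lambda>s. chart ?T i (\<Gamma> s)) has_vector_derivative \<xi> r) (at r within ?J)"
        by (rule has_vector_derivative_transform[OF rJ, rotated]) (simp add: \<Gamma>)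
      then show ?thesis unfolding velocity_def by (rule vector_derivative_within[OF bot[OF rJ]])
    qed
    obtain \<alpha> where \<alpha>: "(\<xi> has_vector_derivative \<alpha>) (at t within ?I)"
      and eq: "\<And>w. M i ?q \<alpha> w + DM i ?q (fst (\<xi> t)) (\<xi> t) w - DM i ?q (fst w) (\<xi> t) (\<xi> t) / 2 = 0"
      using g tI unfolding null_germ_def by blast
    have "(velocity ?T i ?J \<Gamma> has_vector_derivative \<alpha>) (at t within ?I)"
      by (rule has_vector_derivative_transform[OF tI V \<alpha>])
    then have A: "vector_derivative (velocity ?T i ?J \<Gamma>) (at t within ?J) = \<alpha>"
      unfolding loc[OF d tI] by (rule vector_derivative_within[OF bot[OF t(1)]])
    have \<Gamma>t: "\<Gamma> t = (chart_inv A i ?q, H t)" using \<Gamma>[OF t(1)] chart_inv_chart[OF i t(2)] by simp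
    have "0 < snd (\<xi> t)" "M i ?q (\<xi> t) (\<xi> t) = 0" using g tI by (simp_all add: null_germ_def)
    then have "lightlike (lorentz_metric g\<^sub>0 \<omega> \<Lambda> 0) i (\<Gamma> t) (\<xi> t)"
      unfolding lightlike_def \<Gamma>t lorentz_metric_eq by auto
    moreover have "christoffel ?T (lorentz_metric g\<^sub>0 \<omega> \<Lambda> 0) i (\<Gamma> t) (\<xi> t) (\<xi> t) w
        = DM i ?q (fst (\<xi> t)) (\<xi> t) w - DM i ?q (fst w) (\<xi> t) (\<xi> t) / 2"
      using christoffel_eq[OF i t(2), of 0 "H t"] \<Gamma>[OF t(1)] by simp
    ultimately show ?thesis
      unfolding A V[OF tI] using eq[of w] by (simp add: \<Gamma>t lorentz_metric_eq)
  qed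
  have dom: "Y t \<in> chart_dom A i" if "t \<in> ?J" "\<Gamma> t \<in> chart_dom ?T i" for t i using \<Gamma>[OF that(1)] that(2) by simp
  show "lightlike_geodesic ?T (lorentz_metric g\<^sub>0 \<omega> \<Lambda> 0) ?J \<Gamma>"
    unfolding lightlike_geodesic_def is_geodesic_def
  proof (intro conjI sc ballI impI allI)
    fix i t w assume "i \<in> index ?T" "t \<in> ?J" "\<Gamma> t \<in> chart_dom ?T i"
    then have "i \<in> index A" "Y t \<in> chart_dom A i" using dom by simp_all
    then show "lightlike (lorentz_metric g\<^sub>0 \<omega> \<Lambda> 0) i (\<Gamma> t) (velocity ?T i ?J \<Gamma> t)"
      "lorentz_metric g\<^sub>0 \<omega> \<Lambda> 0 i (\<Gamma> t) (vector_derivative (velocity ?T i ?J \<Gamma>) (at t within ?J)) w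
      + christoffel ?T (lorentz_metric g\<^sub>0 \<omega> \<Lambda> 0) i (\<Gamma> t) (velocity ?T i ?J \<Gamma> t) (velocity ?T i ?J \<Gamma> t) w = 0"
      using main \<open>t \<in> ?J\<close> by blast+
  qed
qed

text \<open>Parametrized by time, the curve has velocity \<xi> divided by \<open>snd \<xi>\<close>:
  it is null by homogeneity and its time component is 1.\<close>

lemma future_pointing_of_germs:
  assumes Hinj: "\<And>s r. 0 \<le> s \<Longrightarrow> s < r \<Longrightarrow> r \<le> 1 \<Longrightarrow> H s < H r" and Hcont: "continuous_on {0..1} H"
    and germ: "\<And>i s. i \<in> index A \<Longrightarrow> s \<in> {0..1} \<Longrightarrow> Y s \<in> chart_dom A i \<Longrightarrow>
      \<exists>d>0. \<exists>\<xi>. null_germ i Y H ({0..1} \<inter> ball s d) \<xi>"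
    and \<gamma>: "\<And>s. s \<in> {0..1} \<Longrightarrow> \<gamma> (H s) = (Y s, H s)"
  shows "future_pointing_curve A (lorentz_metric g\<^sub>0 \<omega> \<Lambda> 0) {H 0..H 1} \<gamma>"
proof -
  let ?J = "{0..1::real}"
  have inj: "inj_on H ?J"
  proof (rule inj_onI)
    fix x y assume "x \<in> ?J" "y \<in> ?J" "H x = H y"
    then show "x = y" using Hinj[of x y] Hinj[of y x] by (cases x y rule: linorder_cases) auto
  qed
  define G' where "G' = inv_into ?J H"
  have G': "G' (H s) = s" if "s \<in> ?J" for s using inj that by (simp add: G'_def)
  have mono: "H s \<le> H r" if "0 \<le> s" "s \<le> r" "r \<le> 1" for s r
    using Hinj[of s r] that by (cases "s = r") auto
  have img: "H ` ?J = {H 0..H 1}"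
  proof
    show "H ` ?J \<subseteq> {H 0..H 1}" using mono by auto
    show "{H 0..H 1} \<subseteq> H ` ?J"
    proof
      fix t assume "t \<in> {H 0..H 1}"
      then obtain s where "0 \<le> s" "s \<le> 1" "H s = t" using IVT'[of H 0 t 1] Hcont by auto
      then show "t \<in> H ` ?J" by auto
    qed
  qed
  have "H 0 < H 1" using Hinj[of 0 1] by simp
  show ?thesis
    unfolding future_pointing_curve_def
  proof (intro ballI impI)
    fix i t assume i: "i \<in> index A" and t: "t \<in> {H 0..H 1}" "\<gamma> t \<in> chart_dom (times_line A) i"
    obtain s where s: "s \<in> ?J" "t = H s" using t(1) img by blast
    have Ys: "Y s \<in> chart_dom A i" using t(2) \<gamma>[OF s(1)] s(2) by simp
    obtain d \<xi> where d: "0 < d" and g: "null_germ i Y H (?J \<inter> ball s d) \<xi>" using germ[OF i s(1) Ys] by blast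
    have sI: "s \<in> ?J \<inter> ball s d" using s(1) d by simp
    have at: "at s within (?J \<inter> ball s d) = at s within ?J" using at_within_Int_ball[OF d, of s s ?J] d by simp
    have \<xi>: "((\<lambda>s. (chart A i (Y s), H s)) has_vector_derivative \<xi> s) (at s within ?J)"
      "0 < snd (\<xi> s)" "M i (chart A i (Y s)) (\<xi> s) (\<xi> s) = 0"
      using g sI unfolding null_germ_def at[symmetric] by blast+
    have "(H has_vector_derivative snd (\<xi> s)) (at s within ?J)"
      using bounded_linear.has_vector_derivative[OF bounded_linear_snd \<xi>(1)] by simp
    from inverse_has_vector_derivative[OF Hcont G' s(1) this] \<xi>(2)
    have G1: "(G' has_vector_derivative 1 / snd (\<xi> s)) (at t within {H 0..H 1})" by (simp add: img s(2))
    have Gim: "G' ` {H 0..H 1} = ?J" using G' unfolding img[symmetric] by force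
    have "((\<lambda>s. (chart A i (Y s), H s)) has_vector_derivative \<xi> s) (at (G' t) within G' ` {H 0..H 1})"
      using \<xi>(1) G'[OF s(1)] by (simp only: Gim s(2))
    from vector_diff_chain_within[OF G1 this]
    have "((\<lambda>t. (chart A i (Y (G' t)), H (G' t))) has_vector_derivative (1 / snd (\<xi> s)) *\<^sub>R \<xi> s) (at t within {H 0..H 1})"
      by (simp add: o_def)
    then have "((\<lambda>t. chart (times_line A) i (\<gamma> t)) has_vector_derivative (1 / snd (\<xi> s)) *\<^sub>R \<xi> s) (at t within {H 0..H 1})"
    proof (rule has_vector_derivative_transform[OF t(1), rotated])
      fix r assume "r \<in> {H 0..H 1}"
      then obtain u where "u \<in> ?J" "r = H u" using img by blast
      then show "chart (times_line A) i (\<gamma> r) = (chart A i (Y (G' r)), H (G' r))" using G' \<gamma> by simp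
    qed
    then have V: "velocity (times_line A) i {H 0..H 1} \<gamma> t = (1 / snd (\<xi> s)) *\<^sub>R \<xi> s"
      unfolding velocity_def by (rule vector_derivative_within[OF at_within_Icc_not_bot[OF \<open>H 0 < H 1\<close> t(1)]])
    have q: "chart A i (Y s) \<in> X i" using Ys by blast
    have \<gamma>t: "\<gamma> t = (chart_inv A i (chart A i (Y s)), t)" using \<gamma>[OF s(1)] s(2) chart_inv_chart[OF i Ys] by simp
    have "lorentz_metric g\<^sub>0 \<omega> \<Lambda> 0 i (\<gamma> t) ((1 / snd (\<xi> s)) *\<^sub>R \<xi> s) ((1 / snd (\<xi> s)) *\<^sub>R \<xi> s) = 0"
      unfolding \<gamma>t lorentz_metric_eq bilinear_lmul[OF M_bilinear[OF i q]] bilinear_rmul[OF M_bilinear[OF i q]] \<xi>(3)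
      by simp
    moreover have "snd ((1 / snd (\<xi> s)) *\<^sub>R \<xi> s) = 1" using \<xi>(2) by simp
    then have "(1 / snd (\<xi> s)) *\<^sub>R \<xi> s \<noteq> 0" by (metis snd_zero zero_neq_one)
    ultimately show "future_pointing (lorentz_metric g\<^sub>0 \<omega> \<Lambda> 0) i (\<gamma> t) (velocity (times_line A) i {H 0..H 1} \<gamma> t)"
      unfolding V future_pointing_def causal_def using \<open>snd ((1 / snd (\<xi> s)) *\<^sub>R \<xi> s) = 1\<close> by simp
  qed
qed

text \<open>An upper bound needs only one competitor: the straight segment in the chart, which stays
  in the convex set \<open>Q\<close>, with time running linearly.\<close>

lemma product_distance_le:
  assumes i: "i \<in> index A" and C: "chart_bound i Q C" and Q: "convex Q" "Q \<subseteq> X i"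
    and x: "x \<in> chart_dom A i" "chart A i x \<in> Q" and x': "x' \<in> chart_dom A i" "chart A i x' \<in> Q"
  shows "product_distance A g\<^sub>0 (x, t) (x', t') \<le> C * (norm (chart A i x' - chart A i x) + \<bar>t' - t\<bar>)"
proof -
  let ?T = "times_line A" and ?F = "\<lambda>i z w. sqrt (g\<^sub>0 i (fst z) (fst w) (fst w) + (snd w)\<^sup>2)"
  define q where "q = chart A i x"
  define h where "h = chart A i x' - chart A i x"
  define p where "p = (\<lambda>u :: real. q + u *\<^sub>R h)"
  define \<Gamma> where "\<Gamma> = (\<lambda>u :: real. (chart_inv A i (p u), t + u * (t' - t)))"
  define B where "B = C * (norm h + \<bar>t' - t\<bar>)"
  let ?J = "{0..1::real}"
  have C1: "1 \<le> C" using C by (simp add: chart_bound_def)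
  have pQ: "p u \<in> Q" if "u \<in> ?J" for u
  proof -
    have "p u = (1 - u) *\<^sub>R chart A i x + u *\<^sub>R chart A i x'" by (simp add: p_def q_def h_def algebra_simps)
    then show ?thesis using convexD[OF Q(1) x(2) x'(2), of "1 - u" u] that by simp
  qed
  have pX: "p u \<in> X i" if "u \<in> ?J" for u using pQ[OF that] Q(2) by blast
  have pd: "(p has_vector_derivative h) (at u within T)" for u T
    unfolding p_def by (auto intro!: derivative_eq_intros simp: has_vector_derivative_def)
  have p_smooth: "path_Ck k T p" for k T
  proof (cases k)
    case 0
    then show ?thesis by (simp add: p_def) (intro continuous_intros)
  next
    case (Suc k)
    then show ?thesis using pd path_Ck_const by (auto intro!: exI[of _ "\<lambda>_. h"])
  qed
  have td: "((\<lambda>u. t + u * (t' - t)) has_vector_derivative t' - t) (at u within T)" for u T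
    by (auto intro!: derivative_eq_intros simp: has_real_derivative_iff_has_vector_derivative[symmetric])
  have t_smooth: "path_Ck k T (\<lambda>u. t + u * (t' - t))" for k T
  proof (cases k)
    case 0
    then show ?thesis by simp (intro continuous_intros)
  next
    case (Suc k)
    then show ?thesis using td path_Ck_const by (auto intro!: exI[of _ "\<lambda>_. t' - t"])
  qed
  have cont: "continuous_on ?J (\<lambda>u. chart_inv A i (p u))"
    using path_Ck_continuous[OF p_smooth] pX by (intro continuous_on_compose2[OF continuous_chart_inv[OF i]]) auto
  have contG: "continuous_on ?J \<Gamma>"
    unfolding \<Gamma>_def by (intro continuous_on_Pair cont path_Ck_continuous[OF t_smooth])
  \<comment> \<open>The segment is given in the chart \<open>i\<close>, but smoothness and length
    refer to arbitrary charts \<open>j\<close>; the transition maps relate the two.\<close>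
  have trans: "p u \<in> chart A i ` (chart_dom A i \<inter> chart_dom A j)" "chart A j (fst (\<Gamma> u)) = transition A i j (p u)"
    if "u \<in> ?J" "fst (\<Gamma> u) \<in> chart_dom A j" for j u
  proof -
    have "chart_inv A i (p u) \<in> chart_dom A i \<inter> chart_dom A j"
      using that(2) chart_inv_in_dom[OF i pX[OF that(1)]] by (simp add: \<Gamma>_def)
    moreover have "chart A i (chart_inv A i (p u)) = p u" by (rule chart_chart_inv[OF i pX[OF that(1)]])
    ultimately show "p u \<in> chart A i ` (chart_dom A i \<inter> chart_dom A j)" by (metis image_eqI)
    show "chart A j (fst (\<Gamma> u)) = transition A i j (p u)" by (simp add: transition_def \<Gamma>_def)
  qed
  have smooth_trans: "smooth_on (transition A i j) (chart A i ` (chart_dom A i \<inter> chart_dom A j))"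
    if "j \<in> index A" for j using atlas i that by (simp add: smooth_atlas_def)
  have nbhd: "\<exists>e>0. ?J \<inter> ball u e \<subseteq> {u \<in> ?J. fst (\<Gamma> u) \<in> chart_dom A j}"
    if j: "j \<in> index A" and u: "u \<in> ?J" "fst (\<Gamma> u) \<in> chart_dom A j" for j u
  proof -
    have "continuous_on ?J (\<lambda>u. fst (\<Gamma> u))" using contG by (rule continuous_on_fst)
    from continuous_on_ball_preimage[OF this open_dom[OF j] u(1,2)]
    obtain e where "0 < e" "\<And>s. s \<in> ?J \<Longrightarrow> dist u s < e \<Longrightarrow> fst (\<Gamma> s) \<in> chart_dom A j" by metis
    then show ?thesis by (intro exI[of _ e]) auto
  qed
  have "smooth_curve ?T ?J \<Gamma>"
    unfolding smooth_curve_def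
  proof (intro conjI contG ballI)
    fix j assume "j \<in> index ?T"
    then have j: "j \<in> index A" by simp
    define S where "S = {u \<in> ?J. fst (\<Gamma> u) \<in> chart_dom A j}"
    have S: "u \<in> ?J" "fst (\<Gamma> u) \<in> chart_dom A j" if "u \<in> S" for u using that by (auto simp: S_def)
    have "path_Ck k S (\<lambda>u. (chart A j (fst (\<Gamma> u)), snd (\<Gamma> u)))" for k
    proof -
      have "Ck_on k (transition A i j) (chart A i ` (chart_dom A i \<inter> chart_dom A j))"
        using smooth_trans[OF j] by (simp add: smooth_on_def)
      then have "path_Ck k S (\<lambda>u. transition A i j (p u))"
        by (rule path_Ck_compose[OF _ p_smooth]) (use trans(1) S in blast)
      from path_Ck_Pair[OF this t_smooth]
      show ?thesis by (rule path_Ck_cong) (use trans(2) S in \<open>simp add: \<Gamma>_def\<close>)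
    qed
    then have "smooth_path S (\<lambda>u. (chart A j (fst (\<Gamma> u)), snd (\<Gamma> u)))"
    proof (intro smooth_path_local)
      fix u assume u: "u \<in> S"
      obtain e where "0 < e" "?J \<inter> ball u e \<subseteq> S" using nbhd[OF j S[OF u]] by (auto simp: S_def)
      then have "at u within S = at u within ?J" by (rule at_within_subset_ball) (auto simp: S_def)
      then show "at u within S \<noteq> bot" using at_within_Icc_not_bot[OF zero_less_one S(1)[OF u]] by simp
    qed (use path_Ck_subset[of _ S] in \<open>meson Int_lower1 zero_less_one\<close>)
    then show "smooth_path {t \<in> ?J. \<Gamma> t \<in> chart_dom ?T j} (\<lambda>t. chart ?T j (\<Gamma> t))"
      by (simp add: S_def mem_Times_iff)
  qed
  then have "piecewise_smooth_curve ?T \<Gamma>"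
    unfolding piecewise_smooth_curve_def
    by (auto simp: smooth_curve_def intro!: exI[of _ "1::nat"] exI[of _ "real"])
  moreover have "\<Gamma> 0 = (x, t)" "\<Gamma> 1 = (x', t')"
    using chart_inv_chart[OF i x(1)] chart_inv_chart[OF i x'(1)] by (simp_all add: \<Gamma>_def p_def q_def h_def)
  ultimately have mem: "curve_length ?T ?F \<Gamma> \<in>
      {curve_length ?T ?F \<sigma> |\<sigma>. piecewise_smooth_curve ?T \<sigma> \<and> \<sigma> 0 = (x, t) \<and> \<sigma> 1 = (x', t')}" by blast
  have chT: "chart_at ?T z \<in> index A" "fst z \<in> chart_dom A (chart_at ?T z)" for z
  proof -
    have "chart_at A (fst z) \<in> index ?T \<and> z \<in> chart_dom ?T (chart_at A (fst z))"
      using chart_at[of "fst z"] by (simp add: mem_Times_iff)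
    then have "chart_at ?T z \<in> index ?T \<and> z \<in> chart_dom ?T (chart_at ?T z)"
      unfolding chart_at_def[of ?T] by (rule someI)
    then show "chart_at ?T z \<in> index A" "fst z \<in> chart_dom A (chart_at ?T z)" by (auto simp: mem_Times_iff)
  qed
  have g0: "0 \<le> g\<^sub>0 j y v v" if "j \<in> index A" "y \<in> chart_dom A j" for j y v
    using G_nonneg[of j "chart A j y" v] chart_inv_chart[OF that] that by (simp add: G_def)
  have "0 \<le> ?F (chart_at ?T z) z w" for z w using g0[OF chT] by simp
  then have "0 \<le> curve_length ?T ?F \<sigma>" for \<sigma>
    unfolding curve_length_def by (intro integral_nonneg_or_zero)
  then have bdd: "bdd_below {curve_length ?T ?F \<sigma> |\<sigma>. piecewise_smooth_curve ?T \<sigma> \<and> \<sigma> 0 = (x, t) \<and> \<sigma> 1 = (x', t')}"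
    by (intro bdd_belowI[of _ 0]) auto
  have le: "?F (chart_at ?T (\<Gamma> u)) (\<Gamma> u) (velocity ?T (chart_at ?T (\<Gamma> u)) ?J \<Gamma> u) \<le> B" if u: "u \<in> ?J" for u
  proof -
    define j where "j = chart_at ?T (\<Gamma> u)"
    have j: "j \<in> index A" "fst (\<Gamma> u) \<in> chart_dom A j" using chT by (auto simp: j_def)
    let ?y = "chart_inv A i (p u)"
    have y: "?y \<in> chart_dom A i \<inter> chart_dom A j" "chart A i ?y = p u"
      using j(2) chart_inv_in_dom[OF i pX[OF u]] chart_chart_inv[OF i pX[OF u]] by (auto simp: \<Gamma>_def)
    have "(transition A i j has_derivative frechet_derivative (transition A i j) (at (p u))) (at (p u))"
      by (rule smooth_on_has_derivative[OF smooth_trans[OF j(1)] trans(1)[OF u j(2)]])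
    from vector_derivative_diff_chain_within[OF pd[of u ?J] has_derivative_at_withinI[OF this]]
    have "((\<lambda>u. transition A i j (p u)) has_vector_derivative coord_change A i j ?y h) (at u within ?J)"
      by (simp add: o_def coord_change_def y(2))
    then have d: "((\<lambda>u. (transition A i j (p u), t + u * (t' - t))) has_vector_derivative
        (coord_change A i j ?y h, t' - t)) (at u within ?J)"
      by (rule has_vector_derivative_Pair[OF _ td])
    have "((\<lambda>u. chart ?T j (\<Gamma> u)) has_vector_derivative (coord_change A i j ?y h, t' - t)) (at u within ?J)"
      by (rule has_vector_derivative_transform[OF u _ d]) (simp add: \<Gamma>_def transition_def)
    then have V: "velocity ?T j ?J \<Gamma> u = (coord_change A i j ?y h, t' - t)"
      unfolding velocity_def by (rule vector_derivative_within[OF at_within_Icc_not_bot[OF zero_less_one u]])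
    have "g\<^sub>0 j ?y (coord_change A i j ?y h) (coord_change A i j ?y h) = g\<^sub>0 i ?y h h"
      using metric i j(1) y(1) unfolding riemannian_metric_def by blast
    also have "\<dots> = M i (p u) (h, 0) (h, 0)" by (simp add: M_def G_def)
    also have "\<dots> \<le> C * norm h * norm h"
      using chart_boundD(1)[OF C pQ[OF u], of "(h, 0)" "(h, 0)"] by (simp add: norm_Pair)
    also have "\<dots> \<le> C\<^sup>2 * (norm h)\<^sup>2"
      using mult_right_mono[of 1 C "C * (norm h * norm h)"] C1 by (simp add: power2_eq_square mult.assoc)
    finally have 1: "g\<^sub>0 j ?y (coord_change A i j ?y h) (coord_change A i j ?y h) \<le> C\<^sup>2 * (norm h)\<^sup>2" .
    have "1 * (t' - t)\<^sup>2 \<le> C\<^sup>2 * (t' - t)\<^sup>2" using C1 by (intro mult_right_mono) auto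
    moreover have "0 \<le> C\<^sup>2 * (2 * (norm h * \<bar>t' - t\<bar>))" by simp
    moreover have "B\<^sup>2 = C\<^sup>2 * (norm h)\<^sup>2 + C\<^sup>2 * \<bar>t' - t\<bar>\<^sup>2 + C\<^sup>2 * (2 * (norm h * \<bar>t' - t\<bar>))"
      by (simp add: B_def power2_eq_square algebra_simps del: abs_mult_self_eq)
    ultimately have "g\<^sub>0 j ?y (coord_change A i j ?y h) (coord_change A i j ?y h) + (t' - t)\<^sup>2 \<le> B\<^sup>2"
      using 1 unfolding power2_abs by linarith
    moreover have "0 \<le> B" using C1 by (simp add: B_def)
    ultimately have "sqrt (g\<^sub>0 j ?y (coord_change A i j ?y h) (coord_change A i j ?y h) + (t' - t)\<^sup>2) \<le> B"
      by (intro real_le_lsqrt) simp_all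
    then show ?thesis unfolding j_def[symmetric] V by (simp add: \<Gamma>_def)
  qed
  have "curve_length ?T ?F \<Gamma> \<le> B"
  proof (cases "(\<lambda>u. ?F (chart_at ?T (\<Gamma> u)) (\<Gamma> u) (velocity ?T (chart_at ?T (\<Gamma> u)) ?J \<Gamma> u)) integrable_on ?J")
    case True
    then have "((\<lambda>u. ?F (chart_at ?T (\<Gamma> u)) (\<Gamma> u) (velocity ?T (chart_at ?T (\<Gamma> u)) ?J \<Gamma> u)) has_integral
        curve_length ?T ?F \<Gamma>) ?J"
      unfolding curve_length_def by (rule integrable_integral)
    from has_integral_le[OF this has_integral_const_real[of B 0 1] le] show ?thesis by simp
  next
    case False
    then show ?thesis using C1 by (simp add: curve_length_def not_integrable_integral B_def)
  qed
  then show ?thesis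
    unfolding product_distance_def path_distance_def
    by (intro order_trans[OF cInf_lower[OF mem bdd]]) (simp add: B_def h_def)
qed

end


subsection \<open>Convergence of a subsequence\<close>

lemma smooth_path_pos_imp_less:
  fixes h :: "real \<Rightarrow> real"
  assumes "smooth_path {c..d} h" "\<And>s. s \<in> {c..d} \<Longrightarrow> 0 < vector_derivative h (at s within {c..d})"
    and "c \<le> s" "s < r" "r \<le> d"
  shows "h s < h r"
proof (rule vector_derivative_pos_imp_less[OF _ assms(2-5)])
  fix x assume x: "x \<in> {c..d}"
  have "path_Ck (Suc 0) {c..d} h" by (rule smooth_path_imp_path_Ck[OF assms(1)])
  then obtain h' where h': "(h has_vector_derivative h' x) (at x within {c..d})"
    unfolding path_Ck.simps using x by blast
  have "c < d" using assms(3-5) by linarith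
  then have "vector_derivative h (at x within {c..d}) = h' x"
    by (rule vector_derivative_within[OF at_within_Icc_not_bot[OF _ x] h'])
  then show "(h has_vector_derivative vector_derivative h (at x within {c..d})) (at x within {c..d})"
    using h' by simp
qed

lemma t1_space_eqI:
  fixes a b :: "'b::t1_space"
  assumes "\<And>V. open V \<Longrightarrow> a \<in> V \<Longrightarrow> b \<in> V"
  shows "a = b"
  using assms t1_space by blast

context stationary
begin

lemma pregeodesic_parametrization:
  assumes geo: "lightlike_pregeodesic (times_line A) (lorentz_metric g\<^sub>0 \<omega> \<Lambda> \<epsilon>) a b \<gamma>"
    and \<gamma>: "\<And>t. t \<in> {a..b} \<Longrightarrow> \<gamma> t = (\<sigma> t, t)"
  shows "\<exists>y \<tau> v a' \<tau>1 \<tau>2. null_geodesic \<epsilon> 0 1 y \<tau> v a' \<tau>1 \<tau>2 \<and> smooth_curve A {0..1} y \<and>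
    \<tau> 0 = a \<and> \<tau> 1 = b \<and> (\<forall>s\<in>{0..1}. \<tau> s \<in> {a..b} \<and> y s = \<sigma> (\<tau> s))"
proof -
  obtain c d h where cd: "c < d" and h: "h c = a" "h d = b" "smooth_path {c..d} h"
    "\<And>s. s \<in> {c..d} \<Longrightarrow> 0 < vector_derivative h (at s within {c..d})"
    and G: "lightlike_geodesic (times_line A) (lorentz_metric g\<^sub>0 \<omega> \<Lambda> \<epsilon>) {c..d} (\<gamma> \<circ> h)"
    using geo unfolding lightlike_pregeodesic_def by blast
  have mono: "h s \<le> h r" if "c \<le> s" "s \<le> r" "r \<le> d" for s r
    using smooth_path_pos_imp_less[OF h(3,4), of s r] that by (cases "s = r") auto
  have hab: "h s \<in> {a..b}" if "s \<in> {c..d}" for s using mono[of c s] mono[of s d] that h(1,2) by auto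
  have "snd ((\<gamma> \<circ> h) s) = h s" if "s \<in> {c..d}" for s using \<gamma>[OF hab[OF that]] by simp
  then obtain v a' \<tau>1 \<tau>2 where n: "null_geodesic \<epsilon> c d (\<lambda>s. fst ((\<gamma> \<circ> h) s)) h v a' \<tau>1 \<tau>2"
    using lightlike_geodesic_imp_null_geodesic[OF cd G h(3,4)] by blast
  define l where "l = d - c"
  have l: "0 < l" "c + l * 0 = c" "c + l * 1 = d" using cd by (simp_all add: l_def)
  have img: "c + l * s \<in> {c..d}" if "s \<in> {0..1}" for s
  proof -
    have "l * s \<le> l" "0 \<le> l * s" using that l(1) mult_left_le[of s l] by simp_all
    then show ?thesis using l(3) by simp
  qed
  have "smooth_curve (times_line A) {c..d} (\<gamma> \<circ> h)"
    using G by (simp add: lightlike_geodesic_def is_geodesic_def)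
  from smooth_curve_affine[OF smooth_curve_fst[OF this], of c l "{0..1}"]
  have "smooth_curve A {0..1} (\<lambda>s. fst ((\<gamma> \<circ> h) (c + l * s)))" using img by blast
  moreover have "fst ((\<gamma> \<circ> h) (c + l * s)) = \<sigma> (h (c + l * s))" if "s \<in> {0..1}" for s
    using \<gamma>[OF hab[OF img[OF that]]] by simp
  moreover have "h (c + l * 0) = a" "h (c + l * 1) = b" using l h by simp_all
  ultimately show ?thesis
    using null_geodesic_affine[OF n l] hab[OF img] by blast
qed

text \<open>Elapsed time bounds the distance from the start to \<open>y s\<close> and from
  \<open>y s\<close> to the end, and neither part takes longer than the whole.\<close>

lemma null_geodesic_trapped:
  assumes n: "null_geodesic \<epsilon> 0 1 y \<tau> v a \<tau>1 \<tau>2" and y: "smooth_curve A {0..1} y"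
    and e: "0 < \<epsilon>'" "\<epsilon> \<le> \<epsilon>'" and R: "\<tau> 1 - \<tau> 0 < R" and s: "s \<in> {0..1}"
  shows "y s \<in> closure (forward_ball A (randers g\<^sub>0 \<omega> \<Lambda> \<epsilon>') (y 0) R) \<inter>
    closure (backward_ball A (randers g\<^sub>0 \<omega> \<Lambda> \<epsilon>') (y 1) R)"
proof -
  have "\<tau> 0 \<le> \<tau> s" using null_geodesic_increments[OF n, of 0 s] s by (cases "s = 0") auto
  moreover have "\<tau> s \<le> \<tau> 1" using null_geodesic_increments[OF n, of s 1] s by (cases "s = 1") auto
  ultimately have "path_distance A (randers g\<^sub>0 \<omega> \<Lambda> \<epsilon>') (y 0) (y s) < R"
    "path_distance A (randers g\<^sub>0 \<omega> \<Lambda> \<epsilon>') (y s) (y 1) < R"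
    using path_distance_le_time[OF n y e, of 0 s] path_distance_le_time[OF n y e, of s 1] s R by auto
  then show ?thesis
    using closure_subset by (fastforce simp: forward_ball_def backward_ball_def)
qed

text \<open>If the arrival times tended to 0, equicontinuity would identify the end points, leaving
  short loops. After rescaling to parameter length equal to elapsed time their mean time speed is 1,
  and \<open>time_speed_ratio\<close> puts \<tau>1 into the range that
  \<open>no_short_null_loop\<close> requires.\<close>

lemma null_geodesics_time_positive:
  assumes n: "\<And>n. null_geodesic (\<epsilon> n) 0 1 (y n) (\<tau> n) (v n) (a n) (\<tau>1 n) (\<tau>2 n)"
    and e: "\<And>n. 0 < \<epsilon> n" "\<And>n. \<epsilon> n \<le> 1"
    and K: "compact K" "\<And>n s. s \<in> {0..1} \<Longrightarrow> y n s \<in> K"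
    and ends: "\<And>n. y n 0 = x\<^sub>0" "\<And>n. y n 1 = x\<^sub>1" "\<And>n. \<tau> n 1 - \<tau> n 0 = D n" and D: "D \<longlonglongrightarrow> \<Delta>"
  shows "0 < \<Delta>"
proof (rule ccontr)
  have Dpos: "0 < D n" for n using null_geodesic_increments[OF n, of 0 1 n] ends(3)[of n] by simp
  then have "0 \<le> \<Delta>" using LIMSEQ_le_const[OF D, of 0] by (meson less_imp_le)
  moreover assume "\<not> 0 < \<Delta>"
  ultimately have D0: "D \<longlonglongrightarrow> 0" using D by simp
  have small: "\<forall>\<^sub>F n in sequentially. D n < \<delta>" if "0 < \<delta>" for \<delta> using order_tendstoD(2)[OF D0 that] .
  have x01: "x\<^sub>0 = x\<^sub>1"
  proof (rule t1_space_eqI)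
    fix V assume V: "open V" "x\<^sub>0 \<in> V"
    obtain U C \<delta> where U: "open U" "x\<^sub>0 \<in> U" "closed C" "C \<subseteq> V" "0 < \<delta>"
      "\<And>\<epsilon> c d y \<tau> v a \<tau>1 \<tau>2 s r. null_geodesic \<epsilon> c d y \<tau> v a \<tau>1 \<tau>2 \<Longrightarrow> 0 \<le> \<epsilon> \<Longrightarrow> \<epsilon> \<le> 1 \<Longrightarrow>
       s \<in> {c..d} \<Longrightarrow> r \<in> {c..d} \<Longrightarrow> y s \<in> U \<Longrightarrow> \<bar>\<tau> r - \<tau> s\<bar> < \<delta> \<Longrightarrow> y r \<in> C"
      by (rule null_geodesic_equicontinuous[OF V]) (rule that; assumption)
    obtain n0 where "D n0 < \<delta>" using eventually_happens[OF small[OF U(5)]] by auto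
    then have "y n0 1 \<in> C"
      using U(6)[OF n less_imp_le[OF e(1)] e(2), of 0 1 n0] ends U(2) Dpos[of n0] by simp
    then show "x\<^sub>1 \<in> V" using U(4) ends(2) by auto
  qed
  obtain \<delta> where \<delta>: "0 < \<delta>"
    and loop: "\<And>\<epsilon> D y \<tau> v a \<tau>1 \<tau>2. null_geodesic \<epsilon> 0 D y \<tau> v a \<tau>1 \<tau>2 \<Longrightarrow> 0 < \<epsilon> \<Longrightarrow> \<epsilon> \<le> 1 \<Longrightarrow>
       D < \<delta> \<Longrightarrow> \<tau> D - \<tau> 0 < \<delta> \<Longrightarrow> \<forall>s\<in>{0..D}. 1 / 2 \<le> \<tau>1 s \<and> \<tau>1 s \<le> 2 \<Longrightarrow> y 0 = x\<^sub>0 \<Longrightarrow> y D \<noteq> x\<^sub>0"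
    by (rule no_short_null_loop[of x\<^sub>0]) (rule that; assumption)
  obtain B where B: "0 < B"
    "\<And>\<epsilon> c d y \<tau> v a \<tau>1 \<tau>2 s. null_geodesic \<epsilon> c d y \<tau> v a \<tau>1 \<tau>2 \<Longrightarrow> 0 \<le> \<epsilon> \<Longrightarrow> \<epsilon> \<le> 1 \<Longrightarrow>
       s \<in> {c..d} \<Longrightarrow> y s \<in> K \<Longrightarrow> \<bar>\<tau>2 s\<bar> \<le> B * (\<tau>1 s)\<^sup>2"
    by (rule time_acceleration_bound[OF K(1)]) (rule that; assumption)
  \<comment> \<open>This is the factor by which \<tau>1 may deviate from its mean; once it is below
    2, the rescaled speed lies in [1/2, 2].\<close>
  have "(\<lambda>n. exp (B * D n)) \<longlonglongrightarrow> exp (B * 0)" by (intro tendsto_intros D0)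
  then have "\<forall>\<^sub>F n in sequentially. exp (B * D n) < 2" by (intro order_tendstoD(2)) auto
  from eventually_happens[OF eventually_conj[OF this small[OF \<delta>]]]
  obtain m where m: "exp (B * D m) < 2" "D m < \<delta>" by auto
  let ?l = "1 / D m"
  have Dm: "0 < D m" by (rule Dpos)
  have l: "0 < ?l" "0 + ?l * 0 = 0" "0 + ?l * D m = 1" using Dm by simp_all
  have bounds: "\<forall>s\<in>{0..D m}. 1 / 2 \<le> ?l * \<tau>1 m (0 + ?l * s) \<and> ?l * \<tau>1 m (0 + ?l * s) \<le> 2"
  proof
    fix s assume "s \<in> {0..D m}"
    then have s: "0 + ?l * s \<in> {0..1}" using Dm by (simp add: pos_divide_le_eq)
    note r = time_speed_ratio[OF n[of m] B(2)[OF n[of m] less_imp_le[OF e(1)] e(2) _ K(2)] less_imp_le[OF B(1)] s]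
    have r1: "D m * exp (- B * D m) \<le> \<tau>1 m (0 + ?l * s)" "\<tau>1 m (0 + ?l * s) \<le> D m * exp (B * D m)"
      using r by (simp_all add: ends)
    have "exp (- B * D m) = 1 / exp (B * D m)" by (simp add: exp_minus divide_inverse)
    moreover have "1 / 2 \<le> 1 / exp (B * D m)" using m(1) by (intro divide_left_mono) auto
    ultimately have "1 / 2 \<le> exp (- B * D m)" by simp
    then have "D m * (1 / 2) \<le> D m * exp (- B * D m)" using Dm by (intro mult_left_mono) auto
    then have 1: "D m * (1 / 2) \<le> \<tau>1 m (0 + ?l * s)" using r1 by linarith
    have "D m * exp (B * D m) \<le> D m * 2" using m(1) Dm by (intro mult_left_mono) auto
    then have 2: "\<tau>1 m (0 + ?l * s) \<le> D m * 2" using r1 by linarith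
    show "1 / 2 \<le> ?l * \<tau>1 m (0 + ?l * s) \<and> ?l * \<tau>1 m (0 + ?l * s) \<le> 2"
      using 1 2 Dm by (simp add: pos_le_divide_eq pos_divide_le_eq mult.commute)
  qed
  have "y m (0 + ?l * D m) \<noteq> x\<^sub>0"
    by (rule loop[OF null_geodesic_affine[OF n[of m] l] e(1) e(2) m(2) _ bounds])
      (use ends m(2) l(2,3) in simp_all)
  then show False using ends x01 l(3) by simp
qed

text \<open>The curves are compared as functions of the time coordinate, where they are uniformly
  Lipschitz, and as affinely parametrized geodesics, where the geodesic equation passes to the
  limit; \<open>H\<close> is the limit of the affine parametrizations.\<close>

lemma null_geodesics_limit:
  assumes n: "\<And>n. null_geodesic (\<epsilon> n) 0 1 (y n) (\<tau> n) (v n) (a n) (\<tau>1 n) (\<tau>2 n)"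
    and e: "\<And>n. 0 < \<epsilon> n" "\<And>n. \<epsilon> n \<le> 1" "\<epsilon> \<longlonglongrightarrow> 0"
    and K: "compact K" "\<And>n s. s \<in> {0..1} \<Longrightarrow> y n s \<in> K"
    and ends: "\<And>n. y n 0 = x\<^sub>0" "\<And>n. y n 1 = x\<^sub>1" "\<And>n. \<tau> n 0 = t\<^sub>0" "\<And>n. \<tau> n 1 = t\<^sub>0 + D n"
    and D: "D \<longlonglongrightarrow> \<Delta>" "0 < \<Delta>" "\<And>n. \<Delta> / 2 \<le> D n" "\<And>n. D n \<le> \<Delta> + 1"
    and f: "\<And>n s. s \<in> {0..1} \<Longrightarrow> f n (\<tau> n s) = y n s" "\<And>n t. t\<^sub>0 + D n < t \<Longrightarrow> f n t = x\<^sub>1"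
  shows "\<exists>k F H. strict_mono (k :: nat \<Rightarrow> nat) \<and> continuous_on {t\<^sub>0..t\<^sub>0 + \<Delta> + 1} F \<and>
    (\<forall>t\<in>{t\<^sub>0..t\<^sub>0 + \<Delta> + 1}. \<forall>V. open V \<longrightarrow> F t \<in> V \<longrightarrow>
      (\<exists>\<delta>>0. \<exists>N. \<forall>n\<ge>N. \<forall>s\<in>{t\<^sub>0..t\<^sub>0 + \<Delta> + 1}. \<bar>s - t\<bar> < \<delta> \<longrightarrow> f (k n) s \<in> V)) \<and>
    continuous_on {0..1} H \<and> H 0 = t\<^sub>0 \<and> H 1 = t\<^sub>0 + \<Delta> \<and> (\<forall>s\<in>{0..1}. H s \<in> {t\<^sub>0..t\<^sub>0 + \<Delta> + 1}) \<and>
    F t\<^sub>0 = x\<^sub>0 \<and> F (t\<^sub>0 + \<Delta>) = x\<^sub>1 \<and>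
    (\<forall>i\<in>index A. \<forall>s\<in>{0..1}. F (H s) \<in> chart_dom A i \<longrightarrow>
      (\<exists>d>0. \<exists>\<xi>. null_germ i (\<lambda>s. F (H s)) H ({0..1} \<inter> ball s d) \<xi>))"
proof -
  let ?T = "{t\<^sub>0..t\<^sub>0 + \<Delta> + 1}" and ?J = "{0..1::real}"
  obtain B where B: "0 < B"
    "\<And>\<epsilon> c d y \<tau> v a \<tau>1 \<tau>2 s. null_geodesic \<epsilon> c d y \<tau> v a \<tau>1 \<tau>2 \<Longrightarrow> 0 \<le> \<epsilon> \<Longrightarrow> \<epsilon> \<le> 1 \<Longrightarrow>
       s \<in> {c..d} \<Longrightarrow> y s \<in> K \<Longrightarrow> \<bar>\<tau>2 s\<bar> \<le> B * (\<tau>1 s)\<^sup>2"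
    by (rule time_acceleration_bound[OF K(1)]) (rule that; assumption)
  \<comment> \<open>Bounds from \<open>time_speed_ratio\<close>: over [0, 1] the mean time speed is
    \<open>D n\<close>, which lies between \<Delta> / 2 and \<Delta> + 1. Here the positivity of
    \<Delta> gives \<open>0 < c\<close>.\<close>
  define c where "c = \<Delta> / 2 * exp (- B * (\<Delta> + 1))"
  define b where "b = (\<Delta> + 1) * exp (B * (\<Delta> + 1))"
  have cb: "0 < c" "0 < b" using D(2) by (simp_all add: c_def b_def)
  have speed: "c \<le> \<tau>1 n s" "\<tau>1 n s \<le> b" if s: "s \<in> ?J" for n s
  proof -
    note r = time_speed_ratio[OF n[of n] B(2)[OF n[of n] less_imp_le[OF e(1)] e(2) _ K(2)] less_imp_le[OF B(1)] s]
    have r1: "D n * exp (- B * D n) \<le> \<tau>1 n s" "\<tau>1 n s \<le> D n * exp (B * D n)"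
      using r by (simp_all add: ends)
    have "c \<le> D n * exp (- B * D n)" unfolding c_def
      using D(2) D(3)[of n] D(4)[of n] B(1) by (intro mult_mono) auto
    then show "c \<le> \<tau>1 n s" using r1 by linarith
    have "D n * exp (B * D n) \<le> b" unfolding b_def
      using D(2) D(3)[of n] D(4)[of n] B(1) by (intro mult_mono) auto
    then show "\<tau>1 n s \<le> b" using r1 by linarith
  qed
  have mono: "\<tau> n s \<le> \<tau> n r" if "0 \<le> s" "s \<le> r" "r \<le> 1" for n s r
    using null_geodesic_increments[OF n, of s r n] that by (cases "s = r") auto
  have \<tau>range: "t\<^sub>0 \<le> \<tau> n s" "\<tau> n s \<le> t\<^sub>0 + D n" if "s \<in> ?J" for n s
    using mono[of 0 s n] mono[of s 1 n] that ends by auto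
  have \<tau>T: "\<tau> n s \<in> ?T" if "s \<in> ?J" for n s using \<tau>range[OF that, of n] D(4)[of n] by simp
  have \<tau>lip: "\<bar>\<tau> n s - \<tau> n r\<bar> \<le> b * \<bar>s - r\<bar>" if "s \<in> ?J" "r \<in> ?J" for n s r
  proof -
    have "norm (\<tau> n s - \<tau> n r) \<le> b * \<bar>s - r\<bar>"
    proof (rule vector_derivative_bound[OF null_geodesicD(4)[OF n] _ that])
      show "norm (\<tau>1 n x) \<le> b" if "x \<in> ?J" for x using speed[OF that, of n] cb by simp
    qed
    then show ?thesis by simp
  qed
  \<comment> \<open>The vertically extended curve is the geodesic with its time stopped at arrival.
    Taking \<open>min\<close> does not increase time differences, so equicontinuity persists across
    the arrival.\<close>
  have fy: "\<exists>u\<in>?J. f n t = y n u \<and> \<tau> n u = min t (t\<^sub>0 + D n)" if "t \<in> ?T" for n t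
  proof (cases "t \<le> t\<^sub>0 + D n")
    case True
    have "continuous_on ?J (\<tau> n)" using null_geodesicD(4)[OF n] by (rule continuous_on_vector_derivative)
    then have "\<exists>u. 0 \<le> u \<and> u \<le> 1 \<and> \<tau> n u = t"
      by (intro IVT') (use True that ends in simp_all)
    then obtain u where "0 \<le> u" "u \<le> 1" "\<tau> n u = t" by blast
    then show ?thesis using f(1)[of u n] True by (intro bexI[of _ u]) auto
  next
    case False
    then show ?thesis using f(2)[of n t] ends by (intro bexI[of _ 1]) auto
  qed
  have "t\<^sub>0 < t\<^sub>0 + \<Delta> + 1" using D(2) by simp
  then obtain k1 F where k1: "strict_mono (k1 :: nat \<Rightarrow> nat)" and Fcont: "continuous_on ?T F"
    and F: "\<And>t V. t \<in> ?T \<Longrightarrow> open V \<Longrightarrow> F t \<in> V \<Longrightarrow>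
      \<exists>\<delta>>0. \<exists>N. \<forall>n\<ge>N. \<forall>s\<in>?T. \<bar>s - t\<bar> < \<delta> \<longrightarrow> f (k1 n) s \<in> V"
  proof (rule Arzela_Ascoli_topological[OF _ K(1), of t\<^sub>0 "t\<^sub>0 + \<Delta> + 1" f])
    show "f n t \<in> K" if "t \<in> ?T" for n t using fy[OF that, of n] K(2) by auto
    fix p :: 'a and V assume V: "open V" "p \<in> V"
    obtain U C \<delta> where U: "open U" "p \<in> U" "closed C" "C \<subseteq> V" "0 < \<delta>"
      "\<And>\<epsilon> c d y \<tau> v a \<tau>1 \<tau>2 s r. null_geodesic \<epsilon> c d y \<tau> v a \<tau>1 \<tau>2 \<Longrightarrow> 0 \<le> \<epsilon> \<Longrightarrow> \<epsilon> \<le> 1 \<Longrightarrow>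
       s \<in> {c..d} \<Longrightarrow> r \<in> {c..d} \<Longrightarrow> y s \<in> U \<Longrightarrow> \<bar>\<tau> r - \<tau> s\<bar> < \<delta> \<Longrightarrow> y r \<in> C"
      by (rule null_geodesic_equicontinuous[OF V]) (rule that; assumption)
    have "f n t \<in> C" if st: "s \<in> ?T" "t \<in> ?T" "\<bar>s - t\<bar> < \<delta>" "f n s \<in> U" for n s t
    proof -
      obtain u where u: "u \<in> ?J" "f n s = y n u" "\<tau> n u = min s (t\<^sub>0 + D n)" using fy[OF st(1)] by blast
      obtain w where w: "w \<in> ?J" "f n t = y n w" "\<tau> n w = min t (t\<^sub>0 + D n)" using fy[OF st(2)] by blast
      have "\<bar>\<tau> n w - \<tau> n u\<bar> < \<delta>" using st(3) u(3) w(3) by linarith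
      then show ?thesis using U(6)[OF n less_imp_le[OF e(1)] e(2) u(1) w(1)] u(2) w(2) st(4) by simp
    qed
    then show "\<exists>U C \<delta>. open U \<and> p \<in> U \<and> closed C \<and> C \<subseteq> V \<and> 0 < \<delta> \<and>
        (\<forall>n. \<forall>s\<in>?T. \<forall>t\<in>?T. \<bar>s - t\<bar> < \<delta> \<longrightarrow> f n s \<in> U \<longrightarrow> f n t \<in> C)"
      using U(1-5) by (intro exI[of _ U] exI[of _ C] exI[of _ \<delta>]) auto
  qed (rule that; assumption)
  \<comment> \<open>A second extraction: the time functions of the affine parametrizations share the
    Lipschitz constant \<open>b\<close>.\<close>
  obtain H k2 where Hcont: "continuous_on ?J H" and k2: "strict_mono (k2 :: nat \<Rightarrow> nat)"
    and H: "\<And>e. 0 < e \<Longrightarrow> \<exists>N. \<forall>n x. n \<ge> N \<and> x \<in> ?J \<longrightarrow> norm (\<tau> (k1 (k2 n)) x - H x) < e"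
  proof (rule Arzela_Ascoli[of ?J "\<lambda>n. \<tau> (k1 n)" "\<bar>t\<^sub>0\<bar> + \<Delta> + 1"])
    show "compact ?J" by simp
    show "norm (\<tau> (k1 n) x) \<le> \<bar>t\<^sub>0\<bar> + \<Delta> + 1" if "x \<in> ?J" for n x using \<tau>T[OF that, of "k1 n"] D(2) by auto
    fix x and e' :: real assume x: "x \<in> ?J" "0 < e'"
    show "\<exists>d>0. \<forall>n z. z \<in> ?J \<and> norm (x - z) < d \<longrightarrow> norm (\<tau> (k1 n) x - \<tau> (k1 n) z) < e'"
    proof (intro exI[of _ "e' / b"] conjI allI impI)
      show "0 < e' / b" using x(2) cb by simp
      fix n z assume z: "z \<in> ?J \<and> norm (x - z) < e' / b"
      then have "b * \<bar>x - z\<bar> < e'" using cb(2) by (simp add: pos_less_divide_eq mult.commute)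
      then show "norm (\<tau> (k1 n) x - \<tau> (k1 n) z) < e'" using \<tau>lip[OF x(1), of z "k1 n"] z by simp
    qed
  qed (rule that; assumption)
  define k where "k = (\<lambda>n. k1 (k2 n))"
  have k: "strict_mono k" using strict_mono_o[OF k1 k2] by (simp add: k_def o_def)
  have Fk: "\<exists>\<delta>>0. \<exists>N. \<forall>n\<ge>N. \<forall>s\<in>?T. \<bar>s - t\<bar> < \<delta> \<longrightarrow> f (k n) s \<in> V"
    if tV: "t \<in> ?T" "open V" "F t \<in> V" for t V
  proof -
    obtain \<delta> N where d: "0 < \<delta>" and N: "\<forall>n\<ge>N. \<forall>s\<in>?T. \<bar>s - t\<bar> < \<delta> \<longrightarrow> f (k1 n) s \<in> V"
      using F[OF tV] by blast
    have "k2 n \<ge> N" if "n \<ge> N" for n using seq_suble[OF k2, of n] that by linarith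
    then show ?thesis using d N unfolding k_def by (intro exI[of _ \<delta>] conjI exI[of _ N]) auto
  qed
  have Hlim: "(\<lambda>n. \<tau> (k n) s) \<longlonglongrightarrow> H s" if "s \<in> ?J" for s
    unfolding LIMSEQ_iff k_def using H that by blast
  have HT: "H s \<in> ?T" if "s \<in> ?J" for s
  proof (rule Lim_in_closed_set[OF closed_atLeastAtMost _ sequentially_bot Hlim[OF that]])
    show "\<forall>\<^sub>F n in sequentially. \<tau> (k n) s \<in> ?T" by (rule always_eventually) (use \<tau>T[OF that] in blast)
  qed
  have Dk: "(\<lambda>n. D (k n)) \<longlonglongrightarrow> \<Delta>" using LIMSEQ_subseq_LIMSEQ[OF D(1) k] by (simp add: o_def)
  have H0: "H 0 = t\<^sub>0" using Hlim[of 0] ends by (simp add: LIMSEQ_const_iff)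
  have "(\<lambda>n. t\<^sub>0 + D (k n)) \<longlonglongrightarrow> t\<^sub>0 + \<Delta>" by (intro tendsto_intros Dk)
  then have H1: "H 1 = t\<^sub>0 + \<Delta>" using Hlim[of 1] ends LIMSEQ_unique by auto
  \<comment> \<open>The affine curve is \<open>f (k n)\<close> evaluated at the times
    \<open>\<tau> (k n) r\<close>, which converge uniformly; convergence of \<open>f\<close> at
    moving times applies.\<close>
  have Yconv: "\<exists>\<delta>>0. \<exists>N. \<forall>n\<ge>N. \<forall>r\<in>?J. \<bar>r - s\<bar> < \<delta> \<longrightarrow> y (k n) r \<in> V"
    if s: "s \<in> ?J" and V: "open V" "F (H s) \<in> V" for s V
  proof -
    obtain \<delta> N where d: "0 < \<delta>" and N: "\<forall>n\<ge>N. \<forall>t\<in>?T. \<bar>t - H s\<bar> < \<delta> \<longrightarrow> f (k n) t \<in> V"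
      using Fk[OF HT[OF s] V] by blast
    obtain d' where d': "0 < d'" "\<And>r. r \<in> ?J \<Longrightarrow> dist r s < d' \<Longrightarrow> dist (H r) (H s) < \<delta> / 2"
      using Hcont s d unfolding continuous_on_iff by (meson half_gt_zero)
    obtain N' where N': "\<And>n x. n \<ge> N' \<Longrightarrow> x \<in> ?J \<Longrightarrow> norm (\<tau> (k n) x - H x) < \<delta> / 2"
      using H[of "\<delta> / 2"] d unfolding k_def by auto
    have "y (k n) r \<in> V" if r: "n \<ge> max N N'" "r \<in> ?J" "\<bar>r - s\<bar> < d'" for n r
    proof -
      have "\<bar>\<tau> (k n) r - H r\<bar> < \<delta> / 2" "\<bar>H r - H s\<bar> < \<delta> / 2"
        using N'[of n r] d'(2)[of r] r by (simp_all add: dist_real_def)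
      then have "\<bar>\<tau> (k n) r - H s\<bar> < \<delta>" by linarith
      then have "f (k n) (\<tau> (k n) r) \<in> V" using N \<tau>T[OF r(2), of "k n"] r(1) by simp
      then show ?thesis using f(1)[OF r(2)] by simp
    qed
    then show ?thesis using d'(1) by blast
  qed
  have germ: "\<exists>d>0. \<exists>\<xi>. null_germ i (\<lambda>s. F (H s)) H (?J \<inter> ball s d) \<xi>"
    if i: "i \<in> index A" and s: "s \<in> ?J" "F (H s) \<in> chart_dom A i" for i s
  proof -
    have ek: "(\<lambda>n. \<epsilon> (k n)) \<longlonglongrightarrow> 0" using LIMSEQ_subseq_LIMSEQ[OF e(3) k] by (simp add: o_def)
    have Tb: "\<bar>\<tau> (k n) r\<bar> \<le> \<bar>t\<^sub>0\<bar> + \<Delta> + 1" if "r \<in> ?J" for n r using \<tau>T[OF that, of "k n"] D(2) by auto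
    show ?thesis
      by (rule limit_null_germ[where y="\<lambda>n. y (k n)" and Y="\<lambda>s. F (H s)", OF n e(1,2) ek cb(1) speed Tb Yconv Hlim i s])
        (assumption | rule exI conjI)+
  qed
  have F0: "F t\<^sub>0 = x\<^sub>0"
  proof (rule t1_space_eqI)
    fix V assume V: "open V" "F t\<^sub>0 \<in> V"
    have t0: "t\<^sub>0 \<in> ?T" using D(2) by simp
    obtain \<delta> N where d: "0 < \<delta>" "\<forall>n\<ge>N. \<forall>s\<in>?T. \<bar>s - t\<^sub>0\<bar> < \<delta> \<longrightarrow> f (k n) s \<in> V" using Fk[OF t0 V] by blast
    then have "f (k N) t\<^sub>0 \<in> V" using t0 by simp
    then show "x\<^sub>0 \<in> V" using f(1)[of 0 "k N"] ends by simp
  qed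
  \<comment> \<open>The arrival times move with \<open>n\<close>, so convergence at the fixed time
    \<open>t\<^sub>0 + \<Delta>\<close> would not do: evaluation at the moving times puts
    \<open>x\<^sub>1\<close> into every neighbourhood of the limit.\<close>
  have F1: "F (t\<^sub>0 + \<Delta>) = x\<^sub>1"
  proof (rule t1_space_eqI)
    fix V assume V: "open V" "F (t\<^sub>0 + \<Delta>) \<in> V"
    have t1: "t\<^sub>0 + \<Delta> \<in> ?T" using D(2) by simp
    obtain \<delta> N where d: "0 < \<delta>" "\<forall>n\<ge>N. \<forall>s\<in>?T. \<bar>s - (t\<^sub>0 + \<Delta>)\<bar> < \<delta> \<longrightarrow> f (k n) s \<in> V" using Fk[OF t1 V] by blast
    obtain N' where N': "\<forall>n\<ge>N'. norm (D (k n) - \<Delta>) < \<delta>" using LIMSEQ_D[OF Dk d(1)] by blast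
    let ?m = "max N N'"
    have "t\<^sub>0 + D (k ?m) \<in> ?T" using D(2) D(3)[of "k ?m"] D(4)[of "k ?m"] by simp
    moreover have "\<bar>t\<^sub>0 + D (k ?m) - (t\<^sub>0 + \<Delta>)\<bar> < \<delta>" using N'[rule_format, of ?m] by simp
    ultimately have "f (k ?m) (t\<^sub>0 + D (k ?m)) \<in> V" using d(2) by simp
    then show "x\<^sub>1 \<in> V" using f(1)[of 1 "k ?m"] ends by simp
  qed
  show ?thesis
    by (rule exI[of _ k], rule exI[of _ F], rule exI[of _ H])
      (intro conjI ballI allI impI k Fcont Fk Hcont H0 H1 HT F0 F1 germ; assumption)
qed

text \<open>Neighbourhoods are translated into distances chart by chart through
  \<open>product_distance_le\<close>, and a finite subcover of the interval makes the index
  uniform.\<close>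

lemma product_distance_uniform:
  fixes f :: "nat \<Rightarrow> real \<Rightarrow> 'a"
  assumes ab: "a \<le> b" and F: "continuous_on {a..b} F"
    and conv: "\<And>t V. t \<in> {a..b} \<Longrightarrow> open V \<Longrightarrow> F t \<in> V \<Longrightarrow>
      \<exists>\<delta>>0. \<exists>N. \<forall>n\<ge>N. \<forall>s\<in>{a..b}. \<bar>s - t\<bar> < \<delta> \<longrightarrow> f n s \<in> V"
    and e: "0 < e"
  shows "\<exists>N. \<forall>n\<ge>N. \<forall>t\<in>{a..b}. product_distance A g\<^sub>0 (f n t, t) (F t, t) < e"
proof -
  have loc: "\<exists>\<delta>>0. \<exists>N. \<forall>n\<ge>N. \<forall>s\<in>{a..b}. \<bar>s - t\<bar> < \<delta> \<longrightarrow> product_distance A g\<^sub>0 (f n s, s) (F s, s) < e"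
    if t: "t \<in> {a..b}" for t
  proof -
    define i where "i = chart_at A (F t)"
    have i: "i \<in> index A" "F t \<in> chart_dom A i" using chart_at by (auto simp: i_def)
    obtain r where r: "0 < r" "cball (chart A i (F t)) r \<subseteq> X i"
      by (rule chart_neighbourhood[OF open_UNIV UNIV_I i]) (rule that)
    obtain C where C: "chart_bound i (cball (chart A i (F t)) r) C"
      using chart_bound_exists[OF i(1) compact_cball r(2)] by blast
    have C1: "1 \<le> C" using C by (simp add: chart_bound_def)
    \<comment> \<open>Two points of the ball of radius \<rho> are at distance at most
      \<open>C * (2 * \<rho>)\<close>, hence at most two thirds of \<open>e\<close>;
      \<open>\<rho> \<le> r\<close> keeps them where \<open>C\<close> is valid.\<close>
    define \<rho> where "\<rho> = min r (e / (3 * C))"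
    have \<rho>: "0 < \<rho>" "\<rho> \<le> r" "\<rho> \<le> e / (3 * C)" using r(1) e C1 by (simp_all add: \<rho>_def)
    define V where "V = {x \<in> chart_dom A i. chart A i x \<in> ball (chart A i (F t)) \<rho>}"
    have V: "open V" "F t \<in> V"
      using open_chart_preimage[OF i(1) open_ball] i(2) \<rho>(1) by (simp_all add: V_def)
    have VQ: "x \<in> chart_dom A i" "chart A i x \<in> cball (chart A i (F t)) r" if "x \<in> V" for x
      using that \<rho>(2) by (auto simp: V_def)
    have close: "product_distance A g\<^sub>0 (x, s) (x', s) < e" if "x \<in> V" "x' \<in> V" for x x' s
    proof -
      have "product_distance A g\<^sub>0 (x, s) (x', s) \<le> C * (norm (chart A i x' - chart A i x) + \<bar>s - s\<bar>)"
        by (rule product_distance_le[OF i(1) C convex_cball r(2) VQ[OF that(1)] VQ[OF that(2)]])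
      also have "\<dots> = C * dist (chart A i x') (chart A i x)" by (simp add: dist_norm)
      also have "\<dots> \<le> C * (2 * \<rho>)"
        using that C1 dist_triangle3[of "chart A i x'" "chart A i x" "chart A i (F t)"]
        by (intro mult_left_mono) (auto simp: V_def)
      also have "\<dots> \<le> C * (2 * (e / (3 * C)))" using \<rho>(3) C1 by (intro mult_left_mono) auto
      also have "\<dots> < e" using e C1 by (simp add: field_simps)
      finally show ?thesis .
    qed
    obtain \<delta> N where d: "0 < \<delta>" and N: "\<forall>n\<ge>N. \<forall>s\<in>{a..b}. \<bar>s - t\<bar> < \<delta> \<longrightarrow> f n s \<in> V"
      using conv[OF t V] by blast
    obtain \<delta>' where d': "0 < \<delta>'" "\<And>s. s \<in> {a..b} \<Longrightarrow> dist t s < \<delta>' \<Longrightarrow> F s \<in> V"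
      using continuous_on_ball_preimage[OF F V(1) t V(2)] by blast
    have "product_distance A g\<^sub>0 (f n s, s) (F s, s) < e"
      if "n \<ge> N" "s \<in> {a..b}" "\<bar>s - t\<bar> < min \<delta> \<delta>'" for n s
      using N d'(2)[of s] that by (intro close) (auto simp: dist_real_def abs_minus_commute)
    then show ?thesis using d d'(1) by (intro exI[of _ "min \<delta> \<delta>'"] conjI exI[of _ N]) auto
  qed
  define P where "P = (\<lambda>t \<delta> N. 0 < \<delta> \<and> (\<forall>n\<ge>N. \<forall>s\<in>{a..b}. \<bar>s - t\<bar> < \<delta> \<longrightarrow> product_distance A g\<^sub>0 (f n s, s) (F s, s) < e))"
  have "\<exists>\<delta> N. P t \<delta> N" if "t \<in> {a..b}" for t
    using loc[OF that] by (elim exE conjE) (intro exI, unfold P_def, rule conjI)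
  then obtain \<delta> N where P: "\<And>t. t \<in> {a..b} \<Longrightarrow> P t (\<delta> t) (N t)" by metis
  obtain S where S: "S \<subseteq> {a..b}" "finite S" "{a..b} \<subseteq> (\<Union>t\<in>S. ball t (\<delta> t))"
  proof (rule compactE_image[OF compact_Icc[of a b], of "{a..b}" "\<lambda>t. ball t (\<delta> t)"])
    show "{a..b} \<subseteq> (\<Union>t\<in>{a..b}. ball t (\<delta> t))"
    proof
      fix t assume t: "t \<in> {a..b}"
      then have "t \<in> ball t (\<delta> t)" using P[OF t] by (simp add: P_def)
      with t show "t \<in> (\<Union>t\<in>{a..b}. ball t (\<delta> t))" by blast
    qed
    show "open (ball t (\<delta> t))" for t by simp
  qed (rule that; assumption)
  show ?thesis
  proof (intro exI[of _ "Max (insert 0 (N ` S))"] allI impI ballI)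
    fix n s assume n: "Max (insert 0 (N ` S)) \<le> n" and s: "s \<in> {a..b}"
    obtain t where t: "t \<in> S" "s \<in> ball t (\<delta> t)" using S(3) s by blast
    have "N t \<le> Max (insert 0 (N ` S))" using S(2) t(1) by simp
    then have "N t \<le> n" using n by linarith
    moreover have "\<bar>s - t\<bar> < \<delta> t" using t(2) by (simp add: dist_real_def abs_minus_commute)
    ultimately show "product_distance A g\<^sub>0 (f n s, s) (F s, s) < e"
      using P[of t] S(1) t(1) s unfolding P_def by blast
  qed
qed

end

theorem proposition3p8:
  fixes A :: "('i, 'a::{t2_space, second_countable_topology}, 'e::euclidean_space) atlas"
    and g\<^sub>0 :: "'i \<Rightarrow> 'a \<Rightarrow> 'e \<Rightarrow> 'e \<Rightarrow> real"
    and \<omega> :: "'i \<Rightarrow> 'a \<Rightarrow> 'e \<Rightarrow> real"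
    and \<Lambda> :: "'a \<Rightarrow> real"
    and x\<^sub>0 x\<^sub>1 :: 'a and t\<^sub>0 \<Delta> :: real
    and \<epsilon> \<Delta>s :: "nat \<Rightarrow> real"
    and \<sigma> :: "nat \<Rightarrow> real \<Rightarrow> 'a"
    and \<gamma> :: "nat \<Rightarrow> real \<Rightarrow> 'a \<times> real"
  assumes atlas: "smooth_atlas A"
    and connected: "connected (UNIV :: 'a set)"
    and dim: "2 \<le> DIM('e)"
    and metric: "riemannian_metric A g\<^sub>0"
    and form: "smooth_one_form A \<omega>"
    and form_nonzero: "\<forall>i\<in>index A. \<forall>x\<in>chart_dom A i. \<omega> i x \<noteq> (\<lambda>_. 0)"
    and Lambda_smooth: "smooth_function A \<Lambda>"
    and Lambda_nonneg: "\<forall>x. 0 \<le> \<Lambda> x"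
    and balls_compact: "\<exists>\<epsilon>b. 0 < \<epsilon>b \<and> \<epsilon>b \<le> 1 \<and>
          (\<forall>x y r s. 0 < r \<longrightarrow> 0 < s \<longrightarrow>
             compact (closure (forward_ball A (randers g\<^sub>0 \<omega> \<Lambda> \<epsilon>b) x r) \<inter>
                      closure (backward_ball A (randers g\<^sub>0 \<omega> \<Lambda> \<epsilon>b) y s)))"
    and eps_pos: "\<forall>n. 0 < \<epsilon> n" and eps_lim: "\<epsilon> \<longlonglongrightarrow> 0"
    and Delta_pos: "\<forall>n. 0 < \<Delta>s n" and Delta_lim: "\<Delta>s \<longlonglongrightarrow> \<Delta>"
    and param: "\<forall>n. \<forall>t\<in>{t\<^sub>0..t\<^sub>0 + \<Delta>s n}. \<gamma> n t = (\<sigma> n t, t)"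
    and start: "\<forall>n. \<gamma> n t\<^sub>0 = (x\<^sub>0, t\<^sub>0)"
    and finish: "\<forall>n. \<gamma> n (t\<^sub>0 + \<Delta>s n) = (x\<^sub>1, t\<^sub>0 + \<Delta>s n)"
    and pregeodesics: "\<forall>n. lightlike_pregeodesic (times_line A) (lorentz_metric g\<^sub>0 \<omega> \<Lambda> (\<epsilon> n))
          t\<^sub>0 (t\<^sub>0 + \<Delta>s n) (\<gamma> n)"
  shows "\<exists>(k :: nat \<Rightarrow> nat) (\<sigma>' :: real \<Rightarrow> 'a) (\<gamma>' :: real \<Rightarrow> 'a \<times> real).
           strict_mono k \<and>
           (\<forall>t\<in>{t\<^sub>0..t\<^sub>0 + \<Delta> + 1}. \<gamma>' t = (\<sigma>' t, t)) \<and>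
           continuous_on {t\<^sub>0..t\<^sub>0 + \<Delta> + 1} \<gamma>' \<and>
           (\<forall>e>0. \<exists>N. \<forall>n\<ge>N. \<forall>t\<in>{t\<^sub>0..t\<^sub>0 + \<Delta> + 1}.
              product_distance A g\<^sub>0
                (extend_vertically x\<^sub>1 (t\<^sub>0 + \<Delta>s (k n)) (\<gamma> (k n)) t) (\<gamma>' t) < e) \<and>
           lightlike_pregeodesic (times_line A) (lorentz_metric g\<^sub>0 \<omega> \<Lambda> 0) t\<^sub>0 (t\<^sub>0 + \<Delta>) \<gamma>' \<and>
           future_pointing_curve A (lorentz_metric g\<^sub>0 \<omega> \<Lambda> 0) {t\<^sub>0..t\<^sub>0 + \<Delta>} \<gamma>' \<and>
           \<gamma>' t\<^sub>0 = (x\<^sub>0, t\<^sub>0) \<and>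
           \<gamma>' (t\<^sub>0 + \<Delta>) = (x\<^sub>1, t\<^sub>0 + \<Delta>)"
proof -
  interpret stationary A g\<^sub>0 \<omega> \<Lambda>
    by (unfold_locales) (fact atlas metric form form_nonzero Lambda_smooth Lambda_nonneg)+
  obtain \<epsilon>b where \<epsilon>b: "0 < \<epsilon>b" "\<epsilon>b \<le> 1"
    and compact_balls: "\<And>x y r s. 0 < r \<Longrightarrow> 0 < s \<Longrightarrow>
      compact (closure (forward_ball A (randers g\<^sub>0 \<omega> \<Lambda> \<epsilon>b) x r) \<inter>
               closure (backward_ball A (randers g\<^sub>0 \<omega> \<Lambda> \<epsilon>b) y s))"
    using balls_compact by blast
  \<comment> \<open>Eventually above all arrival times, so one pair of radii serves a whole tail of
    the sequence.\<close>
  let ?R = "\<Delta> + 1"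
  have Delta0: "0 \<le> \<Delta>" using LIMSEQ_le_const[OF Delta_lim, of 0] Delta_pos by (meson less_imp_le)
  then have R: "0 < ?R" by simp
  define K where "K = closure (forward_ball A (randers g\<^sub>0 \<omega> \<Lambda> \<epsilon>b) x\<^sub>0 ?R) \<inter>
    closure (backward_ball A (randers g\<^sub>0 \<omega> \<Lambda> \<epsilon>b) x\<^sub>1 ?R)"
  have K: "compact K" unfolding K_def by (rule compact_balls[OF R R])
  define P where "P = (\<lambda>n y \<tau> v a' \<tau>1 \<tau>2. null_geodesic (\<epsilon> n) 0 1 y \<tau> v a' \<tau>1 \<tau>2 \<and> smooth_curve A {0..1} y \<and>
    \<tau> 0 = t\<^sub>0 \<and> \<tau> 1 = t\<^sub>0 + \<Delta>s n \<and> (\<forall>s\<in>{0..1}. \<tau> s \<in> {t\<^sub>0..t\<^sub>0 + \<Delta>s n} \<and> y s = \<sigma> n (\<tau> s)))"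
  have "\<exists>y \<tau> v a' \<tau>1 \<tau>2. P n y \<tau> v a' \<tau>1 \<tau>2" for n
    unfolding P_def by (rule pregeodesic_parametrization[OF pregeodesics[rule_format]]) (use param in blast)
  then obtain y \<tau> v a \<tau>1 \<tau>2 where P: "\<And>n. P n (y n) (\<tau> n) (v n) (a n) (\<tau>1 n) (\<tau>2 n)" by metis
  have geo: "null_geodesic (\<epsilon> n) 0 1 (y n) (\<tau> n) (v n) (a n) (\<tau>1 n) (\<tau>2 n)"
    and smooth: "smooth_curve A {0..1} (y n)" and ends: "\<tau> n 0 = t\<^sub>0" "\<tau> n 1 = t\<^sub>0 + \<Delta>s n"
    and range: "s \<in> {0..1} \<Longrightarrow> \<tau> n s \<in> {t\<^sub>0..t\<^sub>0 + \<Delta>s n}" and y: "s \<in> {0..1} \<Longrightarrow> y n s = \<sigma> n (\<tau> n s)"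
    for n s using P[of n] by (simp_all add: P_def)
  have \<sigma>ends: "\<sigma> n t\<^sub>0 = x\<^sub>0" "\<sigma> n (t\<^sub>0 + \<Delta>s n) = x\<^sub>1" for n
    using param[rule_format, of t\<^sub>0 n] param[rule_format, of "t\<^sub>0 + \<Delta>s n" n] start[rule_format, of n]
      finish[rule_format, of n] Delta_pos[rule_format, of n] by simp_all
  have yends: "y n 0 = x\<^sub>0" "y n 1 = x\<^sub>1" for n using y[of 0 n] y[of 1 n] ends \<sigma>ends by simp_all
  have "\<forall>\<^sub>F n in sequentially. \<epsilon> n < \<epsilon>b \<and> \<Delta>s n < ?R"
    using order_tendstoD(2)[OF eps_lim \<epsilon>b(1)] order_tendstoD(2)[OF Delta_lim, of ?R]
    by (simp add: eventually_conj)
  then obtain n0 where n0: "\<And>n. n \<ge> n0 \<Longrightarrow> \<epsilon> n < \<epsilon>b" "\<And>n. n \<ge> n0 \<Longrightarrow> \<Delta>s n < ?R"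
    unfolding eventually_sequentially by blast
  have inK: "y n s \<in> K" if "n \<ge> n0" "s \<in> {0..1}" for n s
  proof -
    have "\<tau> n 1 - \<tau> n 0 < ?R" using n0(2)[OF that(1)] ends by simp
    from null_geodesic_trapped[OF geo smooth \<epsilon>b(1) less_imp_le[OF n0(1)[OF that(1)]] this that(2)]
    show ?thesis by (simp add: yends K_def)
  qed
  have lims: "(\<lambda>n. \<epsilon> (n + m)) \<longlonglongrightarrow> 0" "(\<lambda>n. \<Delta>s (n + m)) \<longlonglongrightarrow> \<Delta>" for m
    by (rule LIMSEQ_ignore_initial_segment[OF eps_lim], rule LIMSEQ_ignore_initial_segment[OF Delta_lim])
  have e: "0 < \<epsilon> n" "n \<ge> n0 \<Longrightarrow> \<epsilon> n \<le> 1" for n using eps_pos n0(1)[of n] \<epsilon>b(2) by auto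
  \<comment> \<open>From \<open>n0\<close> on the curves lie in \<open>K\<close> and \<epsilon> is
    at most 1. Positivity of the limit in turn provides \<open>n1\<close>, beyond which the arrival
    times exceed \<Delta> / 2.\<close>
  have \<Delta>pos: "0 < \<Delta>"
  proof (rule null_geodesics_time_positive[where D="\<lambda>n. \<Delta>s (n + n0)" and y="\<lambda>n. y (n + n0)" and \<tau>="\<lambda>n. \<tau> (n + n0)",
        OF geo e(1) _ K _ yends])
    show "\<epsilon> (n + n0) \<le> 1" for n by (rule e(2)) simp
    show "y (n + n0) s \<in> K" if "s \<in> {0..1}" for n s by (rule inK[OF _ that]) simp
    show "\<tau> (n + n0) 1 - \<tau> (n + n0) 0 = \<Delta>s (n + n0)" for n by (simp add: ends)
  qed (rule lims)
  then obtain n1 where n1: "\<And>n. n \<ge> n1 \<Longrightarrow> \<Delta> / 2 < \<Delta>s n"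
    using order_tendstoD(1)[OF Delta_lim, of "\<Delta> / 2"] unfolding eventually_sequentially by auto
  define m where "m = max n0 n1"
  have m: "n + m \<ge> n0" "n + m \<ge> n1" for n by (simp_all add: m_def)
  \<comment> \<open>The spatial part of the vertically extended curve.\<close>
  define f where "f = (\<lambda>n t. if t \<le> t\<^sub>0 + \<Delta>s n then \<sigma> n t else x\<^sub>1)"
  have "\<exists>k F H. strict_mono (k :: nat \<Rightarrow> nat) \<and> continuous_on {t\<^sub>0..t\<^sub>0 + \<Delta> + 1} F \<and>
    (\<forall>t\<in>{t\<^sub>0..t\<^sub>0 + \<Delta> + 1}. \<forall>V. open V \<longrightarrow> F t \<in> V \<longrightarrow>
      (\<exists>\<delta>>0. \<exists>N. \<forall>n\<ge>N. \<forall>s\<in>{t\<^sub>0..t\<^sub>0 + \<Delta> + 1}. \<bar>s - t\<bar> < \<delta> \<longrightarrow> f (k n + m) s \<in> V)) \<and>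
    continuous_on {0..1} H \<and> H 0 = t\<^sub>0 \<and> H 1 = t\<^sub>0 + \<Delta> \<and> (\<forall>s\<in>{0..1}. H s \<in> {t\<^sub>0..t\<^sub>0 + \<Delta> + 1}) \<and>
    F t\<^sub>0 = x\<^sub>0 \<and> F (t\<^sub>0 + \<Delta>) = x\<^sub>1 \<and>
    (\<forall>i\<in>index A. \<forall>s\<in>{0..1}. F (H s) \<in> chart_dom A i \<longrightarrow>
      (\<exists>d>0. \<exists>\<xi>. null_germ i (\<lambda>s. F (H s)) H ({0..1} \<inter> ball s d) \<xi>))"
  proof (rule null_geodesics_limit[where f="\<lambda>n. f (n + m)" and D="\<lambda>n. \<Delta>s (n + m)" and y="\<lambda>n. y (n + m)"
        and \<tau>="\<lambda>n. \<tau> (n + m)", OF geo e(1) _ lims(1) K _ yends ends lims(2) \<Delta>pos])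
    show "\<epsilon> (n + m) \<le> 1" for n by (rule e(2)[OF m(1)])
    show "y (n + m) s \<in> K" if "s \<in> {0..1}" for n s by (rule inK[OF m(1) that])
    show "\<Delta> / 2 \<le> \<Delta>s (n + m)" "\<Delta>s (n + m) \<le> \<Delta> + 1" for n
      using n1[OF m(2), of n] n0(2)[OF m(1), of n] by simp_all
    show "f (n + m) (\<tau> (n + m) s) = y (n + m) s" if "s \<in> {0..1}" for n s
      using range[OF that, of "n + m"] y[OF that, of "n + m"] by (simp add: f_def)
    show "f (n + m) t = x\<^sub>1" if "t\<^sub>0 + \<Delta>s (n + m) < t" for n t using that by (simp add: f_def)
  qed
  then obtain k F H where k: "strict_mono (k :: nat \<Rightarrow> nat)" and Fcont: "continuous_on {t\<^sub>0..t\<^sub>0 + \<Delta> + 1} F"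
    and conv: "\<forall>t\<in>{t\<^sub>0..t\<^sub>0 + \<Delta> + 1}. \<forall>V. open V \<longrightarrow> F t \<in> V \<longrightarrow>
      (\<exists>\<delta>>0. \<exists>N. \<forall>n\<ge>N. \<forall>s\<in>{t\<^sub>0..t\<^sub>0 + \<Delta> + 1}. \<bar>s - t\<bar> < \<delta> \<longrightarrow> f (k n + m) s \<in> V)"
    and H: "continuous_on {0..1} H" "H 0 = t\<^sub>0" "H 1 = t\<^sub>0 + \<Delta>" "\<forall>s\<in>{0..1}. H s \<in> {t\<^sub>0..t\<^sub>0 + \<Delta> + 1}"
    and F: "F t\<^sub>0 = x\<^sub>0" "F (t\<^sub>0 + \<Delta>) = x\<^sub>1"
    and germ: "\<forall>i\<in>index A. \<forall>s\<in>{0..1}. F (H s) \<in> chart_dom A i \<longrightarrow>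
      (\<exists>d>0. \<exists>\<xi>. null_germ i (\<lambda>s. F (H s)) H ({0..1} \<inter> ball s d) \<xi>)"
    by (elim exE conjE) (rule that)
  define \<gamma>' where "\<gamma>' = (\<lambda>t. (F t, t))"
  have FH: "continuous_on {0..1} (\<lambda>s. F (H s))"
    by (rule continuous_on_compose2[OF Fcont H(1)]) (use H(4) in blast)
  have germ': "\<exists>d>0. \<exists>\<xi>. null_germ i (\<lambda>s. F (H s)) H ({0..1} \<inter> ball s d) \<xi>"
    if "i \<in> index A" "s \<in> {0..1}" "F (H s) \<in> chart_dom A i" for i s
    using germ that by blast
  note geo' = lightlike_geodesic_of_germs[OF FH germ', of "\<gamma>' \<circ> H"]
  have \<gamma>'H: "(\<gamma>' \<circ> H) s = (F (H s), H s)" for s by (simp add: \<gamma>'_def)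
  show ?thesis
  \<comment> \<open>\<open>k\<close> numbers the tail that begins at \<open>m\<close>, hence the
    shift in the subsequence.\<close>
  proof (rule exI[of _ "\<lambda>n. k n + m"], rule exI[of _ F], rule exI[of _ \<gamma>'], intro conjI ballI)
    show "strict_mono (\<lambda>n. k n + m)" using k by (simp add: strict_mono_def)
    show "\<gamma>' t = (F t, t)" for t by (simp add: \<gamma>'_def)
    show "continuous_on {t\<^sub>0..t\<^sub>0 + \<Delta> + 1} \<gamma>'"
      unfolding \<gamma>'_def by (intro continuous_on_Pair Fcont continuous_on_id)
    show "\<forall>e>0. \<exists>N. \<forall>n\<ge>N. \<forall>t\<in>{t\<^sub>0..t\<^sub>0 + \<Delta> + 1}. product_distance A g\<^sub>0
        (extend_vertically x\<^sub>1 (t\<^sub>0 + \<Delta>s (k n + m)) (\<gamma> (k n + m)) t) (\<gamma>' t) < e"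
    proof (intro allI impI)
      fix e :: real assume e: "0 < e"
      have "\<exists>N. \<forall>n\<ge>N. \<forall>t\<in>{t\<^sub>0..t\<^sub>0 + \<Delta> + 1}. product_distance A g\<^sub>0 (f (k n + m) t, t) (F t, t) < e"
        by (rule product_distance_uniform[OF _ Fcont _ e]) (use conv Delta0 in auto)
      moreover have "extend_vertically x\<^sub>1 (t\<^sub>0 + \<Delta>s n) (\<gamma> n) t = (f n t, t)" if "t \<in> {t\<^sub>0..t\<^sub>0 + \<Delta> + 1}" for n t
        using param that by (simp add: extend_vertically_def f_def)
      ultimately show "\<exists>N. \<forall>n\<ge>N. \<forall>t\<in>{t\<^sub>0..t\<^sub>0 + \<Delta> + 1}. product_distance A g\<^sub>0
        (extend_vertically x\<^sub>1 (t\<^sub>0 + \<Delta>s (k n + m)) (\<gamma> (k n + m)) t) (\<gamma>' t) < e"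
        by (simp add: \<gamma>'_def)
    qed
    show "lightlike_pregeodesic (times_line A) (lorentz_metric g\<^sub>0 \<omega> \<Lambda> 0) t\<^sub>0 (t\<^sub>0 + \<Delta>) \<gamma>'"
      unfolding lightlike_pregeodesic_def using geo'[OF _ _ _ \<gamma>'H] H(2,3)
      by (intro exI[of _ 0] exI[of _ 1] exI[of _ H]) simp
    have "future_pointing_curve A (lorentz_metric g\<^sub>0 \<omega> \<Lambda> 0) {H 0..H 1} \<gamma>'"
      by (rule future_pointing_of_germs[OF smooth_path_pos_imp_less[OF geo'(1,2)] H(1) germ'])
        (use \<gamma>'H in \<open>simp_all add: \<gamma>'_def\<close>)
    then show "future_pointing_curve A (lorentz_metric g\<^sub>0 \<omega> \<Lambda> 0) {t\<^sub>0..t\<^sub>0 + \<Delta>} \<gamma>'" by (simp add: H)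
    show "\<gamma>' t\<^sub>0 = (x\<^sub>0, t\<^sub>0)" "\<gamma>' (t\<^sub>0 + \<Delta>) = (x\<^sub>1, t\<^sub>0 + \<Delta>)" by (simp_all add: \<gamma>'_def F)
  qed
qed

end
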